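(* There exists a computable $C^{\infty}$ function $f:\mathbb{R}^7\to\mathbb{R}^7$ such that the ODE $x'=f(x)$ has a computable sink $s_0\in\mathbb{R}^7$ whose basin of attraction is non-computable. Moreover, this non-computability is robust and persists under small perturbations: there exists some $\varepsilon>0$ such that if $g:\mathbb{R}^7\to\mathbb{R}^7$ is another $C^\infty$ map with $\|f-g\|_1\le\varepsilon$, then the ODE $y'=g(y)$ also has a sink $s_g$ (computable from $g$ and located near the sink $s_0$ of $x'=f(x)$) whose basin of attraction, with respect to $y'=g(y)$, is non-computable.
   Context: Norms. $\|\cdot\|$ is the max-norm on $\mathbb{R}^d$, or the usual norm for matrices. For a $C^1$ map $h:\mathbb{R}^d\to\mathbb{R}^d$, $\|h\|_1=\sup_{x}\|h(x)\|+\sup_{x}\|Dh(x)\|$ (possibly $\infty$), suprema over $\mathbb{R}^d$. Dynamics. A sink of the ODE $x'=f(x)$ is a point $s$ with $f(s)=0$ such that all eigenvalues of $Df(s)$ have negative real part. Its basin of attraction is the (open) set of all $x_0\in\mathbb{R}^d$ such that the solution of $x'=f(x)$, $x(0)=x_0$, converges to $s$ as $t\to\infty$. "Located near $s_0$" is a qualitative statement; no explicit bound on $\|s_g-s_0\|$ is part of the claim. Computability. An oracle (name) for $x\in\mathbb{R}^d$ is a function $\varphi:\mathbb{N}\to\mathbb{Q}^d$ with $\|\varphi(m)-x\|<2^{-m}$ for all $m$; $x$ is computable if it has a computable oracle. A function $f:\mathbb{R}^d\to\mathbb{R}^l$ is computable if there is an oracle Turing machine which, given any oracle for any $x\in\mathbb{R}^d$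 and any $n\in\mathbb{N}$, outputs a rational point within distance $2^{-n}$ of $f(x)$. An open set $U\subsetneq\mathbb{R}^d$ is computable if the distance function $x\mapsto\inf_{y\in\mathbb{R}^d\setminus U}\|y-x\|$ is a computable function $\mathbb{R}^d\to\mathbb{R}$. "$s_g$ is computable from $g$" means that there is an algorithm which, given a name of $g$ (an encoding of $g$ from which $g$ can be evaluated to arbitrary precision at arbitrary points) and $n\in\mathbb{N}$, outputs a rational point within $2^{-n}$ of $s_g$. *)

theory Defs
  imports "HOL-Analysis.Analysis"
begin

section \<open>Norms, smoothness, sinks and basins\<close>

text \<open>
  The max-norm on $R^n$ is \<open>infnorm\<close> throughout. The matrix norm is the operator norm that it
  induces.
\<close>

definition mat_norm :: "real ^ 'n ^ 'm \<Rightarrow> real" where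
  "mat_norm A = (SUP v \<in> {v. infnorm v = 1}. infnorm (A *v v))"

definition C1_norm :: "(real ^ 'n \<Rightarrow> real ^ 'm) \<Rightarrow> ereal" where
  "C1_norm h = (SUP x. ereal (infnorm (h x))) + (SUP x. ereal (mat_norm (jacobian h (at x))))"

primrec C_k :: "nat \<Rightarrow> (real ^ 'n \<Rightarrow> real ^ 'm) \<Rightarrow> bool" where
  "C_k 0 f \<longleftrightarrow> continuous_on UNIV f"
| "C_k (Suc k) f \<longleftrightarrow>
     (\<forall>x. f differentiable (at x)) \<and> (\<forall>v. C_k k (\<lambda>x. frechet_derivative f (at x) v))"

definition C_infinity :: "(real ^ 'n \<Rightarrow> real ^ 'm) \<Rightarrow> bool" where
  "C_infinity f \<longleftrightarrow> (\<forall>k. C_k k f)"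

definition complex_eigenvalue :: "real ^ 'n ^ 'n \<Rightarrow> complex \<Rightarrow> bool" where
  "complex_eigenvalue A \<mu> \<longleftrightarrow>
     (\<exists>v :: complex ^ 'n. v \<noteq> 0 \<and> map_matrix complex_of_real A *v v = \<mu> *s v)"

definition is_sink :: "(real ^ 'n \<Rightarrow> real ^ 'n) \<Rightarrow> real ^ 'n \<Rightarrow> bool" where
  "is_sink f s \<longleftrightarrow>
     f s = 0 \<and> f differentiable (at s) \<and>
     (\<forall>\<mu>. complex_eigenvalue (jacobian f (at s)) \<mu> \<longrightarrow> Re \<mu> < 0)"

definition is_forward_solution ::
    "(real ^ 'n \<Rightarrow> real ^ 'n) \<Rightarrow> real ^ 'n \<Rightarrow> (real \<Rightarrow> real ^ 'n) \<Rightarrow> bool" where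
  "is_forward_solution f x0 x \<longleftrightarrow>
     x 0 = x0 \<and> (\<forall>t\<ge>0. (x has_vector_derivative f (x t)) (at t within {0..}))"

definition basin :: "(real ^ 'n \<Rightarrow> real ^ 'n) \<Rightarrow> real ^ 'n \<Rightarrow> (real ^ 'n) set" where
  "basin f s = {x0. \<exists>x. is_forward_solution f x0 x \<and> (x \<longlongrightarrow> s) at_top}"


section \<open>Oracle Turing machines\<close>

text \<open>
  Machines are deterministic and have finitely many two-way infinite tapes. Tape 0 carries the input
  and the output, tape 1 is the oracle tape, and all others are work tapes. The transition table is
  a finite list, so only finitely many states and \<open>Aux\<close> symbols are relevant to a given machine.
\<close>

type_synonym word = "bool list"

datatype symbol = Blank | Bit bool | Aux nat

datatype direction = Go_Left | Stay | Go_Right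

text \<open>
  In \<open>Tape l r\<close> the head is on the first cell of \<open>r\<close>, and \<open>l\<close> lists the cells to its left, nearest
  first. All cells that are not listed are blank.
\<close>

datatype tape = Tape "symbol list" "symbol list"

fun first_symbol :: "symbol list \<Rightarrow> symbol" where
  "first_symbol [] = Blank"
| "first_symbol (a # _) = a"

fun scanned :: "tape \<Rightarrow> symbol" where
  "scanned (Tape l r) = first_symbol r"

fun write_and_move :: "symbol \<times> direction \<Rightarrow> tape \<Rightarrow> tape" where
  "write_and_move (a, Stay) (Tape l r) = Tape l (a # tl r)"
| "write_and_move (a, Go_Left) (Tape l r) = Tape (tl l) (first_symbol l # a # tl r)"
| "write_and_move (a, Go_Right) (Tape l r) = Tape (a # l) (tl r)"

text \<open>Tapes for which no action is given stay unchanged.\<close>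

fun perform :: "(symbol \<times> direction) list \<Rightarrow> tape list \<Rightarrow> tape list" where
  "perform (a # as) (t # ts) = write_and_move a t # perform as ts"
| "perform _ ts = ts"

fun leading_bits :: "symbol list \<Rightarrow> word" where
  "leading_bits (Bit b # xs) = b # leading_bits xs"
| "leading_bits _ = []"

text \<open>The word on a tape: the bits from the head rightwards up to the first other symbol.\<close>

fun word_on :: "tape \<Rightarrow> word" where
  "word_on (Tape l r) = leading_bits r"

definition word_tape :: "word \<Rightarrow> tape" where
  "word_tape w = Tape [] (map Bit w)"

record machine =
  work_tapes :: nat
  program :: "((nat \<times> symbol list) \<times> (nat \<times> (symbol \<times> direction) list)) list"

type_synonym config = "nat \<times> tape list"

definition initial_config :: "machine \<Rightarrow> word \<Rightarrow> config" where
  "initial_config M w = (0, word_tape w # replicate (Suc (work_tapes M)) (word_tape []))"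

text \<open>
  State 0 is initial. In state 1 the query \<open>w\<close> on the oracle tape is replaced by the answer \<open>Orc w\<close>
  in one step, and the machine enters state 2. A machine halts in any other state when its table has
  no entry for the current state and scanned symbols.
\<close>

definition step :: "machine \<Rightarrow> (word \<Rightarrow> word) \<Rightarrow> config \<Rightarrow> config option" where
  "step M Orc c = (case c of (q, ts) \<Rightarrow>
     if q = 1 then Some (2, ts[1 := word_tape (Orc (word_on (ts ! 1)))])
     else map_option (\<lambda>(q', acts). (q', perform acts ts))
            (map_of (program M) (q, map scanned ts)))"

definition outputs :: "machine \<Rightarrow> (word \<Rightarrow> word) \<Rightarrow> word \<Rightarrow> word \<Rightarrow> bool" where
  "outputs M Orc w v \<longleftrightarrow>
     (\<exists>q ts. (\<lambda>c c'. step M Orc c = Some c')\<^sup>*\<^sup>* (initial_config M w) (q, ts) \<and>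
             step M Orc (q, ts) = None \<and> word_on (ts ! 0) = v)"


section \<open>Encoding numbers and rational points\<close>

text \<open>
  The argument $n$ of a computation and the argument $m$ of an oracle are given in unary. In
  compound data, numbers are encoded in self-delimiting unary.
\<close>

definition unary :: "nat \<Rightarrow> word" where
  "unary n = replicate n True"

definition enc_nat :: "nat \<Rightarrow> word" where
  "enc_nat n = unary n @ [False]"

definition enc_int :: "int \<Rightarrow> word" where
  "enc_int z = (z < 0) # enc_nat (nat \<bar>z\<bar>)"

definition enc_rat :: "rat \<Rightarrow> word" where
  "enc_rat q = (case quotient_of q of (a, b) \<Rightarrow> enc_int a @ enc_nat (nat b))"

definition enc_point :: "rat ^ 'n::enum \<Rightarrow> word" where
  "enc_point p = concat (map (\<lambda>i. enc_rat (p $ i)) enum_class.enum)"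

definition real_point :: "rat ^ 'n \<Rightarrow> real ^ 'n" where
  "real_point p = (\<chi> i. of_rat (p $ i))"


section \<open>Computable points, functions and sets\<close>

definition point_oracle :: "(nat \<Rightarrow> rat ^ 'n) \<Rightarrow> real ^ 'n \<Rightarrow> bool" where
  "point_oracle \<phi> x \<longleftrightarrow> (\<forall>m. infnorm (real_point (\<phi> m) - x) < (1/2) ^ m)"

text \<open>Any word of length $m$ serves as a query for \<open>\<phi> m\<close>.\<close>

definition oracle_word :: "(nat \<Rightarrow> rat ^ 'n::enum) \<Rightarrow> word \<Rightarrow> word" where
  "oracle_word \<phi> w = enc_point (\<phi> (length w))"

text \<open>
  Ordinary Turing machines are machines with the trivial oracle, whose answers carry no information.
\<close>

definition computable_oracle :: "(nat \<Rightarrow> rat ^ 'n::enum) \<Rightarrow> bool" where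
  "computable_oracle \<phi> \<longleftrightarrow> (\<exists>M. \<forall>n. outputs M (\<lambda>_. []) (unary n) (enc_point (\<phi> n)))"

definition computable_point :: "real ^ 'n::enum \<Rightarrow> bool" where
  "computable_point x \<longleftrightarrow> (\<exists>\<phi>. point_oracle \<phi> x \<and> computable_oracle \<phi>)"

definition approximates :: "machine \<Rightarrow> (word \<Rightarrow> word) \<Rightarrow> real ^ 'n::enum \<Rightarrow> bool" where
  "approximates M Orc y \<longleftrightarrow>
     (\<forall>n. \<exists>p. outputs M Orc (unary n) (enc_point p) \<and> infnorm (real_point p - y) \<le> (1/2) ^ n)"

definition computable_function :: "(real ^ 'n::enum \<Rightarrow> real ^ 'm::enum) \<Rightarrow> bool" where
  "computable_function f \<longleftrightarrow>
     (\<exists>M. \<forall>x \<phi>. point_oracle \<phi> x \<longrightarrow> approximates M (oracle_word \<phi>) (f x))"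

text \<open>
  Intended for open sets. The distance function to the complement is only meaningful for proper
  subsets; the whole space counts as computable, so a non-computable set is always proper.
\<close>

definition computable_open_set :: "(real ^ 'n::enum) set \<Rightarrow> bool" where
  "computable_open_set U \<longleftrightarrow>
     U = UNIV \<or> computable_function (\<lambda>x. vec (INF y \<in> - U. infnorm (y - x)) :: real ^ 1)"

text \<open>
  A name of \<open>g\<close> answers two kinds of queries, told apart by their first bit: approximations \<open>\<psi> q m\<close>
  of the value of \<open>g\<close> at rational points \<open>q\<close>, and a modulus of uniform continuity \<open>\<mu> N\<close> of \<open>g\<close> on
  each cube $[-N, N]^n$. Together they allow evaluating \<open>g\<close> at arbitrary points.
\<close>

definition function_name :: "(word \<Rightarrow> word) \<Rightarrow> (real ^ 'n::enum \<Rightarrow> real ^ 'm::enum) \<Rightarrow> bool" where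
  "function_name Orc g \<longleftrightarrow>
     (\<exists>\<psi> \<mu>.
        (\<forall>q m. Orc (False # enc_point q @ unary m) = enc_point (\<psi> q m)) \<and>
        (\<forall>N m. Orc (True # enc_nat N @ unary m) = unary (\<mu> N m)) \<and>
        (\<forall>q m. infnorm (real_point (\<psi> q m) - g (real_point q)) < (1/2) ^ m) \<and>
        (\<forall>N m x y. infnorm x \<le> real N \<longrightarrow> infnorm y \<le> real N \<longrightarrow>
           infnorm (x - y) \<le> (1/2) ^ \<mu> N m \<longrightarrow> infnorm (g x - g y) \<le> (1/2) ^ m))"

text \<open>The point \<open>s g\<close> is computable from \<open>g\<close>, by one algorithm for all \<open>g \<in> G\<close>.\<close>

definition computable_from_name ::
    "(real ^ 'n::enum \<Rightarrow> real ^ 'm::enum) set \<Rightarrow>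
     ((real ^ 'n::enum \<Rightarrow> real ^ 'm::enum) \<Rightarrow> real ^ 'k::enum) \<Rightarrow> bool" where
  "computable_from_name G s \<longleftrightarrow>
     (\<exists>M. \<forall>g \<in> G. \<forall>Orc. function_name Orc g \<longrightarrow> approximates M Orc (s g))"

definition C1_neighbourhood ::
    "(real ^ 'n \<Rightarrow> real ^ 'm) \<Rightarrow> real \<Rightarrow> (real ^ 'n \<Rightarrow> real ^ 'm) set" where
  "C1_neighbourhood f \<epsilon> = {g. C_infinity g \<and> C1_norm (\<lambda>x. f x - g x) \<le> ereal \<epsilon>}"

end

theory Submission
  imports Defs
begin

text \<open>
  The field has a clock t, a channel coordinate n and a switch z among its seven coordinates. Since
  a computable field on an unbounded domain may consult a decidable predicate h k m at time k in
  channel m, the dynamics need not simulate a Turing machine: while z is below 2 the clock advances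
  and n is pushed towards the centre of its unit cell, and when h k m holds the field lifts z, after
  which everything is attracted to a sink by a field that is exactly linear near it. So the centre
  of channel m is in the basin, together with a ball of fixed radius, if h k m holds for some k, and
  is outside the basin otherwise. All inequalities involved are strict with uniform margins, hence
  survive small perturbations. A machine for the distance to the complement of the basin would
  decide which channels are in the basin; taking h k (e + 1) to say that the e-th oracle machine,
  run with the centre of channel e + 1 as oracle, stops within k steps with an output near zero, it
  would contradict itself on its own channel.
\<close>

section \<open>A structured language for stack machines\<close>

text \<open>A single predicate \<open>h\<close> serves all perturbations: as long as they stay below
  1/100, which channels end in the sink depends on \<open>h\<close> alone, so one diagonal index
  refutes a machine for any of the basins. The centre of a channel is rational, hence a constant
  function is an oracle for it, and a machine run on that oracle receives the same answer word to
  every query. This makes its bounded runs decidable without any oracle. The predicate enters the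
  field through the floors of t and n, which are neither continuous nor computable; the factors
  multiplying it vanish near the walls of the unit cells, so the field is smooth and globally
  Lipschitz, has solutions for all time, and may be evaluated at any nearby rational point. The
  sizes fit together: the distance at a centre is 0 or at least 1/8, the output has error 1/32, and
  it is compared with 1/16. Channel 0 is never lifted, so no basin is the whole space. Machines have
  to be programmed, for the field and the sink, as well as simulated, for \<open>h\<close>; stack
  programs and the calculus \<open>cmp\<close> built on them do both.\<close>

datatype cmd = Skip | Push nat bool | Pop nat | Ask | Seq cmd cmd
  | Test nat bool cmd cmd | Loop nat cmd

instance cmd :: countable by countable_datatype

datatype oper = Idle | PushOp nat bool | PopOp nat | AskOp

text \<open>A step sees the stacks only through their top bits and changes at most one stack. These
  are the restrictions of a machine transition: the top bits are scanned symbols, and the remaining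
  program is the next state.\<close>

fun red :: "(nat \<Rightarrow> bool option) \<Rightarrow> cmd \<Rightarrow> cmd \<times> oper" where
  "red g Skip = (Skip, Idle)"
| "red g (Push i b) = (Skip, PushOp i b)"
| "red g (Pop i) = (Skip, PopOp i)"
| "red g Ask = (Skip, AskOp)"
| "red g (Seq c d) = (if c = Skip then (d, Idle) else (Seq (fst (red g c)) d, snd (red g c)))"
| "red g (Test i b c d) = (if g i = Some b then c else d, Idle)"
| "red g (Loop i c) = (if g i = None then Skip else Seq c (Loop i c), Idle)"

definition peek :: "'a list \<Rightarrow> 'a option" where
  "peek w = (case w of [] \<Rightarrow> None | b # _ \<Rightarrow> Some b)"

lemma peek_simps [simp]: "peek [] = None" "peek (b # w) = Some b" "peek w = None \<longleftrightarrow> w = []"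
  by (auto simp: peek_def split: list.splits)

fun run_op :: "(word \<Rightarrow> word) \<Rightarrow> oper \<Rightarrow> (nat \<Rightarrow> word) \<Rightarrow> (nat \<Rightarrow> word)" where
  "run_op \<Omega> Idle v = v"
| "run_op \<Omega> (PushOp i b) v = v(i := b # v i)"
| "run_op \<Omega> (PopOp i) v = v(i := tl (v i))"
| "run_op \<Omega> AskOp v = v(1 := \<Omega> (v 1))"

definition cmd_step :: "(word \<Rightarrow> word) \<Rightarrow> cmd \<times> (nat \<Rightarrow> word) \<Rightarrow> cmd \<times> (nat \<Rightarrow> word) \<Rightarrow> bool" where
  "cmd_step \<Omega> x y \<longleftrightarrow> fst x \<noteq> Skip \<and>
     (let r = red (\<lambda>i. peek (snd x i)) (fst x) in y = (fst r, run_op \<Omega> (snd r) (snd x)))"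

definition runs :: "(word \<Rightarrow> word) \<Rightarrow> cmd \<Rightarrow> (nat \<Rightarrow> word) \<Rightarrow> (nat \<Rightarrow> word) \<Rightarrow> bool" where
  "runs \<Omega> c v v' \<longleftrightarrow> (cmd_step \<Omega>)\<^sup>*\<^sup>* (c, v) (Skip, v')"

lemma runs_Skip: "runs \<Omega> Skip v v"
  by (simp add: runs_def)

lemma runs_step: "cmd_step \<Omega> (c, v) (c', v') \<Longrightarrow> runs \<Omega> c' v' v'' \<Longrightarrow> runs \<Omega> c v v''"
  unfolding runs_def by (rule converse_rtranclp_into_rtranclp)

lemma runs_Push: "runs \<Omega> (Push i b) v (v(i := b # v i))"
  by (rule runs_step[OF _ runs_Skip]) (simp add: cmd_step_def)

lemma runs_Pop: "runs \<Omega> (Pop i) v (v(i := tl (v i)))"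
  by (rule runs_step[OF _ runs_Skip]) (simp add: cmd_step_def)

lemma runs_Ask: "runs \<Omega> Ask v (v(1 := \<Omega> (v 1)))"
  by (rule runs_step[OF _ runs_Skip]) (simp add: cmd_step_def)

lemma cmd_step_Seq:
  assumes "cmd_step \<Omega> x y" shows "cmd_step \<Omega> (Seq (fst x) d, snd x) (Seq (fst y) d, snd y)"
  using assms by (auto simp: cmd_step_def Let_def)

lemma cmd_steps_Seq:
  assumes "(cmd_step \<Omega>)\<^sup>*\<^sup>* x y"
  shows "(cmd_step \<Omega>)\<^sup>*\<^sup>* (Seq (fst x) d, snd x) (Seq (fst y) d, snd y)"
  using assms by induction (auto dest: cmd_step_Seq intro: rtranclp.rtrancl_into_rtrancl)

lemma runs_Seq:
  assumes "runs \<Omega> c v v'" "runs \<Omega> d v' v''" shows "runs \<Omega> (Seq c d) v v''"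
proof -
  have "(cmd_step \<Omega>)\<^sup>*\<^sup>* (Seq c d, v) (Seq Skip d, v')"
    using cmd_steps_Seq[of \<Omega> "(c, v)" "(Skip, v')" d] assms(1) by (simp add: runs_def)
  moreover have "cmd_step \<Omega> (Seq Skip d, v') (d, v')"
    by (simp add: cmd_step_def)
  ultimately show ?thesis
    using assms(2) unfolding runs_def by auto
qed

lemma runs_Test:
  assumes "peek (v i) = Some b \<Longrightarrow> runs \<Omega> c v v'" "peek (v i) \<noteq> Some b \<Longrightarrow> runs \<Omega> d v v'"
  shows "runs \<Omega> (Test i b c d) v v'"
  by (cases "peek (v i) = Some b")
     (rule runs_step[of _ _ _ c v] runs_step[of _ _ _ d v], simp add: cmd_step_def, simp add: assms)+

lemma runs_Loop_empty: "v i = [] \<Longrightarrow> runs \<Omega> (Loop i c) v v"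
  by (rule runs_step[OF _ runs_Skip]) (simp add: cmd_step_def)

lemma runs_Loop:
  assumes "v i \<noteq> []" "runs \<Omega> c v v'" "runs \<Omega> (Loop i c) v' v''"
  shows "runs \<Omega> (Loop i c) v v''"
  by (rule runs_step[of _ _ _ "Seq c (Loop i c)" v])
     (use assms in \<open>auto simp: cmd_step_def intro: runs_Seq\<close>)


section \<open>Compilation to Turing machines\<close>

text \<open>
  Machine states are the residuals of the program. The return state of a query is remembered as
  a symbol on tape 2, which holds no stack.
\<close>

fun residuals :: "cmd \<Rightarrow> cmd set" where
  "residuals Skip = {Skip}"
| "residuals (Push i b) = {Push i b, Skip}"
| "residuals (Pop i) = {Pop i, Skip}"
| "residuals Ask = {Ask, Skip}"
| "residuals (Seq c d) = (\<lambda>c'. Seq c' d) ` residuals c \<union> residuals d"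
| "residuals (Test i b c d) = insert (Test i b c d) (residuals c \<union> residuals d)"
| "residuals (Loop i c) = {Loop i c, Skip} \<union> (\<lambda>c'. Seq c' (Loop i c)) ` residuals c"

fun stacks :: "cmd \<Rightarrow> nat set" where
  "stacks Skip = {}"
| "stacks (Push i b) = {i}"
| "stacks (Pop i) = {i}"
| "stacks Ask = {}"
| "stacks (Seq c d) = stacks c \<union> stacks d"
| "stacks (Test i b c d) = insert i (stacks c \<union> stacks d)"
| "stacks (Loop i c) = insert i (stacks c)"

lemma finite_residuals: "finite (residuals c)"
  by (induction c) auto

lemma finite_stacks: "finite (stacks c)"
  by (induction c) auto

lemma self_in_residuals: "c \<in> residuals c"
  by (induction c) auto

lemma residuals_red: "d \<in> residuals c \<Longrightarrow> fst (red g d) \<in> residuals c"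
proof (induction c arbitrary: d)
  case (Seq c1 c2)
  then show ?case using self_in_residuals[of c2] by (auto split: if_splits)
next
  case (Test i b c1 c2)
  then show ?case using self_in_residuals[of c1] self_in_residuals[of c2] by auto
next
  case (Loop i c)
  then show ?case using self_in_residuals[of c] by (auto split: if_splits)
qed auto

lemma stacks_residuals: "d \<in> residuals c \<Longrightarrow> stacks d \<subseteq> stacks c"
proof (induction c arbitrary: d)
  case (Seq c1 c2)
  then show ?case using subsetD[OF Seq.IH(1)] subsetD[OF Seq.IH(2)] by auto
next
  case (Test i b c1 c2)
  then show ?case using subsetD[OF Test.IH(1)] subsetD[OF Test.IH(2)] by auto
next
  case (Loop i c)
  then show ?case using subsetD[OF Loop.IH] by auto
qed auto

lemma red_cong: "(\<And>i. i \<in> stacks c \<Longrightarrow> g i = g' i) \<Longrightarrow> red g c = red g' c"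
  by (induction c) auto

text \<open>A push is never decided by a top bit, since tests and loops only produce
  \<open>Idle\<close>. The machine makes two moves for a push, and after the first one the head
  stands on a blank; the second move must still recompute the same step from the changed
  tops.\<close>

lemma red_PushOp_cong: "snd (red g c) = PushOp i b \<Longrightarrow> red g' c = red g c"
  by (induction c) (auto split: if_splits)

lemma stacks_oper:
  "snd (red g c) = PushOp i b \<Longrightarrow> i \<in> stacks c" "snd (red g c) = PopOp i \<Longrightarrow> i \<in> stacks c"
  by (induction c) (auto split: if_splits)

section \<open>Tapes that hold stacks\<close>

definition tape_of :: "nat \<Rightarrow> nat" where
  "tape_of i = (if i < 2 then i else Suc i)"

lemma tape_of_simps [simp]: "tape_of 0 = 0" "tape_of 1 = 1" "tape_of (Suc 0) = 1" "tape_of i \<noteq> 2"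
  "2 \<noteq> tape_of i" "tape_of i = tape_of j \<longleftrightarrow> i = j"
  by (auto simp: tape_of_def)

text \<open>The head is on the top of the stack, which extends to the right. Pops erase their cell
  and leave blanks on the left, where a push finds room. Blanks on the right arise when the head of
  an empty stack makes an unlisted cell explicit.\<close>

definition holds :: "tape \<Rightarrow> word \<Rightarrow> bool" where
  "holds t w \<longleftrightarrow> (\<exists>a b. t = Tape (replicate a Blank) (map Bit w @ replicate b Blank))"

text \<open>A transition acts on every tape, and rewriting the scanned symbol is not quite the
  identity: on an empty list of cells it creates an explicit blank. Hence the invariants hold up to
  blanks.\<close>

definition touch :: "tape \<Rightarrow> tape" where
  "touch t = write_and_move (scanned t, Stay) t"

fun bit_of :: "symbol \<Rightarrow> bool option" where
  "bit_of (Bit b) = Some b"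
| "bit_of _ = None"

lemma first_symbol_blanks [simp]: "first_symbol (replicate a Blank) = Blank"
  by (cases a) auto

lemma tl_blanks: "tl (replicate a Blank) = replicate (a - 1) Blank"
  by (cases a) auto

lemma holds_word_tape: "holds (word_tape w) w"
  unfolding holds_def word_tape_def by (rule exI[of _ 0], rule exI[of _ 0]) simp

lemma leading_bits_blanks: "leading_bits (map Bit w @ replicate b Blank) = w"
  by (induction w) (cases b; auto)+

lemma holds_word_on: "holds t w \<Longrightarrow> word_on t = w"
  by (auto simp: holds_def leading_bits_blanks)

lemma holds_scanned:
  assumes "holds t w" shows "bit_of (scanned t) = peek w" "scanned t \<in> insert Blank (range Bit)"
  using assms by (cases w; auto simp: holds_def)+

lemma holds_touch: "holds t w \<Longrightarrow> holds (touch t) w"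
  unfolding holds_def touch_def
proof (elim exE)
  fix a b assume t: "t = Tape (replicate a Blank) (map Bit w @ replicate b Blank)"
  show "\<exists>a b. write_and_move (scanned t, Stay) t = Tape (replicate a Blank) (map Bit w @ replicate b Blank)"
    by (rule exI[of _ a], rule exI[of _ "if w = [] then Suc (b - 1) else b"])
       (cases w; auto simp: t tl_blanks)
qed

lemma holds_pop: "holds t w \<Longrightarrow> holds (write_and_move (Blank, Go_Right) t) (tl w)"
  unfolding holds_def
proof (elim exE)
  fix a b assume t: "t = Tape (replicate a Blank) (map Bit w @ replicate b Blank)"
  show "\<exists>a b. write_and_move (Blank, Go_Right) t = Tape (replicate a Blank) (map Bit (tl w) @ replicate b Blank)"
    by (rule exI[of _ "Suc a"], rule exI[of _ "if w = [] then b - 1 else b"])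
       (cases w; auto simp: t tl_blanks)
qed

lemma holds_push:
  assumes "holds t w"
  shows "holds (write_and_move (Bit c, Stay) (write_and_move (scanned t, Go_Left) t)) (c # w)"
    and "scanned (write_and_move (scanned t, Go_Left) t) = Blank"
proof -
  from assms obtain a b where t: "t = Tape (replicate a Blank) (map Bit w @ replicate b Blank)"
    by (auto simp: holds_def)
  show "holds (write_and_move (Bit c, Stay) (write_and_move (scanned t, Go_Left) t)) (c # w)"
    unfolding holds_def
    by (rule exI[of _ "a - 1"], rule exI[of _ "if w = [] then Suc (b - 1) else b"])
       (cases w; auto simp: t tl_blanks)
  show "scanned (write_and_move (scanned t, Go_Left) t) = Blank"
    by (simp add: t)
qed

definition on_tape :: "nat \<Rightarrow> symbol \<times> direction \<Rightarrow> symbol list \<Rightarrow> (symbol \<times> direction) list" where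
  "on_tape j p s = (map (\<lambda>a. (a, Stay)) s)[j := p]"

lemma perform_map2: "length as = length ts \<Longrightarrow> perform as ts = map2 write_and_move as ts"
  by (induction as ts rule: list_induct2) auto

lemma perform_on_tape:
  "perform (on_tape j p (map scanned ts)) ts = (map touch ts)[j := write_and_move p (ts ! j)]"
proof (cases "j < length ts")
  case True
  then show ?thesis
    by (intro nth_equalityI) (auto simp: on_tape_def perform_map2 nth_list_update touch_def)
next
  case False
  then show ?thesis
    by (intro nth_equalityI) (auto simp: on_tape_def perform_map2 list_update_beyond touch_def)
qed

lemma perform_stay: "perform (map (\<lambda>a. (a, Stay)) (map scanned ts)) ts = map touch ts"
  by (rule nth_equalityI) (auto simp: perform_map2 touch_def)

lemma finite_map_of:
  assumes "finite (dom m)" shows "\<exists>xs. map_of xs = m"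
proof -
  obtain ks where ks: "set ks = dom m" using finite_list[OF assms] by blast
  have "map_of (map (\<lambda>k. (k, the (m k))) ks) = m"
    by (rule ext) (auto simp: map_of_map_restrict ks restrict_map_def domIff)
  then show ?thesis by blast
qed

section \<open>The transition table and its simulation of a program\<close>

context
  fixes c0 :: cmd and K :: nat
begin

text \<open>State 0 is initial and 1, 2 belong to the query mechanism. So the whole program gets 0,
  the other residuals get odd numbers from 3 on, and the midpoints of pushes get even numbers from 4
  on.\<close>

definition state_of :: "cmd \<Rightarrow> nat" where
  "state_of c = (if c = c0 then 0 else 2 * to_nat c + 3)"

definition mid_state :: "cmd \<Rightarrow> nat" where
  "mid_state c = 2 * to_nat c + 4"

definition alphabet :: "symbol set" where
  "alphabet = insert Blank (range Bit \<union> Aux ` state_of ` residuals c0)"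

definition tops :: "symbol list \<Rightarrow> nat \<Rightarrow> bool option" where
  "tops s i = bit_of (s ! tape_of i)"

text \<open>\<open>Go_Left\<close> writes before it moves, so a push needs one transition to move
  onto the blank cell and a second one, from \<open>mid_state\<close>, to write the bit. A query
  leaves its return state on tape 2, because the machine always resumes in state 2.\<close>

fun act :: "cmd \<Rightarrow> cmd \<times> oper \<Rightarrow> symbol list \<Rightarrow> nat \<times> (symbol \<times> direction) list" where
  "act c (d, Idle) s = (state_of d, map (\<lambda>a. (a, Stay)) s)"
| "act c (d, PushOp i b) s = (mid_state c, on_tape (tape_of i) (s ! tape_of i, Go_Left) s)"
| "act c (d, PopOp i) s = (state_of d, on_tape (tape_of i) (Blank, Go_Right) s)"
| "act c (d, AskOp) s = (1, on_tape 2 (Aux (state_of d), Stay) s)"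

fun mid_act :: "cmd \<times> oper \<Rightarrow> symbol list \<Rightarrow> nat \<times> (symbol \<times> direction) list" where
  "mid_act (d, PushOp i b) s = (state_of d, on_tape (tape_of i) (Bit b, Stay) s)"
| "mid_act (d, _) s = (0, [])"

fun return_state :: "symbol \<Rightarrow> nat" where
  "return_state (Aux j) = j"
| "return_state _ = 0"

text \<open>The descriptions by \<open>THE\<close> are unambiguous since the state numbers are
  injective. Restricting the symbols to \<open>alphabet\<close> and the number of tapes to
  \<open>K\<close> makes the domain finite, so a list with this lookup function exists. The state of
  \<open>Skip\<close> has no entry, and the machine halts there.\<close>

definition table :: "nat \<times> symbol list \<Rightarrow> (nat \<times> (symbol \<times> direction) list) option" where
  "table = (\<lambda>(q, s).
     if \<not> (set s \<subseteq> alphabet \<and> length s = K) then None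
     else if q = 2 then Some (return_state (s ! 2), map (\<lambda>a. (a, Stay)) s)
     else if \<exists>c \<in> residuals c0 - {Skip}. q = state_of c then
       (let c = (THE c. c \<in> residuals c0 - {Skip} \<and> q = state_of c) in Some (act c (red (tops s) c) s))
     else if \<exists>c \<in> residuals c0. q = mid_state c then
       (let c = (THE c. c \<in> residuals c0 \<and> q = mid_state c) in Some (mid_act (red (tops s) c) s))
     else None)"

lemma state_of_inj [simp]: "state_of c = state_of d \<longleftrightarrow> c = d"
  by (auto simp: state_of_def)

lemma mid_state_inj [simp]: "mid_state c = mid_state d \<longleftrightarrow> c = d"
  by (auto simp: mid_state_def)

lemma state_of_neq [simp]: "state_of c \<noteq> 1" "state_of c \<noteq> Suc 0" "state_of c \<noteq> 2" "mid_state c \<noteq> 1"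
  "mid_state c \<noteq> 2" "mid_state c \<noteq> state_of d" "state_of d \<noteq> mid_state c" "mid_state c \<noteq> Suc 0"
  by (auto simp: state_of_def mid_state_def dest: arg_cong[of _ _ "even :: nat \<Rightarrow> bool"])

lemma finite_alphabet: "finite alphabet"
  by (auto simp: alphabet_def finite_residuals)

lemma finite_table: "finite (dom table)"
proof (rule finite_subset)
  show "dom table \<subseteq> ({2} \<union> state_of ` residuals c0 \<union> mid_state ` residuals c0) \<times>
      {s. set s \<subseteq> alphabet \<and> length s = K}" (is "_ \<subseteq> ?Q \<times> ?S")
  proof (rule subsetI, rule ccontr)
    fix x assume "x \<in> dom table" and x: "x \<notin> ?Q \<times> ?S"
    obtain q s where qs: "x = (q, s)" by (cases x)
    have "table (q, s) = None"
    proof (cases "s \<in> ?S")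
      case True
      then have "q \<notin> ?Q" using x qs by blast
      then have "q \<noteq> 2" "\<not> (\<exists>c \<in> residuals c0 - {Skip}. q = state_of c)"
        "\<not> (\<exists>c \<in> residuals c0. q = mid_state c)" by blast+
      then show ?thesis by (simp only: table_def prod.case if_False if_cancel)
    next
      case False
      then have "\<not> (set s \<subseteq> alphabet \<and> length s = K)" by blast
      then show ?thesis by (simp only: table_def prod.case if_True not_False_eq_True)
    qed
    with \<open>x \<in> dom table\<close> qs show False by (simp add: domIff)
  qed
  show "finite (?Q \<times> ?S)"
    by (intro finite_cartesian_product finite_UnI finite_imageI finite_residuals
        finite_lists_length_eq finite_alphabet) simp
qed

definition table_machine :: machine where
  "table_machine = \<lparr>work_tapes = K - 2, program = (SOME xs. map_of xs = table)\<rparr>"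

lemma map_of_table_machine: "map_of (program table_machine) = table"
  using someI_ex[OF finite_map_of[OF finite_table]] by (simp add: table_machine_def)

definition marker :: "tape \<Rightarrow> bool" where
  "marker t \<longleftrightarrow> (\<exists>xs. t = Tape [] xs \<and> set xs \<subseteq> alphabet \<and> length xs \<le> 1)"

definition tapes_ok :: "tape list \<Rightarrow> (nat \<Rightarrow> word) \<Rightarrow> bool" where
  "tapes_ok ts v \<longleftrightarrow> length ts = K \<and> marker (ts ! 2) \<and>
     (\<forall>i. tape_of i < K \<longrightarrow> holds (ts ! tape_of i) (v i))"

lemma marker_touch: "marker t \<Longrightarrow> marker (touch t)"
proof -
  assume "marker t"
  then obtain xs where xs: "t = Tape [] xs" "set xs \<subseteq> alphabet" "length xs \<le> 1"
    unfolding marker_def by blast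
  have "marker (Tape [] [Blank])" by (simp add: marker_def alphabet_def)
  then show ?thesis using xs by (cases xs) (simp_all add: touch_def marker_def)
qed

lemma tape_of_cases: "j = 2 \<or> (\<exists>i. j = tape_of i)"
proof -
  have "j = tape_of (if j < 2 then j else j - 1)" if "j \<noteq> 2"
    using that by (cases "j < 2") (auto simp: tape_of_def)
  then show ?thesis by blast
qed

lemma tapes_ok_scanned:
  assumes "tapes_ok ts v" "K \<ge> 3"
  shows "set (map scanned ts) \<subseteq> alphabet" and "tape_of i < K \<Longrightarrow> tops (map scanned ts) i = peek (v i)"
proof -
  have "scanned (ts ! j) \<in> alphabet" if "j < K" for j
  proof (cases "j = 2")
    case True
    then obtain xs where "ts ! j = Tape [] xs" "set xs \<subseteq> alphabet" "length xs \<le> 1"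
      using assms by (auto simp: tapes_ok_def marker_def)
    then show ?thesis by (cases xs) (auto simp: alphabet_def)
  next
    case False
    then obtain i where "j = tape_of i" using tape_of_cases by blast
    then have "holds (ts ! j) (v i)" using assms that by (auto simp: tapes_ok_def)
    from holds_scanned(2)[OF this] show ?thesis by (auto simp: alphabet_def)
  qed
  then show "set (map scanned ts) \<subseteq> alphabet"
    using assms(1) unfolding tapes_ok_def by (metis image_subset_iff in_set_conv_nth list.set_map subsetI)
  show "tops (map scanned ts) i = peek (v i)" if "tape_of i < K"
    using assms(1) that holds_scanned(1)[of "ts ! tape_of i" "v i"] unfolding tapes_ok_def tops_def by simp
qed

lemma tapes_ok_touch: "tapes_ok ts v \<Longrightarrow> K \<ge> 3 \<Longrightarrow> tapes_ok (map touch ts) v"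
  by (auto simp: tapes_ok_def holds_touch marker_touch)

lemma tapes_ok_update:
  "tapes_ok ts v \<Longrightarrow> K \<ge> 3 \<Longrightarrow> holds t w \<Longrightarrow> tapes_ok (ts[tape_of i := t]) (v(i := w))"
  by (auto simp: tapes_ok_def nth_list_update)

lemma table_state_of:
  assumes "c \<in> residuals c0" "c \<noteq> Skip" "set s \<subseteq> alphabet" "length s = K"
  shows "table (state_of c, s) = Some (act c (red (tops s) c) s)"
proof -
  have "(THE d. d \<in> residuals c0 - {Skip} \<and> state_of c = state_of d) = c"
    using assms by (intro the_equality) auto
  then show ?thesis using assms by (auto simp: table_def)
qed

lemma table_mid_state:
  assumes "c \<in> residuals c0" "set s \<subseteq> alphabet" "length s = K"
  shows "table (mid_state c, s) = Some (mid_act (red (tops s) c) s)"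
proof -
  have "(THE d. d \<in> residuals c0 \<and> mid_state c = mid_state d) = c"
    using assms by (intro the_equality) auto
  then show ?thesis using assms by (auto simp: table_def)
qed

abbreviation reaches :: "(word \<Rightarrow> word) \<Rightarrow> config \<Rightarrow> config \<Rightarrow> bool" where
  "reaches \<Omega> \<equiv> (\<lambda>C C'. step table_machine \<Omega> C = Some C')\<^sup>*\<^sup>*"

lemma step_table_machine:
  "q \<noteq> 1 \<Longrightarrow> step table_machine \<Omega> (q, ts) =
     map_option (\<lambda>(q', acts). (q', perform acts ts)) (table (q, map scanned ts))"
  by (simp add: step_def map_of_table_machine)

text \<open>One command step costs one transition, except that a push takes two and a query
  three.\<close>

lemma simulate_step:
  assumes cs: "cmd_step \<Omega> (c, v) (c', v')" and c: "c \<in> residuals c0" and ok: "tapes_ok ts v"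
    and K: "K \<ge> 3" "\<And>i. i \<in> stacks c0 \<Longrightarrow> tape_of i < K"
  shows "\<exists>ts'. reaches \<Omega> (state_of c, ts) (state_of c', ts') \<and> tapes_ok ts' v'"
proof -
  let ?s = "map scanned ts"
  have len: "length ts = K" using ok by (simp add: tapes_ok_def)
  have s: "set ?s \<subseteq> alphabet" "length ?s = K"
    using tapes_ok_scanned(1)[OF ok K(1)] len by auto
  obtain p where red: "red (\<lambda>i. peek (v i)) c = (c', p)" and v': "v' = run_op \<Omega> p v" and "c \<noteq> Skip"
    using cs by (cases "red (\<lambda>i. peek (v i)) c") (auto simp: cmd_step_def Let_def)
  have stk: "i \<in> stacks c \<Longrightarrow> tape_of i < K" for i
    using stacks_residuals[OF c] K(2) by auto
  have red_tops: "red (tops ?s) c = (c', p)"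
    unfolding red[symmetric] by (rule red_cong) (simp add: tapes_ok_scanned(2)[OF ok K(1) stk])
  have c': "c' \<in> residuals c0" using residuals_red[OF c] red by (metis fst_conv)
  have tab: "table (state_of c, ?s) = Some (act c (c', p) ?s)"
    using table_state_of[OF c \<open>c \<noteq> Skip\<close> s] red_tops by simp
  note touch_ok = tapes_ok_touch[OF ok K(1)]
  show ?thesis
  proof (cases p)
    case Idle
    then have "step table_machine \<Omega> (state_of c, ts) = Some (state_of c', map touch ts)"
      using tab perform_stay[of ts] by (simp add: step_table_machine)
    then show ?thesis using touch_ok Idle v' by auto
  next
    case (PopOp i)
    then have i: "tape_of i < K" using stacks_oper(2)[of _ c i] red stk by (metis snd_conv)
    have "step table_machine \<Omega> (state_of c, ts) =
        Some (state_of c', (map touch ts)[tape_of i := write_and_move (Blank, Go_Right) (ts ! tape_of i)])"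
      using tab PopOp perform_on_tape[of _ _ ts] by (simp add: step_table_machine)
    moreover have "holds (write_and_move (Blank, Go_Right) (ts ! tape_of i)) (tl (v i))"
      using ok i holds_pop by (auto simp: tapes_ok_def)
    ultimately show ?thesis
      using tapes_ok_update[OF touch_ok K(1)] PopOp v' by auto
  next
    case (PushOp i b)
    then have i: "tape_of i < K" using stacks_oper(1)[of _ c i] red stk by (metis snd_conv)
    let ?t = "write_and_move (scanned (ts ! tape_of i), Go_Left) (ts ! tape_of i)"
    let ?ts = "(map touch ts)[tape_of i := ?t]"
    have hold: "holds (ts ! tape_of i) (v i)" using ok i by (simp add: tapes_ok_def)
    have st1: "step table_machine \<Omega> (state_of c, ts) = Some (mid_state c, ?ts)"
      using tab PushOp i len perform_on_tape[of _ _ ts] by (simp add: step_table_machine)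
    have s1: "map scanned ?ts = (map scanned (map touch ts))[tape_of i := Blank]"
      using holds_push(2)[OF hold] by (simp add: map_update)
    have Blank: "Blank \<in> alphabet" by (simp add: alphabet_def)
    have s1': "set (map scanned ?ts) \<subseteq> alphabet" "length (map scanned ?ts) = K"
      unfolding s1 using tapes_ok_scanned(1)[OF touch_ok K(1)] len Blank
        set_update_subset_insert[of "map scanned (map touch ts)" "tape_of i" Blank]
      by (blast, simp)
    \<comment> \<open>The top of stack \<open>i\<close> now reads as a blank, yet the step is the
      same because it is a push.\<close>
    have "red (tops (map scanned ?ts)) c = (c', PushOp i b)"
      using red_PushOp_cong[of "tops ?s" c i b] red_tops PushOp by simp
    then have st2: "step table_machine \<Omega> (mid_state c, ?ts) =
       Some (state_of c', (map touch ?ts)[tape_of i := write_and_move (Bit b, Stay) (?ts ! tape_of i)])"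
      using table_mid_state[OF c s1'] perform_on_tape[of _ _ ?ts] by (simp add: step_table_machine)
    have eq: "(map touch ?ts)[tape_of i := write_and_move (Bit b, Stay) (?ts ! tape_of i)] =
        (map touch (map touch ts))[tape_of i := write_and_move (Bit b, Stay) ?t]"
      using i len by (simp add: map_update)
    have "tapes_ok ((map touch (map touch ts))[tape_of i := write_and_move (Bit b, Stay) ?t]) (v(i := b # v i))"
      by (intro tapes_ok_update tapes_ok_touch touch_ok K(1) holds_push(1) hold)
    moreover have "reaches \<Omega> (state_of c, ts)
        (state_of c', (map touch (map touch ts))[tape_of i := write_and_move (Bit b, Stay) ?t])"
      using st1 st2 unfolding eq by (meson converse_rtranclp_into_rtranclp rtranclp.rtrancl_refl)
    ultimately show ?thesis
      using PushOp v' by auto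
  next
    case AskOp
    let ?ts = "(map touch ts)[2 := write_and_move (Aux (state_of c'), Stay) (ts ! 2)]"
    let ?ts2 = "?ts[1 := word_tape (\<Omega> (word_on (?ts ! 1)))]"
    have st1: "step table_machine \<Omega> (state_of c, ts) = Some (1, ?ts)"
      using tab AskOp perform_on_tape[of _ _ ts] by (simp add: step_table_machine)
    have st2: "step table_machine \<Omega> (1, ?ts) = Some (2, ?ts2)"
      by (simp add: step_def)
    obtain xs where xs: "ts ! 2 = Tape [] xs" "set xs \<subseteq> alphabet" "length xs \<le> 1"
      using ok by (auto simp: tapes_ok_def marker_def)
    have "marker (write_and_move (Aux (state_of c'), Stay) (ts ! 2))"
      using xs c' by (cases xs) (auto simp: marker_def alphabet_def)
    then have ok1: "tapes_ok ?ts v"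
      using touch_ok K(1) by (auto simp: tapes_ok_def nth_list_update)
    have "word_on (?ts ! 1) = v 1"
      using ok1 K(1) holds_word_on[of "?ts ! 1" "v 1"] unfolding tapes_ok_def by (metis One_nat_def tape_of_simps(2) less_le_trans numeral_3_eq_3 lessI less_Suc_eq)
    then have ok2: "tapes_ok ?ts2 v'"
      using tapes_ok_update[OF ok1 K(1) holds_word_tape, of 1] AskOp v' by simp
    have "scanned (?ts2 ! 2) = Aux (state_of c')"
      using K(1) len xs by (simp add: nth_list_update)
    then have "step table_machine \<Omega> (2, ?ts2) = Some (state_of c', map touch ?ts2)"
      using tapes_ok_scanned(1)[OF ok2 K(1)] ok2 K(1) perform_stay[of ?ts2]
      by (simp add: step_table_machine table_def tapes_ok_def)
    then show ?thesis
      using st1 st2 tapes_ok_touch[OF ok2 K(1)]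
      by (meson converse_rtranclp_into_rtranclp rtranclp.rtrancl_refl)
  qed
qed

lemma simulate_steps:
  assumes "(cmd_step \<Omega>)\<^sup>*\<^sup>* x y" "fst x \<in> residuals c0" "tapes_ok ts (snd x)"
    and K: "K \<ge> 3" "\<And>i. i \<in> stacks c0 \<Longrightarrow> tape_of i < K"
  shows "\<exists>ts'. reaches \<Omega> (state_of (fst x), ts) (state_of (fst y), ts') \<and> tapes_ok ts' (snd y)
      \<and> fst y \<in> residuals c0"
  using assms(1)
proof induction
  case base
  then show ?case using assms by auto
next
  case (step y z)
  then obtain ts' where ts': "reaches \<Omega> (state_of (fst x), ts) (state_of (fst y), ts')"
    "tapes_ok ts' (snd y)" "fst y \<in> residuals c0" by blast
  have "fst z \<in> residuals c0"
    using step.hyps(2) residuals_red[OF ts'(3)] by (auto simp: cmd_step_def Let_def)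
  moreover from simulate_step[of \<Omega> "fst y" "snd y" "fst z" "snd z" ts'] step.hyps(2) ts' K
  obtain ts'' where "reaches \<Omega> (state_of (fst y), ts') (state_of (fst z), ts'')" "tapes_ok ts'' (snd z)"
    by auto
  ultimately show ?case using ts'(1) by (meson rtranclp_trans)
qed

lemma outputs_table_machine:
  assumes "runs \<Omega> c0 ((\<lambda>_. [])(0 := w)) v"
    and K: "K \<ge> 3" "\<And>i. i \<in> stacks c0 \<Longrightarrow> tape_of i < K"
  shows "outputs table_machine \<Omega> w (v 0)"
proof -
  let ?ts = "word_tape w # replicate (K - 1) (word_tape [])"
  have init: "initial_config table_machine w = (state_of c0, ?ts)"
    using K(1) by (simp add: initial_config_def table_machine_def state_of_def Suc_diff_Suc numeral_2_eq_2)
  have "marker (word_tape [])" by (auto simp: marker_def word_tape_def)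
  then have "tapes_ok ?ts ((\<lambda>_. [])(0 := w))"
    using K(1) holds_word_tape by (auto simp: tapes_ok_def nth_Cons' tape_of_def)
  then obtain ts' where ts': "reaches \<Omega> (state_of c0, ?ts) (state_of Skip, ts')" "tapes_ok ts' v"
    using simulate_steps[of \<Omega> "(c0, (\<lambda>_. [])(0 := w))" "(Skip, v)" ?ts] assms self_in_residuals
    by (auto simp: runs_def)
  have "step table_machine \<Omega> (state_of Skip, ts') = None"
    by (auto simp: step_table_machine table_def)
  moreover have "holds (ts' ! 0) (v 0)"
    using ts'(2) K(1) unfolding tapes_ok_def by (metis tape_of_simps(1) less_le_trans zero_less_numeral)
  ultimately show ?thesis
    using ts'(1) init holds_word_on unfolding outputs_def by metis
qed

end

text \<open>The machine depends on the program alone and not on oracle or input; computability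
  relative to all oracles of a point needs this uniformity.\<close>

theorem runs_imp_machine:
  fixes c :: cmd
  shows "\<exists>M. \<forall>\<Omega> w v. runs \<Omega> c ((\<lambda>_. [])(0 := w)) v \<longrightarrow> outputs M \<Omega> w (v 0)"
proof -
  obtain B where B: "\<And>i. i \<in> stacks c \<Longrightarrow> i \<le> B"
    using finite_stacks[of c] finite_nat_set_iff_bounded_le by auto
  let ?K = "B + 3"
  have "tape_of i < ?K" if "i \<in> stacks c" for i
    using B[OF that] by (auto simp: tape_of_def)
  then show ?thesis using outputs_table_machine[of _ c _ _ ?K] by (intro exI[of _ "table_machine c ?K"]) auto
qed

section \<open>Functionals computed by stack machines\<close>

definition un :: "nat \<Rightarrow> word" where
  "un n = replicate n True"

lemma un_simps [simp]: "un 0 = []" "un (Suc n) = True # un n" "un n = [] \<longleftrightarrow> n = 0"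
  "un m @ True # w = True # un m @ w" "tl (un n) = un (n - 1)" "un m @ un n = un (m + n)"
  by (auto simp: un_def replicate_app_Cons_same replicate_add simp del: replicate_append_same)

lemma peek_un: "peek (un n) = Some True \<longleftrightarrow> n \<noteq> 0"
  by (cases n) auto

lemma runs_trans:
  "runs \<Omega> c v v' \<Longrightarrow> runs \<Omega> d v' v'' \<Longrightarrow> v'' = u \<Longrightarrow> runs \<Omega> (Seq c d) v u"
  using runs_Seq by blast

lemma runs_Loop_done: "v i = [] \<Longrightarrow> v = u \<Longrightarrow> runs \<Omega> (Loop i c) v u"
  using runs_Loop_empty by blast

lemma runs_LoopI:
  "runs \<Omega> c v v' \<Longrightarrow> runs \<Omega> (Loop i c) v' v'' \<Longrightarrow> v'' = u \<Longrightarrow> v i \<noteq> [] \<Longrightarrow> runs \<Omega> (Loop i c) v u"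
  using runs_Loop by blast

section \<open>Basic programs on unary stacks\<close>

definition clear :: "nat \<Rightarrow> cmd" where
  "clear i = Loop i (Pop i)"

lemma runs_clear: "runs \<Omega> (clear i) v (v(i := []))"
proof (induction "v i" arbitrary: v)
  case Nil
  then show ?case unfolding clear_def by (intro runs_Loop_done) (auto simp: fun_eq_iff)
next
  case (Cons b w)
  have "runs \<Omega> (clear i) (v(i := tl (v i))) (v(i := tl (v i), i := []))"
    by (rule Cons.hyps(1)) (simp add: Cons.hyps(2)[symmetric])
  moreover have "v i \<noteq> []" by (simp add: Cons.hyps(2)[symmetric])
  ultimately show ?case using runs_Loop[OF _ runs_Pop] unfolding clear_def by fastforce
qed

definition transfer :: "nat \<Rightarrow> nat \<Rightarrow> cmd" where
  "transfer i k = Loop i (Seq (Pop i) (Push k True))"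

lemma runs_transfer:
  assumes "v i = un x" "i \<noteq> k" shows "runs \<Omega> (transfer i k) v (v(i := [], k := un x @ v k))"
  using assms(1)
proof (induction x arbitrary: v)
  case 0
  then show ?case unfolding transfer_def by (intro runs_Loop_done) (auto simp: fun_eq_iff)
next
  case (Suc x)
  let ?v = "v(i := un x, k := True # v k)"
  have "runs \<Omega> (Seq (Pop i) (Push k True)) v ?v"
    by (rule runs_trans[OF runs_Pop runs_Push]) (use Suc.prems assms(2) in \<open>auto simp: fun_eq_iff\<close>)
  moreover have "runs \<Omega> (transfer i k) ?v (?v(i := [], k := un x @ ?v k))"
    by (rule Suc.IH) (use assms(2) in auto)
  moreover have "?v(i := [], k := un x @ ?v k) = v(i := [], k := un (Suc x) @ v k)"
    using assms(2) by (auto simp: fun_eq_iff)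
  moreover have "v i \<noteq> []" using Suc.prems by simp
    ultimately show ?case unfolding transfer_def by (rule runs_LoopI)
qed

definition split_off :: "nat \<Rightarrow> nat \<Rightarrow> nat \<Rightarrow> cmd" where
  "split_off i k l = Loop i (Seq (Pop i) (Seq (Push k True) (Push l True)))"

lemma runs_split_off:
  assumes "v i = un x" "i \<noteq> k" "i \<noteq> l" "k \<noteq> l"
  shows "runs \<Omega> (split_off i k l) v (v(i := [], k := un x @ v k, l := un x @ v l))"
  using assms(1)
proof (induction x arbitrary: v)
  case 0
  then show ?case unfolding split_off_def by (intro runs_Loop_done) (auto simp: fun_eq_iff)
next
  case (Suc x)
  let ?v = "v(i := un x, k := True # v k, l := True # v l)"
  have "runs \<Omega> (Seq (Pop i) (Seq (Push k True) (Push l True))) v ?v"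
    by (rule runs_trans[OF runs_Pop runs_trans[OF runs_Push runs_Push refl]])
       (use Suc.prems assms in \<open>auto simp: fun_eq_iff\<close>)
  moreover have "runs \<Omega> (split_off i k l) ?v (?v(i := [], k := un x @ ?v k, l := un x @ ?v l))"
    by (rule Suc.IH) (use assms in auto)
  moreover have "?v(i := [], k := un x @ ?v k, l := un x @ ?v l) = v(i := [], k := un (Suc x) @ v k, l := un (Suc x) @ v l)"
    using assms by (auto simp: fun_eq_iff)
  moreover have "v i \<noteq> []" using Suc.prems by simp
    ultimately show ?case unfolding split_off_def by (rule runs_LoopI)
qed

definition add_copy :: "nat \<Rightarrow> nat \<Rightarrow> nat \<Rightarrow> cmd" where
  "add_copy i k l = Seq (split_off i k l) (transfer l i)"

lemma runs_add_copy:
  assumes "v i = un x" "i \<noteq> k" "i \<noteq> l" "k \<noteq> l" "v l = []"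
  shows "runs \<Omega> (add_copy i k l) v (v(k := un x @ v k))"
  unfolding add_copy_def
  by (rule runs_trans[OF runs_split_off[where x = x] runs_transfer[where x = x]])
     (use assms in \<open>auto simp: fun_eq_iff\<close>)

text \<open>The contract that lets programs be composed: one program for all oracles and inputs
  reads stack \<open>i\<close>, writes stack \<open>j\<close> and leaves everything else as it was.
  Stacks from \<open>s\<close> on are scratch, empty before and, unless \<open>j\<close> is among
  them, after; composites raise \<open>s\<close> to reserve stacks for intermediate results. Stacks
  0 and 1 are kept for input, output and queries.\<close>

definition impl :: "((word \<Rightarrow> word) \<Rightarrow> nat \<Rightarrow> nat) \<Rightarrow> bool" where
  "impl F \<longleftrightarrow> (\<forall>i j s. 2 \<le> i \<longrightarrow> i < s \<longrightarrow> 2 \<le> j \<longrightarrow> j < s \<longrightarrow>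
     (\<exists>c. \<forall>\<Omega> v x. v i = un x \<longrightarrow> v 1 = [] \<longrightarrow> (\<forall>r\<ge>s. v r = []) \<longrightarrow>
        runs \<Omega> c v (v(j := un (F \<Omega> x)))))"

lemma implI:
  assumes "\<And>i j s. 2 \<le> i \<Longrightarrow> i < s \<Longrightarrow> 2 \<le> j \<Longrightarrow> j < s \<Longrightarrow>
     \<exists>c. \<forall>\<Omega> v x. v i = un x \<longrightarrow> v 1 = [] \<longrightarrow> (\<forall>r\<ge>s. v r = []) \<longrightarrow>
        runs \<Omega> c v (v(j := un (F \<Omega> x)))"
  shows "impl F"
  using assms unfolding impl_def by blast

lemma implE:
  assumes "impl F" "2 \<le> i" "i < s" "2 \<le> j" "j < s"
  obtains c where "\<And>\<Omega> v x. v i = un x \<Longrightarrow> v 1 = [] \<Longrightarrow> (\<And>r. r \<ge> s \<Longrightarrow> v r = []) \<Longrightarrow>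
        runs \<Omega> c v (v(j := un (F \<Omega> x)))"
  using assms unfolding impl_def by metis

lemma impl_id: "impl (\<lambda>\<Omega> x. x)"
proof (rule implI)
  fix i j s :: nat assume ij: "2 \<le> i" "i < s" "2 \<le> j" "j < s"
  show "\<exists>c. \<forall>\<Omega> v x. v i = un x \<longrightarrow> v 1 = [] \<longrightarrow> (\<forall>r\<ge>s. v r = []) \<longrightarrow> runs \<Omega> c v (v(j := un x))"
  proof (cases "i = j")
    case True
    show ?thesis by (rule exI[of _ Skip]) (metis True fun_upd_triv runs_Skip)
  next
    case False
    show ?thesis
    proof (intro exI[of _ "Seq (clear j) (add_copy i j s)"] allI impI)
      fix \<Omega> v x assume "v i = un x" "v (1::nat) = []" "\<forall>r\<ge>s. v r = []"
      then show "runs \<Omega> (Seq (clear j) (add_copy i j s)) v (v(j := un x))"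
        by (intro runs_trans[OF runs_clear runs_add_copy[where x = x]]) (use ij False in auto)
    qed
  qed
qed

lemma impl_then:
  assumes "impl F" and d: "\<And>j. \<exists>d. \<forall>\<Omega> v y. v j = un y \<longrightarrow> runs \<Omega> d v (v(j := un (g y)))"
  shows "impl (\<lambda>\<Omega> x. g (F \<Omega> x))"
proof (rule implI)
  fix i j s :: nat assume ij: "2 \<le> i" "i < s" "2 \<le> j" "j < s"
  obtain c where c: "\<And>\<Omega> v x. v i = un x \<Longrightarrow> v 1 = [] \<Longrightarrow> (\<And>r. r \<ge> s \<Longrightarrow> v r = []) \<Longrightarrow>
        runs \<Omega> c v (v(j := un (F \<Omega> x)))" using implE[OF assms(1) ij] by blast
  obtain d where d: "\<forall>\<Omega> v y. v j = un y \<longrightarrow> runs \<Omega> d v (v(j := un (g y)))" using d by blast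
  show "\<exists>c. \<forall>\<Omega> v x. v i = un x \<longrightarrow> v 1 = [] \<longrightarrow> (\<forall>r\<ge>s. v r = []) \<longrightarrow> runs \<Omega> c v (v(j := un (g (F \<Omega> x))))"
    by (rule exI[of _ "Seq c d"]) (auto intro!: runs_trans[OF c d[rule_format]])
qed

lemma impl_Suc: "impl F \<Longrightarrow> impl (\<lambda>\<Omega> x. Suc (F \<Omega> x))"
proof (rule impl_then[of F Suc])
  show "\<exists>d. \<forall>\<Omega> v y. v j = un y \<longrightarrow> runs \<Omega> d v (v(j := un (Suc y)))" for j
    by (rule exI[of _ "Push j True"]) (metis runs_Push un_simps(2))
qed

lemma impl_pred: "impl F \<Longrightarrow> impl (\<lambda>\<Omega> x. F \<Omega> x - 1)"
proof (rule impl_then[of F "\<lambda>y. y - 1"])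
  show "\<exists>d. \<forall>\<Omega> v y. v j = un y \<longrightarrow> runs \<Omega> d v (v(j := un (y - 1)))" for j
    by (rule exI[of _ "Pop j"]) (metis runs_Pop un_simps(5))
qed

lemma impl_const: "impl (\<lambda>\<Omega> x. n)"
proof (induction n)
  case 0
  show ?case
    using impl_then[OF impl_id, of "\<lambda>_. 0"] runs_clear by (metis un_simps(1))
qed (rule impl_Suc)

lemma impl_comp:
  assumes "impl F" "impl G" shows "impl (\<lambda>\<Omega> x. F \<Omega> (G \<Omega> x))"
proof (rule implI)
  fix i j s :: nat assume ij: "2 \<le> i" "i < s" "2 \<le> j" "j < s"
  obtain c where c: "\<And>\<Omega> v x. v i = un x \<Longrightarrow> v 1 = [] \<Longrightarrow> (\<And>r. r \<ge> Suc s \<Longrightarrow> v r = []) \<Longrightarrow>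
      runs \<Omega> c v (v(s := un (G \<Omega> x)))" using implE[OF assms(2), of i "Suc s" s] ij by force
  obtain d where d: "\<And>\<Omega> v x. v s = un x \<Longrightarrow> v 1 = [] \<Longrightarrow> (\<And>r. r \<ge> Suc s \<Longrightarrow> v r = []) \<Longrightarrow>
      runs \<Omega> d v (v(j := un (F \<Omega> x)))" using implE[OF assms(1), of s "Suc s" j] ij by force
  show "\<exists>c. \<forall>\<Omega> v x. v i = un x \<longrightarrow> v 1 = [] \<longrightarrow> (\<forall>r\<ge>s. v r = []) \<longrightarrow> runs \<Omega> c v (v(j := un (F \<Omega> (G \<Omega> x))))"
  proof (intro exI allI impI)
    fix \<Omega> v x assume "v i = un x" "v (1::nat) = []" "\<forall>r\<ge>s. v r = []"
    then show "runs \<Omega> (Seq c (Seq d (clear s))) v (v(j := un (F \<Omega> (G \<Omega> x))))"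
      by (intro runs_trans[OF c[where x = x] runs_trans[OF d[where x = "G \<Omega> x"] runs_clear refl]]) (use ij in \<open>auto simp: fun_eq_iff\<close>)
  qed
qed

text \<open>Cantor's code of (x, y) is the triangular number of x + y, plus x. Splitting
  \<open>a\<close> leaves x + y on \<open>b\<close> and x on \<open>j\<close>; counting
  \<open>b\<close> down then adds x + y, x + y - 1, ..., 1 to \<open>j\<close>.\<close>

definition pair_cmd :: "nat \<Rightarrow> nat \<Rightarrow> nat \<Rightarrow> nat \<Rightarrow> cmd" where
  "pair_cmd a b j t = Seq (split_off a b j) (Loop b (Seq (add_copy b j t) (Pop b)))"

lemma runs_pair_cmd:
  assumes "v a = un x" "v b = un y" "v j = []" "v t = []" "distinct [a, b, j, t]"
  shows "runs \<Omega> (pair_cmd a b j t) v (v(a := [], b := [], j := un (prod_encode (x, y))))"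
proof -
  have loop: "runs \<Omega> (Loop b (Seq (add_copy b j t) (Pop b))) v (v(b := [], j := un (triangle k + n)))"
    if "v b = un k" "v t = []" "v j = un n" for v k n using that
  proof (induction k arbitrary: v n)
    case 0
    then show ?case by (intro runs_Loop_done) (auto simp: fun_eq_iff)
  next
    case (Suc k)
    let ?v = "v(b := un k, j := un (Suc k + n))"
    have "runs \<Omega> (Seq (add_copy b j t) (Pop b)) v ?v"
      by (rule runs_trans[OF runs_add_copy[where x = "Suc k"] runs_Pop])
         (use Suc.prems assms(5) in \<open>auto simp: fun_eq_iff\<close>)
    moreover have "runs \<Omega> (Loop b (Seq (add_copy b j t) (Pop b))) ?v (?v(b := [], j := un (triangle k + (Suc k + n))))"
      by (rule Suc.IH) (use Suc.prems assms(5) in auto)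
    moreover have "?v(b := [], j := un (triangle k + (Suc k + n))) = v(b := [], j := un (triangle (Suc k) + n))"
      by (simp add: fun_eq_iff add_ac)
    moreover have "v b \<noteq> []" using Suc.prems by simp
    ultimately show ?case by (rule runs_LoopI)
  qed
  show ?thesis unfolding pair_cmd_def
    by (rule runs_trans[OF runs_split_off[where x = x] loop[where k = "x + y" and n = x]])
       (use assms in \<open>auto simp: fun_eq_iff prod_encode_def\<close>)
qed

lemma impl_pair:
  assumes "impl F" "impl G" shows "impl (\<lambda>\<Omega> x. prod_encode (F \<Omega> x, G \<Omega> x))"
proof (rule implI)
  fix i j s :: nat assume ij: "2 \<le> i" "i < s" "2 \<le> j" "j < s"
  obtain c where c: "\<And>\<Omega> v x. v i = un x \<Longrightarrow> v 1 = [] \<Longrightarrow> (\<And>r. r \<ge> s + 2 \<Longrightarrow> v r = []) \<Longrightarrow>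
      runs \<Omega> c v (v(s := un (F \<Omega> x)))" using implE[OF assms(1), of i "s + 2" s] ij by force
  obtain d where d: "\<And>\<Omega> v x. v i = un x \<Longrightarrow> v 1 = [] \<Longrightarrow> (\<And>r. r \<ge> s + 2 \<Longrightarrow> v r = []) \<Longrightarrow>
      runs \<Omega> d v (v(s + 1 := un (G \<Omega> x)))" using implE[OF assms(2), of i "s + 2" "s + 1"] ij by force
  show "\<exists>c. \<forall>\<Omega> v x. v i = un x \<longrightarrow> v 1 = [] \<longrightarrow> (\<forall>r\<ge>s. v r = []) \<longrightarrow>
      runs \<Omega> c v (v(j := un (prod_encode (F \<Omega> x, G \<Omega> x))))"
  proof (intro exI allI impI)
    fix \<Omega> v x assume v: "v i = un x" "v (1::nat) = []" "\<forall>r\<ge>s. v r = []"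
    have "runs \<Omega> (Seq c (Seq d (clear j))) v (v(s := un (F \<Omega> x), s + 1 := un (G \<Omega> x), j := []))"
      by (intro runs_trans[OF c[where x = x] runs_trans[OF d[where x = x] runs_clear refl]]) (use ij v in auto)
    then show "runs \<Omega> (Seq (Seq c (Seq d (clear j))) (pair_cmd s (s + 1) j (s + 2))) v (v(j := un (prod_encode (F \<Omega> x, G \<Omega> x))))"
      by (rule runs_trans[OF _ runs_pair_cmd[where x = "F \<Omega> x" and y = "G \<Omega> x"]])
         (use ij v in \<open>auto simp: fun_eq_iff\<close>)
  qed
qed

text \<open>The enumeration walks along antidiagonals, and from the end (a, 0) of one it jumps to
  the start (0, a + 1) of the next. Decoding n amounts to n such moves from (0, 0), which is how
  \<open>unpair_cmd\<close> works.\<close>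

lemma prod_decode_Suc:
  "prod_decode (Suc n) = (case prod_decode n of (a, b) \<Rightarrow> if b = 0 then (0, Suc a) else (Suc a, b - 1))"
proof -
  obtain a b where ab: "prod_decode n = (a, b)" by (cases "prod_decode n")
  then have n: "prod_encode (a, b) = n" using prod_decode_inverse[of n] by simp
  have "prod_encode (0, Suc a) = Suc (prod_encode (a, 0))"
    "prod_encode (Suc a, c) = Suc (prod_encode (a, Suc c))" for c
    by (simp_all add: prod_encode_def)
  then have "prod_encode (if b = 0 then (0, Suc a) else (Suc a, b - 1)) = Suc n"
    using n by (cases b) simp_all
  then have "prod_decode (Suc n) = (if b = 0 then (0, Suc a) else (Suc a, b - 1))"
    by (metis prod_encode_inverse)
  then show ?thesis by (simp add: ab)
qed

definition unpair_cmd :: "nat \<Rightarrow> nat \<Rightarrow> nat \<Rightarrow> cmd" where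
  "unpair_cmd x a b = Loop x (Seq (Pop x)
     (Test b True (Seq (Pop b) (Push a True)) (Seq (transfer a b) (Push b True))))"

lemma runs_unpair_cmd:
  assumes "distinct [x, a, b]" "v x = un n" "v a = []" "v b = []"
  shows "runs \<Omega> (unpair_cmd x a b) v
    (v(x := [], a := un (fst (prod_decode n)), b := un (snd (prod_decode n))))"
proof -
  have "runs \<Omega> (unpair_cmd x a b) v
      (v(x := [], a := un (fst (prod_decode (m + n))), b := un (snd (prod_decode (m + n)))))"
    if "v x = un n" "v a = un (fst (prod_decode m))" "v b = un (snd (prod_decode m))" for m v
    using that
  proof (induction n arbitrary: m v)
    case 0
    then show ?case unfolding unpair_cmd_def by (intro runs_Loop_done) (auto simp: fun_eq_iff)
  next
    case (Suc n)
    obtain k l where kl: "prod_decode m = (k, l)" by (cases "prod_decode m")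
    let ?v = "v(x := un n, a := un (fst (prod_decode (Suc m))), b := un (snd (prod_decode (Suc m))))"
    have "runs \<Omega> (Test b True (Seq (Pop b) (Push a True)) (Seq (transfer a b) (Push b True))) (v(x := un n)) ?v"
    proof (rule runs_Test)
      assume "peek ((v(x := un n)) b) = Some True"
      then have "l \<noteq> 0" using Suc.prems kl assms(1) by (auto simp: peek_un)
      then show "runs \<Omega> (Seq (Pop b) (Push a True)) (v(x := un n)) ?v"
        by (intro runs_trans[OF runs_Pop runs_Push])
           (use Suc.prems kl assms(1) in \<open>auto simp: fun_eq_iff prod_decode_Suc\<close>)
    next
      assume "peek ((v(x := un n)) b) \<noteq> Some True"
      then have "l = 0" using Suc.prems kl assms(1) by (auto simp: peek_un)
      then show "runs \<Omega> (Seq (transfer a b) (Push b True)) (v(x := un n)) ?v"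
        by (intro runs_trans[OF runs_transfer[where x = k] runs_Push])
           (use Suc.prems kl assms(1) in \<open>auto simp: fun_eq_iff prod_decode_Suc\<close>)
    qed
    then have "runs \<Omega> (Seq (Pop x) (Test b True (Seq (Pop b) (Push a True)) (Seq (transfer a b) (Push b True)))) v ?v"
      by (intro runs_Seq[OF runs_Pop]) (simp add: Suc.prems(1))
    moreover have "runs \<Omega> (unpair_cmd x a b) ?v
        (?v(x := [], a := un (fst (prod_decode (Suc m + n))), b := un (snd (prod_decode (Suc m + n)))))"
      by (rule Suc.IH) (use assms(1) in auto)
    moreover have "?v(x := [], a := un (fst (prod_decode (Suc m + n))), b := un (snd (prod_decode (Suc m + n)))) =
        v(x := [], a := un (fst (prod_decode (m + Suc n))), b := un (snd (prod_decode (m + Suc n))))"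
      by (auto simp: fun_eq_iff)
    moreover have "v x \<noteq> []" using Suc.prems by simp
    ultimately show ?case unfolding unpair_cmd_def by (rule runs_LoopI)
  qed
  from this[of v 0] show ?thesis using assms by (simp add: prod_decode_def prod_decode_aux.simps)
qed

lemma impl_unpair:
  assumes "impl F" shows "impl (\<lambda>\<Omega> x. fst (prod_decode (F \<Omega> x)))" "impl (\<lambda>\<Omega> x. snd (prod_decode (F \<Omega> x)))"
proof -
  have "\<exists>c. (\<forall>\<Omega> v x. v i = un x \<longrightarrow> v 1 = [] \<longrightarrow> (\<forall>r\<ge>s. v r = []) \<longrightarrow>
      runs \<Omega> c v (v(j := un (fst (prod_decode (F \<Omega> x))))))"
    "\<exists>c. (\<forall>\<Omega> v x. v i = un x \<longrightarrow> v 1 = [] \<longrightarrow> (\<forall>r\<ge>s. v r = []) \<longrightarrow>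
      runs \<Omega> c v (v(j := un (snd (prod_decode (F \<Omega> x))))))"
    if ij: "2 \<le> i" "i < s" "2 \<le> j" "j < s" for i j s
  proof -
    obtain c where c: "\<And>\<Omega> v x. v i = un x \<Longrightarrow> v 1 = [] \<Longrightarrow> (\<And>r. r \<ge> s + 1 \<Longrightarrow> v r = []) \<Longrightarrow>
        runs \<Omega> c v (v(s := un (F \<Omega> x)))" using implE[OF assms, of i "s + 1" s] ij by force
    have u: "runs \<Omega> (Seq c (Seq (clear j) (unpair_cmd s (s + 1) (s + 2)))) v
        (v(j := [], s + 1 := un (fst (prod_decode (F \<Omega> x))), s + 2 := un (snd (prod_decode (F \<Omega> x)))))"
      if v: "v i = un x" "v 1 = []" "\<forall>r\<ge>s. v r = []" for \<Omega> v x
      by (intro runs_trans[OF c[where x = x] runs_trans[OF runs_clear runs_unpair_cmd[where n = "F \<Omega> x"] refl]])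
         (use ij v in \<open>auto simp: fun_eq_iff\<close>)
    let ?u = "Seq c (Seq (clear j) (unpair_cmd s (s + 1) (s + 2)))"
    have "runs \<Omega> (Seq ?u (Seq (transfer (s + 1) j) (clear (s + 2)))) v (v(j := un (fst (prod_decode (F \<Omega> x)))))"
      "runs \<Omega> (Seq ?u (Seq (transfer (s + 2) j) (clear (s + 1)))) v (v(j := un (snd (prod_decode (F \<Omega> x)))))"
      if v: "v i = un x" "v 1 = []" "\<forall>r\<ge>s. v r = []" for \<Omega> v x
       apply (rule runs_trans[OF u[OF v] runs_trans[OF runs_transfer[where x = "fst (prod_decode (F \<Omega> x))"] runs_clear refl]])
         apply (use ij v in \<open>auto simp: fun_eq_iff\<close>)[3]
      apply (rule runs_trans[OF u[OF v] runs_trans[OF runs_transfer[where x = "snd (prod_decode (F \<Omega> x))"] runs_clear refl]])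
        apply (use ij v in \<open>auto simp: fun_eq_iff\<close>)[3]
      done
    then show "\<exists>c. (\<forall>\<Omega> v x. v i = un x \<longrightarrow> v 1 = [] \<longrightarrow> (\<forall>r\<ge>s. v r = []) \<longrightarrow>
      runs \<Omega> c v (v(j := un (fst (prod_decode (F \<Omega> x))))))"
    "\<exists>c. (\<forall>\<Omega> v x. v i = un x \<longrightarrow> v 1 = [] \<longrightarrow> (\<forall>r\<ge>s. v r = []) \<longrightarrow>
      runs \<Omega> c v (v(j := un (snd (prod_decode (F \<Omega> x))))))"
      by blast+
  qed
  then show "impl (\<lambda>\<Omega> x. fst (prod_decode (F \<Omega> x)))" "impl (\<lambda>\<Omega> x. snd (prod_decode (F \<Omega> x)))"
    by (auto intro!: implI)
qed

text \<open>The only rule for repetition. The number of rounds is computed before the loop starts,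
  so every functional obtained is total and termination never has to be argued again.\<close>

lemma impl_iterate:
  assumes "impl B" "impl N" "impl I" shows "impl (\<lambda>\<Omega> x. (B \<Omega> ^^ N \<Omega> x) (I \<Omega> x))"
proof (rule implI)
  fix i j s :: nat assume ij: "2 \<le> i" "i < s" "2 \<le> j" "j < s"
  obtain b where b: "\<And>\<Omega> v x. v (s + 1) = un x \<Longrightarrow> v 1 = [] \<Longrightarrow> (\<And>r. r \<ge> s + 2 \<Longrightarrow> v r = []) \<Longrightarrow>
      runs \<Omega> b v (v(s + 1 := un (B \<Omega> x)))" using implE[OF assms(1), of "s + 1" "s + 2" "s + 1"] ij by force
  obtain n where n: "\<And>\<Omega> v x. v i = un x \<Longrightarrow> v 1 = [] \<Longrightarrow> (\<And>r. r \<ge> s + 2 \<Longrightarrow> v r = []) \<Longrightarrow>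
      runs \<Omega> n v (v(s := un (N \<Omega> x)))" using implE[OF assms(2), of i "s + 2" s] ij by force
  obtain c where c: "\<And>\<Omega> v x. v i = un x \<Longrightarrow> v 1 = [] \<Longrightarrow> (\<And>r. r \<ge> s + 2 \<Longrightarrow> v r = []) \<Longrightarrow>
      runs \<Omega> c v (v(s + 1 := un (I \<Omega> x)))" using implE[OF assms(3), of i "s + 2" "s + 1"] ij by force
  have loop: "runs \<Omega> (Loop s (Seq (Pop s) b)) v (v(s := [], s + 1 := un ((B \<Omega> ^^ k) y)))"
    if "v s = un k" "v (s + 1) = un y" "v 1 = []" "\<And>r. r \<ge> s + 2 \<Longrightarrow> v r = []" for \<Omega> v k y
    using that
  proof (induction k arbitrary: v y)
    case 0
    then show ?case by (intro runs_Loop_done) (auto simp: fun_eq_iff)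
  next
    case (Suc k)
    let ?v = "v(s := un k, s + 1 := un (B \<Omega> y))"
    have "runs \<Omega> (Seq (Pop s) b) v ?v"
      by (rule runs_trans[OF runs_Pop b[where x = y]]) (use Suc.prems ij in \<open>auto simp: fun_eq_iff\<close>)
    moreover have "runs \<Omega> (Loop s (Seq (Pop s) b)) ?v (?v(s := [], s + 1 := un ((B \<Omega> ^^ k) (B \<Omega> y))))"
      by (rule Suc.IH) (use Suc.prems ij in auto)
    moreover have "?v(s := [], s + 1 := un ((B \<Omega> ^^ k) (B \<Omega> y))) = v(s := [], s + 1 := un ((B \<Omega> ^^ Suc k) y))"
      by (auto simp: fun_eq_iff funpow_swap1)
    moreover have "v s \<noteq> []" using Suc.prems by simp
    ultimately show ?case by (rule runs_LoopI)
  qed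
  show "\<exists>c. \<forall>\<Omega> v x. v i = un x \<longrightarrow> v 1 = [] \<longrightarrow> (\<forall>r\<ge>s. v r = []) \<longrightarrow>
      runs \<Omega> c v (v(j := un ((B \<Omega> ^^ N \<Omega> x) (I \<Omega> x))))"
  proof (intro exI allI impI)
    fix \<Omega> v x assume v: "v i = un x" "v (1::nat) = []" "\<forall>r\<ge>s. v r = []"
    let ?y = "(B \<Omega> ^^ N \<Omega> x) (I \<Omega> x)"
    have "runs \<Omega> (Seq n (Seq c (Loop s (Seq (Pop s) b)))) v (v(s + 1 := un ?y))"
      by (rule runs_trans[OF n[where x = x] runs_trans[OF c[where x = x] loop[where y = "I \<Omega> x"] refl]])
         (use ij v in \<open>auto simp: fun_eq_iff\<close>)
    then show "runs \<Omega> (Seq (Seq n (Seq c (Loop s (Seq (Pop s) b)))) (Seq (clear j) (transfer (s + 1) j))) v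
        (v(j := un ((B \<Omega> ^^ N \<Omega> x) (I \<Omega> x))))"
      by (rule runs_trans[OF _ runs_trans[OF runs_clear runs_transfer[where x = ?y] refl]])
         (use ij v in \<open>auto simp: fun_eq_iff\<close>)
  qed
qed

lemma impl_if:
  assumes "impl C" "impl F" "impl G" shows "impl (\<lambda>\<Omega> x. if C \<Omega> x \<noteq> 0 then F \<Omega> x else G \<Omega> x)"
proof (rule implI)
  fix i j s :: nat assume ij: "2 \<le> i" "i < s" "2 \<le> j" "j < s"
  obtain c where c: "\<And>\<Omega> v x. v i = un x \<Longrightarrow> v 1 = [] \<Longrightarrow> (\<And>r. r \<ge> s + 1 \<Longrightarrow> v r = []) \<Longrightarrow>
      runs \<Omega> c v (v(s := un (C \<Omega> x)))" using implE[OF assms(1), of i "s + 1" s] ij by force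
  obtain f where f: "\<And>\<Omega> v x. v i = un x \<Longrightarrow> v 1 = [] \<Longrightarrow> (\<And>r. r \<ge> s \<Longrightarrow> v r = []) \<Longrightarrow>
      runs \<Omega> f v (v(j := un (F \<Omega> x)))" using implE[OF assms(2) ij] by blast
  obtain g where g: "\<And>\<Omega> v x. v i = un x \<Longrightarrow> v 1 = [] \<Longrightarrow> (\<And>r. r \<ge> s \<Longrightarrow> v r = []) \<Longrightarrow>
      runs \<Omega> g v (v(j := un (G \<Omega> x)))" using implE[OF assms(3) ij] by blast
  show "\<exists>c. \<forall>\<Omega> v x. v i = un x \<longrightarrow> v 1 = [] \<longrightarrow> (\<forall>r\<ge>s. v r = []) \<longrightarrow>
      runs \<Omega> c v (v(j := un (if C \<Omega> x \<noteq> 0 then F \<Omega> x else G \<Omega> x)))"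
  proof (intro exI allI impI)
    fix \<Omega> v x assume v: "v i = un x" "v (1::nat) = []" "\<forall>r\<ge>s. v r = []"
    have "runs \<Omega> c v (v(s := un (C \<Omega> x)))" using c v by simp
    moreover have "runs \<Omega> (Test s True (Seq (clear s) f) g) (v(s := un (C \<Omega> x)))
        (v(j := un (if C \<Omega> x \<noteq> 0 then F \<Omega> x else G \<Omega> x)))"
    proof (rule runs_Test)
      assume "peek ((v(s := un (C \<Omega> x))) s) = Some True"
      then show "runs \<Omega> (Seq (clear s) f) (v(s := un (C \<Omega> x))) (v(j := un (if C \<Omega> x \<noteq> 0 then F \<Omega> x else G \<Omega> x)))"
        by (intro runs_trans[OF runs_clear f[where x = x]]) (use ij v in \<open>auto simp: fun_eq_iff peek_un\<close>)
    next
      assume "peek ((v(s := un (C \<Omega> x))) s) \<noteq> Some True"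
      then have "C \<Omega> x = 0" by (simp add: peek_un)
      moreover from this v have "v(s := un (C \<Omega> x)) = v" by (auto simp: fun_eq_iff)
      ultimately show "runs \<Omega> g (v(s := un (C \<Omega> x))) (v(j := un (if C \<Omega> x \<noteq> 0 then F \<Omega> x else G \<Omega> x)))"
        using g[where x = x] v by auto
    qed
    ultimately show "runs \<Omega> (Seq c (Test s True (Seq (clear s) f) g)) v
        (v(j := un (if C \<Omega> x \<noteq> 0 then F \<Omega> x else G \<Omega> x)))"
      by (rule runs_Seq)
  qed
qed

section \<open>Words as numbers, and queries to the oracle\<close>

definition word_code :: "word \<Rightarrow> nat" where
  "word_code w = list_encode (map of_bool w)"

text \<open>Every nonzero entry counts as \<open>True\<close>, so each number decodes to some word
  and any functional on numbers can supply a query or an output.\<close>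

definition word_decode :: "nat \<Rightarrow> word" where
  "word_decode n = map (\<lambda>k. k \<noteq> 0) (list_decode n)"

lemma word_decode_code [simp]: "word_decode (word_code w) = w"
  by (induction w) (auto simp: word_code_def word_decode_def comp_def)

lemma word_code_simps: "word_code [] = 0" "word_code (b # w) = Suc (prod_encode (of_bool b, word_code w))"
  by (simp_all add: word_code_def)

lemma word_decode_simps: "word_decode 0 = []"
  "word_decode (Suc n) = (fst (prod_decode n) \<noteq> 0) # word_decode (snd (prod_decode n))"
  by (simp_all add: word_decode_def split: prod.splits)

definition shift :: "nat \<Rightarrow> nat \<Rightarrow> cmd" where
  "shift i k = Loop i (Test i True (Seq (Pop i) (Push k True)) (Seq (Pop i) (Push k False)))"

lemma runs_shift:
  assumes "i \<noteq> k" shows "runs \<Omega> (shift i k) v (v(i := [], k := rev (v i) @ v k))"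
proof (induction "v i" arbitrary: v)
  case Nil
  then show ?case unfolding shift_def by (intro runs_Loop_done) (auto simp: fun_eq_iff)
next
  case (Cons b w)
  let ?v = "v(i := w, k := b # v k)"
  have "runs \<Omega> (Test i True (Seq (Pop i) (Push k True)) (Seq (Pop i) (Push k False))) v ?v"
    using assms by (intro runs_Test runs_trans[OF runs_Pop runs_Push])
       (auto simp: fun_eq_iff Cons.hyps(2)[symmetric])
  moreover have "runs \<Omega> (shift i k) ?v (?v(i := [], k := rev (?v i) @ ?v k))"
    by (rule Cons.hyps(1)) (use assms in simp)
  moreover have "?v(i := [], k := rev (?v i) @ ?v k) = v(i := [], k := rev (v i) @ v k)"
    using assms by (auto simp: fun_eq_iff Cons.hyps(2)[symmetric])
  moreover have "v i \<noteq> []" by (simp add: Cons.hyps(2)[symmetric])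
  ultimately show ?case unfolding shift_def by (rule runs_LoopI)
qed

text \<open>Decoding yields the head of the word first, and pushing reverses the order;
  \<open>shift\<close> reverses it once more when the bits are moved to the oracle stack or to the
  output.\<close>

lemma unpack_cmd:
  assumes "2 \<le> p" "p < q"
  shows "\<exists>c. \<forall>\<Omega> v n. v p = un n \<longrightarrow> v 1 = [] \<longrightarrow> (\<forall>r>q. v r = []) \<longrightarrow>
     runs \<Omega> c v (v(p := [], q := rev (word_decode n) @ v q))"
proof -
  let ?h = "Suc q"
  obtain c where c: "\<And>\<Omega> v x. v p = un x \<Longrightarrow> v 1 = [] \<Longrightarrow> (\<And>r. r \<ge> q + 2 \<Longrightarrow> v r = []) \<Longrightarrow>
      runs \<Omega> c v (v(?h := un (fst (prod_decode x))))"
    using implE[OF impl_unpair(1)[OF impl_id], of p "q + 2" ?h] assms by force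
  obtain d where d: "\<And>\<Omega> v x. v p = un x \<Longrightarrow> v 1 = [] \<Longrightarrow> (\<And>r. r \<ge> q + 2 \<Longrightarrow> v r = []) \<Longrightarrow>
      runs \<Omega> d v (v(p := un (snd (prod_decode x))))"
    using implE[OF impl_unpair(2)[OF impl_id], of p "q + 2" p] assms by force
  let ?t = "Test ?h True (Push q True) (Push q False)"
  let ?b = "Seq (Pop p) (Seq c (Seq d (Seq ?t (clear ?h))))"
  have "runs \<Omega> (Loop p ?b) v (v(p := [], q := rev (word_decode n) @ v q))"
    if "v p = un n" "v 1 = []" "\<forall>r>q. v r = []" for \<Omega> v n
    using that
  proof (induction n arbitrary: v rule: less_induct)
    case (less n)
    show ?case
    proof (cases n)
      case 0
      then show ?thesis
        using less.prems by (intro runs_Loop_done) (auto simp: fun_eq_iff word_decode_simps)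
    next
      case (Suc m)
      obtain a y where ay: "prod_decode m = (a, y)" by (cases "prod_decode m")
      let ?v1 = "v(p := un m)" let ?v2 = "?v1(?h := un a)" let ?v3 = "?v2(p := un y)"
      let ?v4 = "?v3(q := (a \<noteq> 0) # v q)" let ?v5 = "?v4(?h := [])"
      have 1: "runs \<Omega> (Pop p) v ?v1" using runs_Pop[of \<Omega> p v] less.prems Suc by simp
      have 2: "runs \<Omega> c ?v1 ?v2" using c[of ?v1 m] less.prems assms ay by auto
      have 3: "runs \<Omega> d ?v2 ?v3" using d[of ?v2 m] less.prems assms ay by auto
      have 4: "runs \<Omega> ?t ?v3 ?v4"
        using assms runs_Push[of \<Omega> q True ?v3] runs_Push[of \<Omega> q False ?v3]
        by (intro runs_Test) (auto simp: peek_un)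
      have "runs \<Omega> ?b v ?v5"
        by (rule runs_Seq[OF 1 runs_Seq[OF 2 runs_Seq[OF 3 runs_Seq[OF 4 runs_clear]]]])
      moreover have "y < n" using le_prod_encode_2[of y a] ay Suc by (metis le_imp_less_Suc prod_decode_inverse)
      then have "runs \<Omega> (Loop p ?b) ?v5 (?v5(p := [], q := rev (word_decode y) @ ?v5 q))"
        by (rule less.IH) (use assms less.prems in auto)
      moreover have "?v5(p := [], q := rev (word_decode y) @ ?v5 q) = v(p := [], q := rev (word_decode n) @ v q)"
        using assms less.prems ay Suc by (auto simp: fun_eq_iff word_decode_simps)
      moreover have "v p \<noteq> []" using less.prems Suc by simp
      ultimately show ?thesis by (rule runs_LoopI)
    qed
  qed
  then show ?thesis by blast
qed

lemma pack_cmd: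
  assumes "2 \<le> p" "p < q"
  shows "\<exists>c. \<forall>\<Omega> v u. v p = un (word_code u) \<longrightarrow> v 1 = [] \<longrightarrow> (\<forall>r>q. v r = []) \<longrightarrow>
     runs \<Omega> c v (v(q := [], p := un (word_code (rev (v q) @ u))))"
proof -
  have "\<exists>c. \<forall>\<Omega> v x. v p = un x \<longrightarrow> v 1 = [] \<longrightarrow> (\<forall>r>q. v r = []) \<longrightarrow>
      runs \<Omega> c v (v(p := un (Suc (prod_encode (of_bool b, x)))))" for b
    using implE[OF impl_Suc[OF impl_pair[OF impl_const[of "of_bool b"] impl_id]], of p "Suc q" p] assms
    by (metis Suc_le_eq Suc_le_lessD less_Suc_eq)
  then obtain c where c: "\<And>b \<Omega> v x. v p = un x \<Longrightarrow> v 1 = [] \<Longrightarrow> (\<forall>r>q. v r = []) \<Longrightarrow>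
      runs \<Omega> (c b) v (v(p := un (Suc (prod_encode (of_bool b, x)))))"
    by metis
  let ?b = "Test q True (Seq (Pop q) (c True)) (Seq (Pop q) (c False))"
  have "runs \<Omega> (Loop q ?b) v (v(q := [], p := un (word_code (rev (v q) @ u))))"
    if "v p = un (word_code u)" "v 1 = []" "\<forall>r>q. v r = []" for \<Omega> v u
    using that
  proof (induction "v q" arbitrary: v u)
    case Nil
    then show ?case by (intro runs_Loop_done) (auto simp: fun_eq_iff)
  next
    case (Cons b w)
    let ?v = "v(q := w, p := un (word_code (b # u)))"
    have "runs \<Omega> ?b v ?v"
      by (rule runs_Test; rule runs_trans[OF runs_Pop c[where x = "word_code u"]])
         (use Cons.hyps(2)[symmetric] Cons.prems assms in \<open>auto simp: word_code_simps fun_eq_iff\<close>)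
    moreover have "runs \<Omega> (Loop q ?b) ?v (?v(q := [], p := un (word_code (rev (?v q) @ b # u))))"
      by (rule Cons.hyps(1)) (use Cons.prems assms in auto)
    moreover have "?v(q := [], p := un (word_code (rev (?v q) @ b # u))) = v(q := [], p := un (word_code (rev (v q) @ u)))"
      using assms by (auto simp: fun_eq_iff Cons.hyps(2)[symmetric])
    moreover have "v q \<noteq> []" by (simp add: Cons.hyps(2)[symmetric])
    ultimately show ?case by (rule runs_LoopI)
  qed
  then show ?thesis by blast
qed

text \<open>All data are unary numbers except on stack 1, where the oracle expects and returns
  words. So a query unpacks the code into bits, moves them to stack 1, and packs the answer again,
  leaving stack 1 empty as \<open>impl\<close> demands.\<close>

lemma impl_Ask:
  assumes "impl F" shows "impl (\<lambda>\<Omega> x. word_code (\<Omega> (word_decode (F \<Omega> x))))"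
proof (rule implI)
  fix i j s :: nat assume ij: "2 \<le> i" "i < s" "2 \<le> j" "j < s"
  obtain c where c: "\<And>\<Omega> v x. v i = un x \<Longrightarrow> v 1 = [] \<Longrightarrow> (\<And>r. r \<ge> s + 1 \<Longrightarrow> v r = []) \<Longrightarrow>
      runs \<Omega> c v (v(s := un (F \<Omega> x)))" using implE[OF assms(1), of i "s + 1" s] ij by force
  let ?q = "s + 1"
  obtain d where d: "\<And>\<Omega> v n. v s = un n \<Longrightarrow> v 1 = [] \<Longrightarrow> (\<forall>r>?q. v r = []) \<Longrightarrow>
     runs \<Omega> d v (v(s := [], ?q := rev (word_decode n) @ v ?q))"
    using unpack_cmd[of s ?q] ij by auto
  obtain e where e: "\<And>\<Omega> v u. v s = un (word_code u) \<Longrightarrow> v 1 = [] \<Longrightarrow> (\<forall>r>?q. v r = []) \<Longrightarrow>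
     runs \<Omega> e v (v(?q := [], s := un (word_code (rev (v ?q) @ u))))"
    using pack_cmd[of s ?q] ij by auto
  show "\<exists>c. \<forall>\<Omega> v x. v i = un x \<longrightarrow> v 1 = [] \<longrightarrow> (\<forall>r\<ge>s. v r = []) \<longrightarrow>
      runs \<Omega> c v (v(j := un (word_code (\<Omega> (word_decode (F \<Omega> x))))))"
  proof (intro exI allI impI)
    fix \<Omega> v x assume v: "v i = un x" "v (1::nat) = []" "\<forall>r\<ge>s. v r = []"
    let ?n = "F \<Omega> x" let ?w = "word_decode ?n"
    let ?v1 = "v(s := un ?n)" let ?v2 = "v(?q := rev ?w)" let ?v3 = "v(1 := ?w)"
    let ?v4 = "v(1 := \<Omega> ?w)" let ?v5 = "v(?q := rev (\<Omega> ?w))" let ?v6 = "v(s := un (word_code (\<Omega> ?w)))"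
    have 1: "runs \<Omega> c v ?v1" using c v by simp
    have "runs \<Omega> d ?v1 (?v1(s := [], ?q := rev ?w @ ?v1 ?q))" by (rule d) (use v ij in auto)
    moreover have "?v1(s := [], ?q := rev ?w @ ?v1 ?q) = ?v2" using v by (auto simp: fun_eq_iff)
    ultimately have 2: "runs \<Omega> d ?v1 ?v2" by metis
    have "runs \<Omega> (shift ?q 1) ?v2 (?v2(?q := [], 1 := rev (?v2 ?q) @ ?v2 1))"
      by (rule runs_shift) (use ij in auto)
    moreover have "?v2(?q := [], 1 := rev (?v2 ?q) @ ?v2 1) = ?v3" using v ij by (auto simp: fun_eq_iff)
    ultimately have 3: "runs \<Omega> (shift ?q 1) ?v2 ?v3" by metis
    have 4: "runs \<Omega> Ask ?v3 ?v4" using runs_Ask[of \<Omega> ?v3] by simp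
    have "runs \<Omega> (shift 1 ?q) ?v4 (?v4(1 := [], ?q := rev (?v4 1) @ ?v4 ?q))"
      by (rule runs_shift) (use ij in auto)
    moreover have "?v4(1 := [], ?q := rev (?v4 1) @ ?v4 ?q) = ?v5" using v ij by (auto simp: fun_eq_iff)
    ultimately have 5: "runs \<Omega> (shift 1 ?q) ?v4 ?v5" by metis
    have "runs \<Omega> e ?v5 (?v5(?q := [], s := un (word_code (rev (?v5 ?q) @ []))))"
      by (rule e) (use v ij in \<open>auto simp: word_code_simps\<close>)
    moreover have "?v5(?q := [], s := un (word_code (rev (?v5 ?q) @ []))) = ?v6" using v ij by (auto simp: fun_eq_iff)
    ultimately have 6: "runs \<Omega> e ?v5 ?v6" by metis
    have 7: "runs \<Omega> (Seq (clear j) (transfer s j)) ?v6 (v(j := un (word_code (\<Omega> ?w))))"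
      by (rule runs_trans[OF runs_clear runs_transfer[where x = "word_code (\<Omega> ?w)"]])
         (use v ij in \<open>auto simp: fun_eq_iff\<close>)
    show "runs \<Omega> (Seq c (Seq d (Seq (shift ?q 1) (Seq Ask (Seq (shift 1 ?q) (Seq e (Seq (clear j) (transfer s j))))))))
        v (v(j := un (word_code (\<Omega> (word_decode (F \<Omega> x))))))"
      by (intro runs_Seq[OF 1] runs_Seq[OF 2] runs_Seq[OF 3] runs_Seq[OF 4] runs_Seq[OF 5] runs_Seq[OF 6] 7)
  qed
qed

theorem impl_imp_machine:
  assumes "impl F"
  shows "\<exists>M. \<forall>\<Omega> w. outputs M \<Omega> w (word_decode (F \<Omega> (word_code w)))"
proof -
  obtain c where c: "\<And>\<Omega> v x. v 2 = un x \<Longrightarrow> v 1 = [] \<Longrightarrow> (\<And>r. r \<ge> 3 \<Longrightarrow> v r = []) \<Longrightarrow>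
      runs \<Omega> c v (v(2 := un (F \<Omega> x)))" using implE[OF assms, of 2 3 2] by force
  obtain d where d: "\<And>\<Omega> v n. v 2 = un n \<Longrightarrow> v 1 = [] \<Longrightarrow> (\<forall>r>3. v r = []) \<Longrightarrow>
     runs \<Omega> d v (v(2 := [], 3 := rev (word_decode n) @ v 3))"
    using unpack_cmd[of 2 3] by auto
  obtain e where e: "\<And>\<Omega> v u. v 2 = un (word_code u) \<Longrightarrow> v 1 = [] \<Longrightarrow> (\<forall>r>3. v r = []) \<Longrightarrow>
     runs \<Omega> e v (v(3 := [], 2 := un (word_code (rev (v 3) @ u))))"
    using pack_cmd[of 2 3] by auto
  have "\<exists>v. runs \<Omega> (Seq (shift 0 3) (Seq e (Seq c (Seq d (shift 3 0))))) ((\<lambda>_. [])(0 := w)) v \<and>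
      v 0 = word_decode (F \<Omega> (word_code w))" for \<Omega> w
  proof -
    let ?z = "\<lambda>_::nat. [] :: bool list" let ?n = "F \<Omega> (word_code w)"
    have "runs \<Omega> (shift 0 3) (?z(0 := w)) ((?z(0 := w))(0 := [], 3 := rev ((?z(0 := w)) 0) @ (?z(0 := w)) 3))"
      by (rule runs_shift) simp
    moreover have "(?z(0 := w))(0 := [], 3 := rev ((?z(0 := w)) 0) @ (?z(0 := w)) 3) = ?z(3 := rev w)" by auto
    ultimately have 1: "runs \<Omega> (shift 0 3) (?z(0 := w)) (?z(3 := rev w))" by metis
    have "runs \<Omega> e (?z(3 := rev w)) ((?z(3 := rev w))(3 := [], 2 := un (word_code (rev ((?z(3 := rev w)) 3) @ []))))"
      by (rule e) (auto simp: word_code_simps)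
    moreover have "(?z(3 := rev w))(3 := [], 2 := un (word_code (rev ((?z(3 := rev w)) 3) @ []))) = ?z(2 := un (word_code w))"
      by auto
    ultimately have 2: "runs \<Omega> e (?z(3 := rev w)) (?z(2 := un (word_code w)))" by metis
    have 3: "runs \<Omega> c (?z(2 := un (word_code w))) (?z(2 := un ?n))"
      using c[of "?z(2 := un (word_code w))"] by simp
    have "runs \<Omega> d (?z(2 := un ?n)) ((?z(2 := un ?n))(2 := [], 3 := rev (word_decode ?n) @ (?z(2 := un ?n)) 3))"
      by (rule d) auto
    moreover have "(?z(2 := un ?n))(2 := [], 3 := rev (word_decode ?n) @ (?z(2 := un ?n)) 3) = ?z(3 := rev (word_decode ?n))"
      by auto
    ultimately have 4: "runs \<Omega> d (?z(2 := un ?n)) (?z(3 := rev (word_decode ?n)))" by metis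
    have 5: "runs \<Omega> (shift 3 0) (?z(3 := rev (word_decode ?n))) (?z(0 := word_decode ?n))"
      using runs_shift[of 3 0 \<Omega> "?z(3 := rev (word_decode ?n))"] by (simp add: fun_upd_def if_distrib cong: if_cong)
    show ?thesis
      by (intro exI conjI, rule runs_Seq[OF 1 runs_Seq[OF 2 runs_Seq[OF 3 runs_Seq[OF 4 5]]]]) simp
  qed
  then show ?thesis using runs_imp_machine by metis
qed

section \<open>Computable functionals on encoded types\<close>

text \<open>Computations take place on codes, and a function on numbers may do anything off the
  codes, so injectivity is enough. Surjectivity is asked for separately where arbitrary numbers have
  to be decoded.\<close>

class enc =
  fixes enc :: "'a \<Rightarrow> nat"
  assumes inj_enc: "enc x = enc y \<Longrightarrow> x = y"
begin

lemma enc_eq_iff [simp]: "enc x = enc y \<longleftrightarrow> x = y"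
  using inj_enc by blast

end

instantiation nat :: enc begin
definition enc_nat' [simp]: "enc (n :: nat) = n"
instance by standard simp
end

instantiation bool :: enc begin
definition enc_bool [simp]: "enc (b :: bool) = (of_bool b :: nat)"
instance
proof
  show "enc x = enc y \<Longrightarrow> x = y" for x y :: bool by (cases x; cases y) simp_all
qed
end

instantiation prod :: (enc, enc) enc begin
definition enc_prod: "enc p = prod_encode (enc (fst p), enc (snd p))"
instance by standard (auto simp: enc_prod prod_eq_iff)
end

instantiation list :: (enc) enc begin
definition enc_list: "enc xs = list_encode (map enc xs)"
instance
proof
  fix xs ys :: "'a list" assume "enc xs = enc ys"
  then have "map enc xs = map enc ys"
    unfolding enc_list by (metis list_encode_inverse)
  moreover have "inj (enc :: 'a \<Rightarrow> nat)" by (simp add: inj_def)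
  ultimately show "xs = ys" using map_injective by blast
qed
end

instantiation option :: (enc) enc begin
definition enc_option: "enc x = (case x of None \<Rightarrow> 0 | Some y \<Rightarrow> Suc (enc y))"
instance by standard (auto simp: enc_option split: option.splits)
end

lemma enc_pair [simp]: "enc (a, b) = prod_encode (enc a, enc b)"
  by (simp add: enc_prod)

lemma enc_list_simps [simp]: "enc [] = 0" "enc (x # xs) = Suc (prod_encode (enc x, enc xs))"
  by (simp_all add: enc_list)

lemma enc_word: "enc (w :: word) = word_code w"
proof -
  have "(enc :: bool \<Rightarrow> nat) = of_bool" by (rule ext) simp
  then show ?thesis by (simp add: enc_list word_code_def)
qed

text \<open>Computability of a total functional relative to an oracle, by one program for all
  oracles. The closure rules are collected in \<open>cmp_intros\<close>, so that for an explicit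
  formula it is proved by following the syntax.\<close>

definition cmp :: "((word \<Rightarrow> word) \<Rightarrow> 'a::enc \<Rightarrow> 'b::enc) \<Rightarrow> bool" where
  "cmp F \<longleftrightarrow> (\<exists>G. impl G \<and> (\<forall>\<Omega> x. enc (F \<Omega> x) = G \<Omega> (enc x)))"

named_theorems cmp_intros

theorem cmp_imp_machine:
  assumes "cmp F" shows "\<exists>M. \<forall>\<Omega> w. outputs M \<Omega> w (F \<Omega> w)"
proof -
  obtain G where G: "impl G" "\<And>\<Omega> w. enc (F \<Omega> w) = G \<Omega> (enc w)"
    using assms by (auto simp: cmp_def)
  have "word_decode (G \<Omega> (word_code w)) = F \<Omega> w" for \<Omega> w
    using G(2)[of \<Omega> w] by (metis enc_word word_decode_code)
  then show ?thesis using impl_imp_machine[OF G(1)] by simp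
qed

lemma cmpI: "impl G \<Longrightarrow> (\<And>\<Omega> x. enc (F \<Omega> x) = G \<Omega> (enc x)) \<Longrightarrow> cmp F"
  by (auto simp: cmp_def)

text \<open>Types are changed at no cost when the codes agree, for instance from a tape to its two
  lists of cells, or from a rational number to its normalised fraction.\<close>

lemma cmp_same_code: "cmp F \<Longrightarrow> (\<And>\<Omega> x. enc (F' \<Omega> x) = enc (F \<Omega> x)) \<Longrightarrow> cmp F'"
  by (auto simp: cmp_def)

lemma cmp_cong: "cmp F \<Longrightarrow> (\<And>\<Omega> x. F' \<Omega> x = F \<Omega> x) \<Longrightarrow> cmp F'"
  by (rule cmp_same_code) auto

lemma cmp_id [cmp_intros]: "cmp (\<lambda>\<Omega> x. x)"
  by (rule cmpI[OF impl_id]) simp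

lemma cmp_const [cmp_intros]: "cmp (\<lambda>\<Omega> x. c)"
  by (rule cmpI[OF impl_const]) simp

lemma cmp_compose: "cmp F \<Longrightarrow> cmp G \<Longrightarrow> cmp (\<lambda>\<Omega> x. F \<Omega> (G \<Omega> x))"
proof -
  assume "cmp F" "cmp G"
  then obtain f g where "impl f" "impl g" "\<And>\<Omega> x. enc (F \<Omega> x) = f \<Omega> (enc x)"
    "\<And>\<Omega> x. enc (G \<Omega> x) = g \<Omega> (enc x)"
    by (auto simp: cmp_def)
  then show ?thesis by (intro cmpI[OF impl_comp[of f g]]) auto
qed

lemma cmp_app: "cmp (\<lambda>\<Omega>. h) \<Longrightarrow> cmp F \<Longrightarrow> cmp (\<lambda>\<Omega> x. h (F \<Omega> x))"
  by (rule cmp_compose)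

lemma cmp_Pair [cmp_intros]: "cmp F \<Longrightarrow> cmp G \<Longrightarrow> cmp (\<lambda>\<Omega> x. (F \<Omega> x, G \<Omega> x))"
proof -
  assume "cmp F" "cmp G"
  then obtain f g where "impl f" "impl g" "\<And>\<Omega> x. enc (F \<Omega> x) = f \<Omega> (enc x)"
    "\<And>\<Omega> x. enc (G \<Omega> x) = g \<Omega> (enc x)"
    by (auto simp: cmp_def)
  then show ?thesis by (intro cmpI[OF impl_pair[of f g]]) auto
qed

lemma cmp_app2:
  "cmp (\<lambda>\<Omega> p. h (fst p) (snd p)) \<Longrightarrow> cmp F \<Longrightarrow> cmp G \<Longrightarrow> cmp (\<lambda>\<Omega> x. h (F \<Omega> x) (G \<Omega> x))"
  using cmp_compose[of "\<lambda>\<Omega> p. h (fst p) (snd p)" "\<lambda>\<Omega> x. (F \<Omega> x, G \<Omega> x)"] by (simp add: cmp_Pair)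

lemma cmp_fst [cmp_intros]: "cmp F \<Longrightarrow> cmp (\<lambda>\<Omega> x. fst (F \<Omega> x))"
  by (rule cmp_app[of fst], rule cmpI[OF impl_unpair(1)[OF impl_id]]) (simp add: enc_prod)

lemma cmp_snd [cmp_intros]: "cmp F \<Longrightarrow> cmp (\<lambda>\<Omega> x. snd (F \<Omega> x))"
  by (rule cmp_app[of snd], rule cmpI[OF impl_unpair(2)[OF impl_id]]) (simp add: enc_prod)

lemma cmp_Ask [cmp_intros]: "cmp F \<Longrightarrow> cmp (\<lambda>\<Omega> x. \<Omega> (F \<Omega> x))"
  by (rule cmp_compose[of "\<lambda>\<Omega>. \<Omega>"], rule cmpI[OF impl_Ask[OF impl_id]]) (simp_all add: enc_word)

lemma cmp_if [cmp_intros]: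
  assumes "cmp P" "cmp F" "cmp G" shows "cmp (\<lambda>\<Omega> x. if P \<Omega> x then F \<Omega> x else G \<Omega> x)"
proof -
  obtain p f g where "impl p" "impl f" "impl g" "\<And>\<Omega> x. enc (P \<Omega> x) = p \<Omega> (enc x)"
    "\<And>\<Omega> x. enc (F \<Omega> x) = f \<Omega> (enc x)" "\<And>\<Omega> x. enc (G \<Omega> x) = g \<Omega> (enc x)"
    using assms by (auto simp: cmp_def)
  moreover from this have "p \<Omega> (enc x) \<noteq> 0 \<longleftrightarrow> P \<Omega> x" for \<Omega> x
    by (metis enc_bool of_bool_eq zero_neq_one)
  ultimately show ?thesis
    by (intro cmpI[OF impl_if[of p f g]]) simp_all
qed

text \<open>The loop body may depend on the input \<open>x\<close>, whereas the body in
  \<open>impl_iterate\<close> sees only its state. So the state carries the code of \<open>x\<close>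
  along.\<close>

lemma cmp_iterate [cmp_intros]:
  fixes B :: "(word \<Rightarrow> word) \<Rightarrow> 'a::enc \<Rightarrow> 'b::enc \<Rightarrow> 'b"
  assumes "cmp (\<lambda>\<Omega> p. B \<Omega> (fst p) (snd p))" "cmp N" "cmp I"
  shows "cmp (\<lambda>\<Omega> x. (B \<Omega> x ^^ N \<Omega> x) (I \<Omega> x))"
proof -
  obtain b n i where b: "impl b" "\<And>\<Omega> x s. enc (B \<Omega> x s) = b \<Omega> (prod_encode (enc x, enc s))"
    and n: "impl n" "\<And>\<Omega> x. N \<Omega> x = n \<Omega> (enc x)" and i: "impl i" "\<And>\<Omega> x. enc (I \<Omega> x) = i \<Omega> (enc x)"
    using assms by (auto simp: cmp_def)
  let ?b = "\<lambda>\<Omega> c. prod_encode (fst (prod_decode c), b \<Omega> c)"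
  let ?i = "\<lambda>\<Omega> c. prod_encode (c, i \<Omega> c)"
  have "(?b \<Omega> ^^ k) (prod_encode (enc x, enc s)) = prod_encode (enc x, enc ((B \<Omega> x ^^ k) s))" for \<Omega> x s k
    by (induction k) (simp_all add: b(2))
  then have "enc ((B \<Omega> x ^^ N \<Omega> x) (I \<Omega> x)) = snd (prod_decode ((?b \<Omega> ^^ n \<Omega> (enc x)) (?i \<Omega> (enc x))))" for \<Omega> x
    by (simp add: n(2) i(2)[symmetric])
  moreover have "impl (\<lambda>\<Omega> c. snd (prod_decode ((?b \<Omega> ^^ n \<Omega> c) (?i \<Omega> c))))"
    by (intro impl_unpair(2) impl_iterate impl_pair impl_unpair(1) impl_id b(1) n(1) i(1))
  ultimately show ?thesis by (rule cmpI[rotated])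
qed


subsection \<open>Natural numbers and truth values\<close>

lemma cmp_Suc [cmp_intros]: "cmp F \<Longrightarrow> cmp (\<lambda>\<Omega> x. Suc (F \<Omega> x))"
  by (rule cmp_app[of Suc], rule cmpI[OF impl_Suc[OF impl_id]]) simp

lemma cmp_enc [cmp_intros]: "cmp F \<Longrightarrow> cmp (\<lambda>\<Omega> x. enc (F \<Omega> x))"
  by (erule cmp_same_code) simp

lemma funpow_Suc_eq: "(Suc ^^ m) n = m + n"
  by (induction m) auto

lemma cmp_add [cmp_intros]: "cmp F \<Longrightarrow> cmp G \<Longrightarrow> cmp (\<lambda>\<Omega> x. F \<Omega> x + (G \<Omega> x :: nat))"
  by (rule cmp_cong[of "\<lambda>\<Omega> x. (Suc ^^ F \<Omega> x) (G \<Omega> x)"])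
     (intro cmp_intros, auto simp: funpow_Suc_eq)

lemma cmp_diff [cmp_intros]: "cmp F \<Longrightarrow> cmp G \<Longrightarrow> cmp (\<lambda>\<Omega> x. F \<Omega> x - (G \<Omega> x :: nat))"
proof (rule cmp_cong[of "\<lambda>\<Omega> x. ((\<lambda>s. s - 1) ^^ G \<Omega> x) (F \<Omega> x)"])
  assume FG: "cmp F" "cmp G"
  have "cmp (\<lambda>\<Omega> n. n - 1 :: nat)" by (rule cmpI[OF impl_pred[OF impl_id]]) simp
  note dec = cmp_app[OF this]
  show "cmp (\<lambda>\<Omega> x. ((\<lambda>s. s - 1) ^^ G \<Omega> x) (F \<Omega> x))"
    by (intro cmp_iterate dec cmp_snd cmp_id FG)
  have "((\<lambda>s. s - 1) ^^ n) m = m - n" for m n :: nat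
    by (induction n) auto
  then show "F \<Omega> x - G \<Omega> x = ((\<lambda>s. s - 1) ^^ G \<Omega> x) (F \<Omega> x)" for \<Omega> x by simp
qed

lemma cmp_mult [cmp_intros]: "cmp F \<Longrightarrow> cmp G \<Longrightarrow> cmp (\<lambda>\<Omega> x. F \<Omega> x * (G \<Omega> x :: nat))"
proof (rule cmp_cong[of "\<lambda>\<Omega> x. ((\<lambda>s. s + G \<Omega> x) ^^ F \<Omega> x) 0"])
  assume FG: "cmp F" "cmp G"
  show "cmp (\<lambda>\<Omega> x. ((\<lambda>s. s + G \<Omega> x) ^^ F \<Omega> x) 0)"
    by (intro cmp_intros cmp_compose[OF FG(2)] FG)
  have "((\<lambda>s. s + n) ^^ m) 0 = m * n" for m n :: nat
    by (induction m) auto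
  then show "F \<Omega> x * G \<Omega> x = ((\<lambda>s. s + G \<Omega> x) ^^ F \<Omega> x) 0" for \<Omega> x by simp
qed

lemma cmp_le [cmp_intros]: "cmp F \<Longrightarrow> cmp G \<Longrightarrow> cmp (\<lambda>\<Omega> x. F \<Omega> x \<le> (G \<Omega> x :: nat))"
proof (rule cmp_cong[of "\<lambda>\<Omega> x. F \<Omega> x - G \<Omega> x = 0"])
  assume FG: "cmp F" "cmp G"
  have "cmp (\<lambda>\<Omega> n. (n :: nat) = 0)"
    by (rule cmpI[OF impl_if[OF impl_id impl_const[of 0] impl_const[of 1]]]) simp
  from cmp_app[OF this, of "\<lambda>\<Omega> x. F \<Omega> x - G \<Omega> x"] show "cmp (\<lambda>\<Omega> x. F \<Omega> x - G \<Omega> x = 0)"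
    by (simp only: cmp_diff FG)
qed auto

lemma cmp_conj [cmp_intros]: "cmp F \<Longrightarrow> cmp G \<Longrightarrow> cmp (\<lambda>\<Omega> x. F \<Omega> x \<and> G \<Omega> x)"
  by (rule cmp_cong[of "\<lambda>\<Omega> x. if F \<Omega> x then G \<Omega> x else False"]) (intro cmp_intros, auto)

lemma cmp_not [cmp_intros]: "cmp F \<Longrightarrow> cmp (\<lambda>\<Omega> x. \<not> F \<Omega> x)"
  by (rule cmp_cong[of "\<lambda>\<Omega> x. if F \<Omega> x then False else True"]) (intro cmp_intros, auto)

lemma cmp_less [cmp_intros]: "cmp F \<Longrightarrow> cmp G \<Longrightarrow> cmp (\<lambda>\<Omega> x. F \<Omega> x < (G \<Omega> x :: nat))"
  by (rule cmp_cong[of "\<lambda>\<Omega> x. \<not> G \<Omega> x \<le> F \<Omega> x"]) (intro cmp_intros, auto)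

lemma cmp_eq [cmp_intros]: "cmp F \<Longrightarrow> cmp G \<Longrightarrow> cmp (\<lambda>\<Omega> x. F \<Omega> x = G \<Omega> x)"
  by (rule cmp_cong[of "\<lambda>\<Omega> x. enc (F \<Omega> x) \<le> enc (G \<Omega> x) \<and> enc (G \<Omega> x) \<le> enc (F \<Omega> x)"])
     (intro cmp_intros, auto simp: eq_iff[symmetric])

lemma cmp_power [cmp_intros]: "cmp F \<Longrightarrow> cmp G \<Longrightarrow> cmp (\<lambda>\<Omega> x. F \<Omega> x ^ (G \<Omega> x) :: nat)"
proof (rule cmp_cong[of "\<lambda>\<Omega> x. ((\<lambda>s. s * F \<Omega> x) ^^ G \<Omega> x) 1"])
  assume FG: "cmp F" "cmp G"
  show "cmp (\<lambda>\<Omega> x. ((\<lambda>s. s * F \<Omega> x) ^^ G \<Omega> x) 1)"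
    by (intro cmp_intros cmp_compose[OF FG(1)] FG)
  have "((\<lambda>s. s * a) ^^ n) 1 = a ^ n" for a n :: nat
    by (induction n) auto
  then show "F \<Omega> x ^ G \<Omega> x = ((\<lambda>s. s * F \<Omega> x) ^^ G \<Omega> x) 1" for \<Omega> x by simp
qed

text \<open>Repeated subtraction. For a positive divisor \<open>Suc m\<close> rounds exceed the
  quotient, and surplus rounds change nothing; a zero divisor is treated apart.\<close>

lemma cmp_div [cmp_intros]: "cmp F \<Longrightarrow> cmp G \<Longrightarrow> cmp (\<lambda>\<Omega> x. F \<Omega> x div (G \<Omega> x :: nat))"
proof -
  define h where "h = (\<lambda>n p :: nat \<times> nat. if n \<le> snd p then (Suc (fst p), snd p - n) else p)"
  have "(h n ^^ k) (0, m) = (if k * n \<le> m then (k, m - k * n) else (m div n, m mod n))"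
    if "n > 0" for n m k
  proof (induction k)
    case (Suc k)
    show ?case
    proof (cases "k * n \<le> m")
      case True
      have "Suc k * n \<le> m \<longleftrightarrow> n \<le> m - k * n" using True by auto
      moreover have "m div n = k \<and> m mod n = m - k * n" if "\<not> n \<le> m - k * n"
      proof -
        have "m = (m - k * n) + k * n" using True by simp
        then show ?thesis using that \<open>n > 0\<close>
          by (metis add_diff_cancel_left' add.commute div_mult_self1_is_m div_less div_mult_self1
              mod_less mod_mult_self1 not_le not_less_zero plus_nat.add_0)
      qed
      ultimately show ?thesis using Suc.IH True by (auto simp: h_def)
    next
      case False
      then have "\<not> Suc k * n \<le> m" by auto
      moreover have "\<not> n \<le> m mod n" using that by (simp add: not_le)
      ultimately show ?thesis using Suc.IH False by (auto simp: h_def)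
    qed
  qed auto
  moreover have "\<not> Suc m * n \<le> m" if "n > 0" for m n :: nat
    using that by (cases n) auto
  ultimately have eq: "m div n = (if n = 0 then 0 else fst ((h n ^^ Suc m) (0, m)))" for m n
    by (simp del: funpow.simps)
  assume FG: "cmp F" "cmp G"
  show ?thesis unfolding eq h_def
    by (intro cmp_intros cmp_compose[OF FG(2)] FG)
qed

lemma cmp_mod [cmp_intros]: "cmp F \<Longrightarrow> cmp G \<Longrightarrow> cmp (\<lambda>\<Omega> x. F \<Omega> x mod (G \<Omega> x :: nat))"
  by (simp only: minus_div_mult_eq_mod[symmetric]) (intro cmp_intros)

text \<open>Euclid's algorithm. The second entry drops in each round until it is 0, so one round
  more than its initial value suffices.\<close>

lemma cmp_gcd [cmp_intros]: "cmp F \<Longrightarrow> cmp G \<Longrightarrow> cmp (\<lambda>\<Omega> x. gcd (F \<Omega> x) (G \<Omega> x :: nat))"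
proof -
  define h where "h = (\<lambda>p :: nat \<times> nat. if snd p = 0 then p else (snd p, fst p mod snd p))"
  have "gcd (fst ((h ^^ k) p)) (snd ((h ^^ k) p)) = gcd (fst p) (snd p) \<and>
      (snd ((h ^^ k) p) = 0 \<or> snd ((h ^^ k) p) + k \<le> snd p)" for k p
  proof (induction k)
    case (Suc k)
    let ?q = "(h ^^ k) p"
    show ?case
    proof (cases "snd ?q = 0")
      case False
      then have "fst ?q mod snd ?q < snd ?q" by simp
      moreover have "gcd (snd ?q) (fst ?q mod snd ?q) = gcd (fst ?q) (snd ?q)"
        by (metis gcd.commute gcd_red_nat)
      ultimately show ?thesis using Suc.IH False by (auto simp: h_def)
    qed (use Suc.IH in \<open>auto simp: h_def\<close>)
  qed auto
  note inv = this[of "Suc (snd p)" p for p]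
  have "snd ((h ^^ Suc (snd p)) p) = 0" "gcd (fst ((h ^^ Suc (snd p)) p)) (snd ((h ^^ Suc (snd p)) p)) = gcd (fst p) (snd p)" for p
    using inv[of p] by (auto simp del: funpow.simps)
  then have eq: "gcd m n = fst ((h ^^ Suc n) (m, n))" for m n
    by (metis fst_conv gcd_0_nat snd_conv)
  assume FG: "cmp F" "cmp G"
  show ?thesis unfolding eq h_def by (intro cmp_intros FG)
qed


subsection \<open>Lists and options\<close>

lemma cmp_Cons [cmp_intros]: "cmp F \<Longrightarrow> cmp G \<Longrightarrow> cmp (\<lambda>\<Omega> x. F \<Omega> x # G \<Omega> x)"
  by (rule cmp_same_code[of "\<lambda>\<Omega> x. Suc (enc (F \<Omega> x, G \<Omega> x))"]) (intro cmp_intros, auto)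

lemma cmp_tl [cmp_intros]: "cmp F \<Longrightarrow> cmp (\<lambda>\<Omega> x. tl (F \<Omega> x))"
proof (rule cmp_app[of tl])
  have "prod_decode 0 = (0, 0)" using prod_encode_inverse[of "(0, 0)"] by (simp add: prod_encode_def)
  then have "enc (tl xs) = snd (prod_decode (enc xs - 1))" for xs :: "'b list"
    by (cases xs) auto
  then show "cmp (\<lambda>\<Omega>. tl :: 'b list \<Rightarrow> _)"
    by (intro cmpI[OF impl_unpair(2)[OF impl_pred[OF impl_id]]])
qed

text \<open>The value of \<open>hd []\<close> is unspecified but fixed, so its code can be used as a
  constant. The same device makes \<open>the\<close> computable.\<close>

lemma cmp_hd [cmp_intros]: "cmp F \<Longrightarrow> cmp (\<lambda>\<Omega> x. hd (F \<Omega> x))"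
proof (rule cmp_app[of hd])
  show "cmp (\<lambda>\<Omega>. hd :: 'b list \<Rightarrow> _)"
  proof (rule cmpI[OF impl_if[OF impl_id impl_unpair(1)[OF impl_pred[OF impl_id]] impl_const]])
    show "enc (hd xs) = (if enc xs \<noteq> 0 then fst (prod_decode (enc xs - 1)) else enc (hd [] :: 'b))" for xs :: "'b list"
      by (cases xs) auto
  qed
qed

lemma length_le_enc: "length xs \<le> enc xs"
proof (induction xs)
  case (Cons x xs)
  then show ?case using le_prod_encode_2[of "enc xs" "enc x"] by simp
qed simp

text \<open>The loop needs a bound on the length before the length is known to be computable; the
  code of the list is such a bound. Once the list is used up the rounds are idle.\<close>

lemma cmp_foldl [cmp_intros]:
  assumes "cmp (\<lambda>\<Omega> p. B \<Omega> (fst p) (fst (snd p)) (snd (snd p)))" "cmp I" "cmp L"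
  shows "cmp (\<lambda>\<Omega> x. foldl (B \<Omega> x) (I \<Omega> x) (L \<Omega> x))"
proof -
  define h where "h = (\<lambda>\<Omega> x p. if snd p = [] then p else (B \<Omega> x (fst p) (hd (snd p)), tl (snd p)))"
  have fold: "(h \<Omega> x ^^ n) (a, xs) = (foldl (B \<Omega> x) a xs, [])" if "length xs \<le> n" for \<Omega> x n a xs
    using that
  proof (induction n arbitrary: a xs)
    case (Suc n)
    show ?case
    proof (cases xs)
      case Nil
      have "(h \<Omega> x ^^ n) (a, []) = (a, [])" using Suc.IH[of "[]" a] by simp
      then show ?thesis using Nil by (simp add: h_def)
    next
      case (Cons y ys)
      then have "h \<Omega> x (a, xs) = (B \<Omega> x a y, ys)" by (simp add: h_def)
      then show ?thesis using Suc Cons by (simp add: funpow_Suc_right del: funpow.simps)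
    qed
  qed auto
  have eq: "foldl (B \<Omega> x) (I \<Omega> x) (L \<Omega> x) = fst ((h \<Omega> x ^^ enc (L \<Omega> x)) (I \<Omega> x, L \<Omega> x))" for \<Omega> x
    by (subst fold[OF length_le_enc]) simp
  have "cmp (\<lambda>\<Omega> p. B \<Omega> (fst p) (fst (snd p)) (hd (snd (snd p))))"
    using cmp_compose[OF assms(1), of "\<lambda>\<Omega> p. (fst p, fst (snd p), hd (snd (snd p)))"]
    by (simp add: cmp_intros)
  then have "cmp (\<lambda>\<Omega> p. h \<Omega> (fst p) (snd p))" unfolding h_def by (intro cmp_intros)
  then show ?thesis unfolding eq by (intro cmp_intros assms)
qed

lemma cmp_rev [cmp_intros]: "cmp F \<Longrightarrow> cmp (\<lambda>\<Omega> x. rev (F \<Omega> x))"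
proof (rule cmp_app[of rev])
  have "foldl (\<lambda>a y. y # a) a xs = rev xs @ a" for a xs :: "'b list"
    by (induction xs arbitrary: a) auto
  then have eq: "rev xs = foldl (\<lambda>a y. y # a) [] xs" for xs :: "'b list" by simp
  have "cmp (\<lambda>\<Omega> xs :: 'b list. foldl (\<lambda>a y. y # a) [] xs)" by (intro cmp_intros)
  then show "cmp (\<lambda>\<Omega>. rev :: 'b list \<Rightarrow> _)"
    by (rule cmp_cong) (rule eq)
qed

lemma cmp_foldr [cmp_intros]:
  assumes "cmp (\<lambda>\<Omega> p. B \<Omega> (fst p) (fst (snd p)) (snd (snd p)))" "cmp L" "cmp I"
  shows "cmp (\<lambda>\<Omega> x. foldr (B \<Omega> x) (L \<Omega> x) (I \<Omega> x))"
  unfolding foldr_conv_foldl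
  using cmp_compose[OF assms(1), of "\<lambda>\<Omega> p. (fst p, snd (snd p), fst (snd p))"]
  by (intro cmp_intros assms(2,3)) (simp add: cmp_intros)

lemma cmp_append [cmp_intros]: "cmp F \<Longrightarrow> cmp G \<Longrightarrow> cmp (\<lambda>\<Omega> x. F \<Omega> x @ G \<Omega> x)"
proof (rule cmp_cong[of "\<lambda>\<Omega> x. foldr (\<lambda>y a. y # a) (F \<Omega> x) (G \<Omega> x)"])
  have "foldr (\<lambda>y a. y # a) xs ys = xs @ ys" for xs ys :: "'b list" by (induction xs) auto
  then show "F \<Omega> x @ G \<Omega> x = foldr (\<lambda>y a. y # a) (F \<Omega> x) (G \<Omega> x)" for \<Omega> x by simp
qed (intro cmp_intros)

lemma cmp_map [cmp_intros]:
  assumes "cmp (\<lambda>\<Omega> p. B \<Omega> (fst p) (snd p))" "cmp L" shows "cmp (\<lambda>\<Omega> x. map (B \<Omega> x) (L \<Omega> x))"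
proof (rule cmp_cong[of "\<lambda>\<Omega> x. foldr (\<lambda>y a. B \<Omega> x y # a) (L \<Omega> x) []"])
  show "map (B \<Omega> x) (L \<Omega> x) = foldr (\<lambda>y a. B \<Omega> x y # a) (L \<Omega> x) []" for \<Omega> x
  proof -
    have "map g xs = foldr (\<lambda>y a. g y # a) xs []" for g :: "'b \<Rightarrow> 'c" and xs by (induction xs) auto
    then show ?thesis by simp
  qed
  show "cmp (\<lambda>\<Omega> x. foldr (\<lambda>y a. B \<Omega> x y # a) (L \<Omega> x) [])"
    using cmp_compose[OF assms(1), of "\<lambda>\<Omega> p. (fst p, fst (snd p))"]
    by (intro cmp_intros assms(2)) (simp add: cmp_intros)
qed

lemma cmp_concat [cmp_intros]: "cmp F \<Longrightarrow> cmp (\<lambda>\<Omega> x. concat (F \<Omega> x))"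
  unfolding concat_conv_foldr by (intro cmp_intros)

lemma cmp_length [cmp_intros]: "cmp F \<Longrightarrow> cmp (\<lambda>\<Omega> x. length (F \<Omega> x))"
proof (rule cmp_cong[of "\<lambda>\<Omega> x. foldl (\<lambda>n y. Suc n) 0 (F \<Omega> x)"])
  have "foldl (\<lambda>n y. Suc n) m xs = m + length xs" for m and xs :: "'b list"
    by (induction xs arbitrary: m) auto
  then show "length (F \<Omega> x) = foldl (\<lambda>n y. Suc n) 0 (F \<Omega> x)" for \<Omega> x by simp
qed (intro cmp_intros)

lemma cmp_replicate [cmp_intros]:
  assumes "cmp N" "cmp F" shows "cmp (\<lambda>\<Omega> x. replicate (N \<Omega> x) (F \<Omega> x))"
proof (rule cmp_cong[of "\<lambda>\<Omega> x. ((\<lambda>a. F \<Omega> x # a) ^^ N \<Omega> x) []"])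
  have "replicate n y = ((\<lambda>a. y # a) ^^ n) []" for n and y :: 'b by (induction n) auto
  then show "replicate (N \<Omega> x) (F \<Omega> x) = ((\<lambda>a. F \<Omega> x # a) ^^ N \<Omega> x) []" for \<Omega> x by simp
qed (intro cmp_intros cmp_compose[OF assms(2)] assms)

lemma cmp_drop [cmp_intros]: "cmp N \<Longrightarrow> cmp F \<Longrightarrow> cmp (\<lambda>\<Omega> x. drop (N \<Omega> x) (F \<Omega> x))"
proof (rule cmp_cong[of "\<lambda>\<Omega> x. (tl ^^ N \<Omega> x) (F \<Omega> x)"])
  have "drop n xs = (tl ^^ n) xs" for n and xs :: "'b list"
    by (induction n arbitrary: xs) (auto simp: drop_Suc funpow_swap1 tl_drop)
  then show "drop (N \<Omega> x) (F \<Omega> x) = (tl ^^ N \<Omega> x) (F \<Omega> x)" for \<Omega> x by simp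
qed (intro cmp_intros)

lemma cmp_takeWhile [cmp_intros]:
  assumes "cmp (\<lambda>\<Omega> p. P \<Omega> (fst p) (snd p))" "cmp L" shows "cmp (\<lambda>\<Omega> x. takeWhile (P \<Omega> x) (L \<Omega> x))"
proof (rule cmp_cong[of "\<lambda>\<Omega> x. foldr (\<lambda>y a. if P \<Omega> x y then y # a else []) (L \<Omega> x) []"])
  have "takeWhile g xs = foldr (\<lambda>y a. if g y then y # a else []) xs []" for g and xs :: "'b list"
    by (induction xs) auto
  then show "takeWhile (P \<Omega> x) (L \<Omega> x) = foldr (\<lambda>y a. if P \<Omega> x y then y # a else []) (L \<Omega> x) []" for \<Omega> x
    by simp
  show "cmp (\<lambda>\<Omega> x. foldr (\<lambda>y a. if P \<Omega> x y then y # a else []) (L \<Omega> x) [])"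
    using cmp_compose[OF assms(1), of "\<lambda>\<Omega> p. (fst p, fst (snd p))"]
    by (intro cmp_intros assms(2)) (simp_all add: cmp_intros)
qed

lemma cmp_Some [cmp_intros]: "cmp F \<Longrightarrow> cmp (\<lambda>\<Omega> x. Some (F \<Omega> x))"
  by (rule cmp_same_code[of "\<lambda>\<Omega> x. Suc (enc (F \<Omega> x))"]) (intro cmp_intros, auto simp: enc_option)

lemma cmp_the [cmp_intros]: "cmp F \<Longrightarrow> cmp (\<lambda>\<Omega> x. the (F \<Omega> x))"
proof (rule cmp_app[of the])
  show "cmp (\<lambda>\<Omega>. the :: 'b option \<Rightarrow> _)"
  proof (rule cmpI[OF impl_if[OF impl_id impl_pred[OF impl_id] impl_const]])
    show "enc (the x) = (if enc x \<noteq> 0 then enc x - 1 else enc (the None :: 'b))" for x :: "'b option"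
      by (cases x) (auto simp: enc_option)
  qed
qed

subsection \<open>Integers and rational numbers\<close>

instantiation int :: enc begin
definition enc_int': "enc (z :: int) = prod_encode (of_bool (z < 0), nat \<bar>z\<bar>)"
instance
proof
  fix x y :: int assume "enc x = enc y"
  then have "(x < 0) = (y < 0)" "nat \<bar>x\<bar> = nat \<bar>y\<bar>"
    by (auto simp: enc_int' of_bool_eq_iff)
  then show "x = y" by linarith
qed
end

instantiation rat :: enc begin
definition enc_rat': "enc (r :: rat) = enc (quotient_of r)"
instance by standard (simp add: enc_rat' quotient_of_inject)
end

lemma cmp_nat_abs [cmp_intros]: "cmp F \<Longrightarrow> cmp (\<lambda>\<Omega> x. nat \<bar>F \<Omega> x\<bar>)"
  by (rule cmp_app[of "\<lambda>z. nat \<bar>z\<bar>"], rule cmpI[OF impl_unpair(2)[OF impl_id]]) (simp add: enc_int')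

lemma cmp_negative [cmp_intros]: "cmp F \<Longrightarrow> cmp (\<lambda>\<Omega> x. F \<Omega> x < (0 :: int))"
  by (rule cmp_app[of "\<lambda>z. z < 0"], rule cmpI[OF impl_unpair(1)[OF impl_id]]) (simp add: enc_int')

lemma cmp_int [cmp_intros]: "cmp F \<Longrightarrow> cmp (\<lambda>\<Omega> x. int (F \<Omega> x))"
  by (rule cmp_same_code[of "\<lambda>\<Omega> x. (False, F \<Omega> x)"]) (intro cmp_intros, auto simp: enc_int')

lemma cmp_minus_int: "cmp F \<Longrightarrow> cmp (\<lambda>\<Omega> x. - int (F \<Omega> x))"
  by (rule cmp_same_code[of "\<lambda>\<Omega> x. (0 < F \<Omega> x, F \<Omega> x)"]) (intro cmp_intros, auto simp: enc_int')

lemma cmp_nat [cmp_intros]: "cmp F \<Longrightarrow> cmp (\<lambda>\<Omega> x. nat (F \<Omega> x))"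
  by (rule cmp_cong[of "\<lambda>\<Omega> x. if F \<Omega> x < 0 then 0 else nat \<bar>F \<Omega> x\<bar>"]) (intro cmp_intros, auto)

lemma cmp_int_diff: "cmp F \<Longrightarrow> cmp G \<Longrightarrow> cmp (\<lambda>\<Omega> x. int (F \<Omega> x) - int (G \<Omega> x))"
  by (rule cmp_cong[of "\<lambda>\<Omega> x. if G \<Omega> x \<le> F \<Omega> x then int (F \<Omega> x - G \<Omega> x) else - int (G \<Omega> x - F \<Omega> x)"])
     (intro cmp_intros cmp_minus_int, auto simp: of_nat_diff)

lemma cmp_uminus_int [cmp_intros]: "cmp F \<Longrightarrow> cmp (\<lambda>\<Omega> x. - F \<Omega> x :: int)"
  by (rule cmp_cong[of "\<lambda>\<Omega> x. if F \<Omega> x < 0 then int (nat \<bar>F \<Omega> x\<bar>) else - int (nat \<bar>F \<Omega> x\<bar>)"])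
     (intro cmp_intros cmp_minus_int, auto)

lemma cmp_add_int [cmp_intros]: "cmp F \<Longrightarrow> cmp G \<Longrightarrow> cmp (\<lambda>\<Omega> x. F \<Omega> x + G \<Omega> x :: int)"
  by (rule cmp_cong[of "\<lambda>\<Omega> x. int (nat (F \<Omega> x) + nat (G \<Omega> x)) - int (nat (- F \<Omega> x) + nat (- G \<Omega> x))"])
     (intro cmp_int_diff cmp_intros, auto)

lemma cmp_mult_int [cmp_intros]: "cmp F \<Longrightarrow> cmp G \<Longrightarrow> cmp (\<lambda>\<Omega> x. F \<Omega> x * G \<Omega> x :: int)"
proof (rule cmp_cong[of "\<lambda>\<Omega> x. int (nat (F \<Omega> x) * nat (G \<Omega> x) + nat (- F \<Omega> x) * nat (- G \<Omega> x)) -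
    int (nat (- F \<Omega> x) * nat (G \<Omega> x) + nat (F \<Omega> x) * nat (- G \<Omega> x))"])
  have "a * b = int (nat a * nat b + nat (- a) * nat (- b)) - int (nat (- a) * nat b + nat a * nat (- b))" for a b
    by (cases "0 \<le> a"; cases "0 \<le> b") auto
  then show "F \<Omega> x * G \<Omega> x = int (nat (F \<Omega> x) * nat (G \<Omega> x) + nat (- F \<Omega> x) * nat (- G \<Omega> x)) -
    int (nat (- F \<Omega> x) * nat (G \<Omega> x) + nat (F \<Omega> x) * nat (- G \<Omega> x))" for \<Omega> x .
qed (intro cmp_int_diff cmp_intros)

lemma cmp_less_int [cmp_intros]: "cmp F \<Longrightarrow> cmp G \<Longrightarrow> cmp (\<lambda>\<Omega> x. F \<Omega> x < (G \<Omega> x :: int))"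
  by (rule cmp_cong[of "\<lambda>\<Omega> x. F \<Omega> x + - G \<Omega> x < 0"]) (intro cmp_intros, auto)

lemma cmp_le_int [cmp_intros]: "cmp F \<Longrightarrow> cmp G \<Longrightarrow> cmp (\<lambda>\<Omega> x. F \<Omega> x \<le> (G \<Omega> x :: int))"
  by (rule cmp_cong[of "\<lambda>\<Omega> x. \<not> G \<Omega> x < F \<Omega> x"]) (intro cmp_intros, auto)

definition numer :: "rat \<Rightarrow> int" where
  "numer r = fst (quotient_of r)"

definition denom :: "rat \<Rightarrow> nat" where
  "denom r = nat (snd (quotient_of r))"

lemma denom_pos [simp]: "denom r > 0"
  using quotient_of_denom_pos' by (simp add: denom_def)

lemma int_denom: "int (denom r) = snd (quotient_of r)"
  using quotient_of_denom_pos'[of r] by (simp add: denom_def)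

lemma numer_denom: "r = of_int (numer r) / of_nat (denom r)"
proof -
  have "r = of_int (numer r) / of_int (snd (quotient_of r))"
    using quotient_of_div[of r] by (simp add: numer_def)
  then show ?thesis by (simp add: int_denom[symmetric])
qed

lemma cmp_numer [cmp_intros]: "cmp F \<Longrightarrow> cmp (\<lambda>\<Omega> x. numer (F \<Omega> x))"
  unfolding numer_def by (intro cmp_intros) (erule cmp_same_code, simp add: enc_rat')

lemma cmp_denom [cmp_intros]: "cmp F \<Longrightarrow> cmp (\<lambda>\<Omega> x. denom (F \<Omega> x))"
  unfolding denom_def by (intro cmp_intros) (erule cmp_same_code, simp add: enc_rat')

text \<open>Normalised fractions in terms of gcd and division of natural numbers, whose
  computability is already known. A zero denominator gives 0, with the fraction (0, 1). The field
  operations on rationals are reduced to this.\<close>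

lemma quotient_of_of_int_divide:
  "quotient_of (of_int a / of_nat n) = (if n = 0 then (0, 1) else
     (if a < 0 then - int (nat \<bar>a\<bar> div gcd (nat \<bar>a\<bar>) n) else int (nat \<bar>a\<bar> div gcd (nat \<bar>a\<bar>) n),
      int (n div gcd (nat \<bar>a\<bar>) n)))"
proof (cases "n = 0")
  case False
  let ?g = "gcd (nat \<bar>a\<bar>) n"
  have g: "gcd a (int n) = int ?g" by (simp only: gcd_int_def abs_of_nat nat_int)
  have "of_int a / of_nat n = Fract a (int n)"
    by (simp only: Fract_of_int_quotient of_int_of_nat_eq)
  moreover have "int n > 0" using False by simp
  ultimately have q: "quotient_of (of_int a / of_nat n) = (a div int ?g, int n div int ?g)"
    by (simp only: quotient_of_Fract normalize_def Let_def fst_conv snd_conv if_True g)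
  have "a div int ?g = (if a < 0 then - int (nat \<bar>a\<bar> div ?g) else int (nat \<bar>a\<bar> div ?g))"
  proof (cases "a < 0")
    case True
    then have "a div int ?g = (- int (nat \<bar>a\<bar>)) div int ?g" by simp
    also have "\<dots> = - (int (nat \<bar>a\<bar>) div int ?g)"
      by (rule dvd_neg_div) (simp only: int_dvd_int_iff gcd_dvd1)
    finally show ?thesis using True by (simp only: zdiv_int if_True)
  next
    case a: False
    then have "a div int ?g = int (nat \<bar>a\<bar>) div int ?g" by simp
    then show ?thesis using a by (simp only: zdiv_int if_False)
  qed
  then show ?thesis using False q by (simp only: zdiv_int if_False)
qed simp

lemma cmp_quotient [cmp_intros]: "cmp F \<Longrightarrow> cmp G \<Longrightarrow> cmp (\<lambda>\<Omega> x. of_int (F \<Omega> x) / of_nat (G \<Omega> x) :: rat)"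
proof (rule cmp_same_code[of "\<lambda>\<Omega> x. quotient_of (of_int (F \<Omega> x) / of_nat (G \<Omega> x))"])
  assume "cmp F" "cmp G"
  then show "cmp (\<lambda>\<Omega> x. quotient_of (of_int (F \<Omega> x) / of_nat (G \<Omega> x)))"
    unfolding quotient_of_of_int_divide by (intro cmp_intros)
qed (simp add: enc_rat')

lemma cmp_of_nat_rat [cmp_intros]: "cmp F \<Longrightarrow> cmp (\<lambda>\<Omega> x. of_nat (F \<Omega> x) :: rat)"
  by (rule cmp_cong[of "\<lambda>\<Omega> x. of_int (int (F \<Omega> x)) / of_nat 1"]) (intro cmp_intros, auto)

lemma cmp_add_rat [cmp_intros]: "cmp F \<Longrightarrow> cmp G \<Longrightarrow> cmp (\<lambda>\<Omega> x. F \<Omega> x + G \<Omega> x :: rat)"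
proof (rule cmp_cong[of "\<lambda>\<Omega> x. of_int (numer (F \<Omega> x) * int (denom (G \<Omega> x)) + numer (G \<Omega> x) * int (denom (F \<Omega> x))) /
    of_nat (denom (F \<Omega> x) * denom (G \<Omega> x))"])
  have "r + s = of_int (numer r * int (denom s) + numer s * int (denom r)) / of_nat (denom r * denom s)" for r s
    by (subst numer_denom[of r], subst numer_denom[of s]) (simp add: add_frac_eq)
  then show "F \<Omega> x + G \<Omega> x = of_int (numer (F \<Omega> x) * int (denom (G \<Omega> x)) + numer (G \<Omega> x) * int (denom (F \<Omega> x))) /
    of_nat (denom (F \<Omega> x) * denom (G \<Omega> x))" for \<Omega> x .
qed (intro cmp_intros)

lemma cmp_mult_rat [cmp_intros]: "cmp F \<Longrightarrow> cmp G \<Longrightarrow> cmp (\<lambda>\<Omega> x. F \<Omega> x * G \<Omega> x :: rat)"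
proof (rule cmp_cong[of "\<lambda>\<Omega> x. of_int (numer (F \<Omega> x) * numer (G \<Omega> x)) / of_nat (denom (F \<Omega> x) * denom (G \<Omega> x))"])
  have "r * s = of_int (numer r * numer s) / of_nat (denom r * denom s)" for r s
    by (subst numer_denom[of r], subst numer_denom[of s]) simp
  then show "F \<Omega> x * G \<Omega> x = of_int (numer (F \<Omega> x) * numer (G \<Omega> x)) / of_nat (denom (F \<Omega> x) * denom (G \<Omega> x))"
    for \<Omega> x .
qed (intro cmp_intros)

lemma cmp_uminus_rat [cmp_intros]: "cmp F \<Longrightarrow> cmp (\<lambda>\<Omega> x. - F \<Omega> x :: rat)"
  by (rule cmp_cong[of "\<lambda>\<Omega> x. of_int (- 1) / of_nat 1 * F \<Omega> x"]) (intro cmp_intros, auto)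

lemma cmp_diff_rat [cmp_intros]: "cmp F \<Longrightarrow> cmp G \<Longrightarrow> cmp (\<lambda>\<Omega> x. F \<Omega> x - G \<Omega> x :: rat)"
  by (simp only: diff_conv_add_uminus) (intro cmp_intros)

lemma cmp_inverse_rat [cmp_intros]: "cmp F \<Longrightarrow> cmp (\<lambda>\<Omega> x. inverse (F \<Omega> x) :: rat)"
proof (rule cmp_cong[of "\<lambda>\<Omega> x. of_int (if numer (F \<Omega> x) < 0 then - int (denom (F \<Omega> x)) else int (denom (F \<Omega> x))) /
    of_nat (nat \<bar>numer (F \<Omega> x)\<bar>)"])
  have "inverse r = of_int (if numer r < 0 then - int (denom r) else int (denom r)) / of_nat (nat \<bar>numer r\<bar>)" for r
    by (subst numer_denom[of r]) (simp add: field_simps)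
  then show "inverse (F \<Omega> x) = of_int (if numer (F \<Omega> x) < 0 then - int (denom (F \<Omega> x)) else int (denom (F \<Omega> x))) /
    of_nat (nat \<bar>numer (F \<Omega> x)\<bar>)" for \<Omega> x .
qed (intro cmp_intros)

lemma cmp_divide_rat [cmp_intros]: "cmp F \<Longrightarrow> cmp G \<Longrightarrow> cmp (\<lambda>\<Omega> x. F \<Omega> x / G \<Omega> x :: rat)"
  by (simp only: divide_inverse) (intro cmp_intros)

lemma cmp_power_rat [cmp_intros]:
  assumes "cmp F" "cmp G" shows "cmp (\<lambda>\<Omega> x. F \<Omega> x ^ (G \<Omega> x) :: rat)"
proof (rule cmp_cong[of "\<lambda>\<Omega> x. ((\<lambda>s. s * F \<Omega> x) ^^ G \<Omega> x) 1"])
  have "((\<lambda>s. s * a) ^^ n) 1 = a ^ n" for a :: rat and n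
    by (induction n) auto
  then show "F \<Omega> x ^ G \<Omega> x = ((\<lambda>s. s * F \<Omega> x) ^^ G \<Omega> x) 1" for \<Omega> x by simp
qed (intro cmp_intros cmp_compose[OF assms(1)] assms)

lemma cmp_le_rat [cmp_intros]: "cmp F \<Longrightarrow> cmp G \<Longrightarrow> cmp (\<lambda>\<Omega> x. F \<Omega> x \<le> (G \<Omega> x :: rat))"
proof (rule cmp_cong[of "\<lambda>\<Omega> x. numer (F \<Omega> x) * int (denom (G \<Omega> x)) \<le> numer (G \<Omega> x) * int (denom (F \<Omega> x))"])
  have "r \<le> s \<longleftrightarrow> numer r * int (denom s) \<le> numer s * int (denom r)" for r s
  proof -
    have "r \<le> s \<longleftrightarrow> (of_int (numer r) :: rat) * of_nat (denom s) \<le> of_int (numer s) * of_nat (denom r)"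
      by (subst numer_denom[of r], subst numer_denom[of s]) (simp add: field_simps)
    also have "\<dots> \<longleftrightarrow> (of_int (numer r * int (denom s)) :: rat) \<le> of_int (numer s * int (denom r))"
      by simp
    finally show ?thesis by (simp only: of_int_le_iff)
  qed
  then show "F \<Omega> x \<le> G \<Omega> x \<longleftrightarrow> numer (F \<Omega> x) * int (denom (G \<Omega> x)) \<le> numer (G \<Omega> x) * int (denom (F \<Omega> x))"
    for \<Omega> x .
qed (intro cmp_intros)

lemma cmp_nat_floor [cmp_intros]: "cmp F \<Longrightarrow> cmp (\<lambda>\<Omega> x. nat \<lfloor>F \<Omega> x :: rat\<rfloor>)"
proof (rule cmp_cong[of "\<lambda>\<Omega> x. nat (numer (F \<Omega> x)) div denom (F \<Omega> x)"])
  have "nat \<lfloor>r\<rfloor> = nat (numer r) div denom r" for r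
  proof -
    have "\<lfloor>r\<rfloor> = numer r div int (denom r)"
      by (subst numer_denom[of r]) (metis floor_divide_of_int_eq of_int_of_nat_eq)
    then show ?thesis
      by (cases "0 \<le> numer r") (auto simp: nat_div_distrib div_nonpos_pos_le0 nat_int)
  qed
  then show "nat \<lfloor>F \<Omega> x\<rfloor> = nat (numer (F \<Omega> x)) div denom (F \<Omega> x)" for \<Omega> x .
qed (intro cmp_intros)


subsection \<open>Words encoding rational points\<close>

lemma cmp_unary [cmp_intros]: "cmp F \<Longrightarrow> cmp (\<lambda>\<Omega> x. unary (F \<Omega> x))"
  unfolding unary_def by (intro cmp_intros)

lemma cmp_enc_nat [cmp_intros]: "cmp F \<Longrightarrow> cmp (\<lambda>\<Omega> x. enc_nat (F \<Omega> x))"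
  unfolding enc_nat_def by (intro cmp_intros)

lemma cmp_enc_rat [cmp_intros]: "cmp F \<Longrightarrow> cmp (\<lambda>\<Omega> x. enc_rat (F \<Omega> x))"
proof (rule cmp_cong[of "\<lambda>\<Omega> x. ((numer (F \<Omega> x) < 0) # enc_nat (nat \<bar>numer (F \<Omega> x)\<bar>)) @ enc_nat (denom (F \<Omega> x))"])
  show "enc_rat (F \<Omega> x) = ((numer (F \<Omega> x) < 0) # enc_nat (nat \<bar>numer (F \<Omega> x)\<bar>)) @ enc_nat (denom (F \<Omega> x))" for \<Omega> x
    by (simp add: enc_rat_def enc_int_def numer_def denom_def split: prod.splits)
qed (intro cmp_intros)

lemma enc_rat_eq: "enc_rat r = (numer r < 0) # enc_nat (nat \<bar>numer r\<bar>) @ enc_nat (denom r)"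
  by (simp add: enc_rat_def enc_int_def numer_def denom_def split: prod.splits)

lemma takeWhile_unary: "takeWhile (\<lambda>b. b) (unary n @ False # w) = unary n"
  by (induction n) (auto simp: unary_def)

lemma length_unary [simp]: "length (unary n) = n"
  by (simp add: unary_def)

definition lead :: "word \<Rightarrow> nat" where
  "lead w = length (takeWhile (\<lambda>b. b) w)"

lemma lead_enc_nat [simp]: "lead (enc_nat n @ w) = n" "lead (enc_nat n) = n"
  using takeWhile_unary[of n w] takeWhile_unary[of n "[]"] by (simp_all add: lead_def enc_nat_def)

lemma drop_enc_nat [simp]: "drop (Suc n) (enc_nat n @ w) = w"
  by (simp add: enc_nat_def unary_def)

lemma cmp_lead [cmp_intros]: "cmp F \<Longrightarrow> cmp (\<lambda>\<Omega> x. lead (F \<Omega> x))"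
  unfolding lead_def by (intro cmp_intros)

text \<open>A sign bit is followed by two self-delimiting unary numbers; the \<open>Suc\<close>
  skips the terminating \<open>False\<close>. Words that are not codes also yield some rational,
  which keeps the functional total.\<close>

definition read_rat :: "word \<Rightarrow> rat" where
  "read_rat w = of_int (if hd w then - int (lead (tl w)) else int (lead (tl w))) /
     of_nat (lead (drop (Suc (lead (tl w))) (tl w)))"

definition skip_rat :: "word \<Rightarrow> word" where
  "skip_rat w = (let u = drop (Suc (lead (tl w))) (tl w) in drop (Suc (lead u)) u)"

lemma read_rat_enc_rat [simp]: "read_rat (enc_rat r @ w) = r" "skip_rat (enc_rat r @ w) = w"
proof -
  have "read_rat (enc_rat r @ w) = of_int (numer r) / of_nat (denom r)"
    by (auto simp: read_rat_def enc_rat_eq simp del: drop_append)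
  then show "read_rat (enc_rat r @ w) = r" by (simp add: numer_denom[symmetric])
  show "skip_rat (enc_rat r @ w) = w" by (simp add: skip_rat_def enc_rat_eq Let_def del: drop_append)
qed

definition enc_rats :: "rat list \<Rightarrow> word" where
  "enc_rats qs = concat (map enc_rat qs)"

definition read_rats :: "nat \<Rightarrow> word \<Rightarrow> rat list" where
  "read_rats k w = rev (fst (((\<lambda>p. (read_rat (snd p) # fst p, skip_rat (snd p))) ^^ k) ([], w)))"

lemma read_rats_enc_rats [simp]: "read_rats (length qs) (enc_rats qs) = qs"
proof -
  have "((\<lambda>p. (read_rat (snd p) # fst p, skip_rat (snd p))) ^^ length qs) (rs, enc_rats qs @ w) = (rev qs @ rs, w)" for rs w
    by (induction qs arbitrary: rs) (auto simp: enc_rats_def funpow_Suc_right simp del: funpow.simps(2))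
  from this[of "[]" "[]"] show ?thesis by (simp add: read_rats_def)
qed

lemma cmp_enc_rats [cmp_intros]: "cmp F \<Longrightarrow> cmp (\<lambda>\<Omega> x. enc_rats (F \<Omega> x))"
  unfolding enc_rats_def by (intro cmp_intros)

lemma cmp_read_rat [cmp_intros]: "cmp F \<Longrightarrow> cmp (\<lambda>\<Omega> x. read_rat (F \<Omega> x))"
  unfolding read_rat_def by (intro cmp_intros)

lemma cmp_skip_rat [cmp_intros]: "cmp F \<Longrightarrow> cmp (\<lambda>\<Omega> x. skip_rat (F \<Omega> x))"
  unfolding skip_rat_def Let_def by (intro cmp_intros)

lemma cmp_read_rats [cmp_intros]: "cmp F \<Longrightarrow> cmp (\<lambda>\<Omega> x. read_rats k (F \<Omega> x))"
  unfolding read_rats_def by (intro cmp_intros)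

text \<open>Points enter the calculus \<open>cmp\<close> as lists, in the order in which
  \<open>enc_point\<close> writes their coordinates.\<close>

definition coords :: "'a ^ 'n::enum \<Rightarrow> 'a list" where
  "coords p = map (\<lambda>i. p $ i) enum_class.enum"

lemma length_coords [simp]: "length (coords (p :: 'a ^ 'n::enum)) = CARD('n)"
  by (simp add: coords_def card_UNIV_length_enum)

lemma enc_point_coords: "enc_point p = enc_rats (coords p)"
  by (simp add: enc_point_def enc_rats_def coords_def comp_def)

lemma coords_exists:
  assumes "length qs = CARD('n)" shows "\<exists>p :: 'a ^ 'n::enum. coords p = qs"
proof
  let ?ix = "\<lambda>i :: 'n. THE k. k < CARD('n) \<and> enum_class.enum ! k = i"
  have "?ix (enum_class.enum ! k) = k" if "k < CARD('n)" for k
    using that by (intro the_equality) (auto simp: card_UNIV_length_enum nth_eq_iff_index_eq[OF enum_distinct])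
  then show "coords (\<chi> i. qs ! ?ix i) = qs"
    using assms by (intro nth_equalityI) (auto simp: coords_def card_UNIV_length_enum)
qed

section \<open>Universal simulation and diagonalisation\<close>

instantiation symbol :: enc begin
fun enc_symbol :: "symbol \<Rightarrow> nat" where
  "enc_symbol Blank = 0"
| "enc_symbol (Bit b) = Suc (of_bool b)"
| "enc_symbol (Aux n) = n + 3"
instance
proof
  show "enc x = enc y \<Longrightarrow> x = y" for x y :: symbol
    by (cases x; cases y) (auto split: if_splits simp: of_bool_eq_iff of_bool_def)
qed
end

instantiation direction :: enc begin
fun enc_direction :: "direction \<Rightarrow> nat" where
  "enc_direction Go_Left = 0"
| "enc_direction Stay = 1"
| "enc_direction Go_Right = 2"
instance
proof
  show "enc x = enc y \<Longrightarrow> x = y" for x y :: direction by (cases x; cases y) auto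
qed
end

fun cells :: "tape \<Rightarrow> symbol list \<times> symbol list" where
  "cells (Tape l r) = (l, r)"

instantiation tape :: enc begin
definition enc_tape: "enc t = enc (cells t)"
instance
proof
  show "enc x = enc y \<Longrightarrow> x = y" for x y :: tape by (cases x; cases y) (simp add: enc_tape)
qed
end

lemma cmp_cells [cmp_intros]: "cmp F \<Longrightarrow> cmp (\<lambda>\<Omega> x. cells (F \<Omega> x))"
  by (erule cmp_same_code) (simp add: enc_tape)

lemma cmp_Tape [cmp_intros]: "cmp F \<Longrightarrow> cmp G \<Longrightarrow> cmp (\<lambda>\<Omega> x. Tape (F \<Omega> x) (G \<Omega> x))"
  by (rule cmp_same_code[of "\<lambda>\<Omega> x. (F \<Omega> x, G \<Omega> x)"]) (intro cmp_intros, auto simp: enc_tape)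

lemma cmp_Bit [cmp_intros]: "cmp F \<Longrightarrow> cmp (\<lambda>\<Omega> x. Bit (F \<Omega> x))"
  by (rule cmp_cong[of "\<lambda>\<Omega> x. if F \<Omega> x then Bit True else Bit False"]) (intro cmp_intros, auto)

lemma cmp_first_symbol [cmp_intros]: "cmp F \<Longrightarrow> cmp (\<lambda>\<Omega> x. first_symbol (F \<Omega> x))"
proof (rule cmp_cong[of "\<lambda>\<Omega> x. if F \<Omega> x = [] then Blank else hd (F \<Omega> x)"])
  have "first_symbol xs = (if xs = [] then Blank else hd xs)" for xs by (cases xs) auto
  then show "first_symbol (F \<Omega> x) = (if F \<Omega> x = [] then Blank else hd (F \<Omega> x))" for \<Omega> x .
qed (intro cmp_intros)

lemma cmp_scanned [cmp_intros]: "cmp F \<Longrightarrow> cmp (\<lambda>\<Omega> x. scanned (F \<Omega> x))"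
proof (rule cmp_cong[of "\<lambda>\<Omega> x. first_symbol (snd (cells (F \<Omega> x)))"])
  show "scanned (F \<Omega> x) = first_symbol (snd (cells (F \<Omega> x)))" for \<Omega> x by (cases "F \<Omega> x") simp
qed (intro cmp_intros)

lemma cmp_write_and_move [cmp_intros]:
  "cmp F \<Longrightarrow> cmp G \<Longrightarrow> cmp (\<lambda>\<Omega> x. write_and_move (F \<Omega> x) (G \<Omega> x))"
proof (rule cmp_cong[of "\<lambda>\<Omega> x. if snd (F \<Omega> x) = Stay
      then Tape (fst (cells (G \<Omega> x))) (fst (F \<Omega> x) # tl (snd (cells (G \<Omega> x))))
      else if snd (F \<Omega> x) = Go_Left
      then Tape (tl (fst (cells (G \<Omega> x)))) (first_symbol (fst (cells (G \<Omega> x))) # fst (F \<Omega> x) # tl (snd (cells (G \<Omega> x))))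
      else Tape (fst (F \<Omega> x) # fst (cells (G \<Omega> x))) (tl (snd (cells (G \<Omega> x))))"])
  have "write_and_move p t = (if snd p = Stay then Tape (fst (cells t)) (fst p # tl (snd (cells t)))
      else if snd p = Go_Left then Tape (tl (fst (cells t))) (first_symbol (fst (cells t)) # fst p # tl (snd (cells t)))
      else Tape (fst p # fst (cells t)) (tl (snd (cells t))))" for p t
    by (cases p; cases t; cases "snd p") auto
  then show "write_and_move (F \<Omega> x) (G \<Omega> x) = (if snd (F \<Omega> x) = Stay
      then Tape (fst (cells (G \<Omega> x))) (fst (F \<Omega> x) # tl (snd (cells (G \<Omega> x))))
      else if snd (F \<Omega> x) = Go_Left
      then Tape (tl (fst (cells (G \<Omega> x)))) (first_symbol (fst (cells (G \<Omega> x))) # fst (F \<Omega> x) # tl (snd (cells (G \<Omega> x))))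
      else Tape (fst (F \<Omega> x) # fst (cells (G \<Omega> x))) (tl (snd (cells (G \<Omega> x)))))" for \<Omega> x .
qed (intro cmp_intros)

lemma cmp_perform [cmp_intros]:
  "cmp F \<Longrightarrow> cmp G \<Longrightarrow> cmp (\<lambda>\<Omega> x. perform (F \<Omega> x) (G \<Omega> x))"
proof (rule cmp_cong[of "\<lambda>\<Omega> x. rev (snd (foldl (\<lambda>p t. if fst p = [] then ([], t # snd p)
    else (tl (fst p), write_and_move (hd (fst p)) t # snd p)) (F \<Omega> x, []) (G \<Omega> x)))"])
  have "rev (snd (foldl (\<lambda>p t. if fst p = [] then ([], t # snd p)
    else (tl (fst p), write_and_move (hd (fst p)) t # snd p)) (as, us) ts)) = rev us @ perform as ts" for as us ts
  proof (induction ts arbitrary: as us)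
    case (Cons t ts)
    show ?case
    proof (cases as)
      case Nil
      have "perform [] ts = ts" by (cases ts) auto
      then show ?thesis using Cons.IH Nil by simp
    qed (use Cons.IH in simp)
  qed (cases as; simp)
  then show "perform (F \<Omega> x) (G \<Omega> x) = rev (snd (foldl (\<lambda>p t. if fst p = [] then ([], t # snd p)
    else (tl (fst p), write_and_move (hd (fst p)) t # snd p)) (F \<Omega> x, []) (G \<Omega> x)))" for \<Omega> x by simp
qed (intro cmp_intros)

lemma cmp_map_of [cmp_intros]: "cmp F \<Longrightarrow> cmp G \<Longrightarrow> cmp (\<lambda>\<Omega> x. map_of (F \<Omega> x) (G \<Omega> x))"
proof (rule cmp_app2[of map_of])
  have "map_of ps k = foldr (\<lambda>e acc. if fst e = k then Some (snd e) else acc) ps None" for ps :: "('b \<times> 'c) list" and k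
    by (induction ps) auto
  then show "cmp (\<lambda>\<Omega> p. map_of (fst p :: ('b \<times> 'c) list) (snd p))"
    by (rule cmp_cong[of "\<lambda>\<Omega> p. foldr (\<lambda>e acc. if fst e = snd p then Some (snd e) else acc) (fst p) None", rotated])
       (intro cmp_intros)
qed

lemma cmp_leading_bits [cmp_intros]: "cmp F \<Longrightarrow> cmp (\<lambda>\<Omega> x. leading_bits (F \<Omega> x))"
proof (rule cmp_cong[of "\<lambda>\<Omega> x. foldr (\<lambda>s acc. if s = Bit True then True # acc
    else if s = Bit False then False # acc else []) (F \<Omega> x) []"])
  have "leading_bits xs = foldr (\<lambda>s acc. if s = Bit True then True # acc
    else if s = Bit False then False # acc else []) xs []" for xs
    by (induction xs rule: leading_bits.induct) auto
  then show "leading_bits (F \<Omega> x) = foldr (\<lambda>s acc. if s = Bit True then True # acc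
    else if s = Bit False then False # acc else []) (F \<Omega> x) []" for \<Omega> x .
qed (intro cmp_intros)

lemma cmp_word_on [cmp_intros]: "cmp F \<Longrightarrow> cmp (\<lambda>\<Omega> x. word_on (F \<Omega> x))"
proof (rule cmp_cong[of "\<lambda>\<Omega> x. leading_bits (snd (cells (F \<Omega> x)))"])
  show "word_on (F \<Omega> x) = leading_bits (snd (cells (F \<Omega> x)))" for \<Omega> x by (cases "F \<Omega> x") simp
qed (intro cmp_intros)

lemma cmp_word_tape [cmp_intros]: "cmp F \<Longrightarrow> cmp (\<lambda>\<Omega> x. word_tape (F \<Omega> x))"
  unfolding word_tape_def by (intro cmp_intros)

lemma cmp_update_1 [cmp_intros]: "cmp F \<Longrightarrow> cmp G \<Longrightarrow> cmp (\<lambda>\<Omega> x. (F \<Omega> x)[1 := G \<Omega> x])"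
proof (rule cmp_cong[of "\<lambda>\<Omega> x. if F \<Omega> x = [] then [] else if tl (F \<Omega> x) = [] then F \<Omega> x
    else hd (F \<Omega> x) # G \<Omega> x # tl (tl (F \<Omega> x))"])
  have "xs[1 := y] = (if xs = [] then [] else if tl xs = [] then xs else hd xs # y # tl (tl xs))" for xs and y :: 'b
    by (cases xs; cases "tl xs") auto
  then show "(F \<Omega> x)[1 := G \<Omega> x] = (if F \<Omega> x = [] then [] else if tl (F \<Omega> x) = [] then F \<Omega> x
    else hd (F \<Omega> x) # G \<Omega> x # tl (tl (F \<Omega> x)))" for \<Omega> x .
qed (intro cmp_intros)

text \<open>
  Raw machines are machines whose symbols and directions are given by numbers. Every number encodes
  a raw machine.
\<close>

type_synonym raw_machine = "nat \<times> ((nat \<times> nat list) \<times> (nat \<times> (nat \<times> nat) list)) list"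

definition symbol_of :: "nat \<Rightarrow> symbol" where
  "symbol_of n = (if n = 0 then Blank else if n \<le> 2 then Bit (n = 2) else Aux (n - 3))"

definition direction_of :: "nat \<Rightarrow> direction" where
  "direction_of n = (if n = 0 then Go_Left else if n = 1 then Stay else Go_Right)"

definition program_of :: "raw_machine \<Rightarrow> ((nat \<times> symbol list) \<times> (nat \<times> (symbol \<times> direction) list)) list" where
  "program_of x = map (\<lambda>e. ((fst (fst e), map symbol_of (snd (fst e))),
     (fst (snd e), map (\<lambda>p. (symbol_of (fst p), direction_of (snd p))) (snd (snd e))))) (snd x)"

definition machine_of :: "raw_machine \<Rightarrow> machine" where
  "machine_of x = \<lparr>work_tapes = fst x, program = program_of x\<rparr>"

lemma enc_symbol_of: "enc (symbol_of n) = n"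
  by (auto simp: symbol_of_def)

lemma symbol_of_enc: "symbol_of (enc a) = a"
  using enc_symbol_of[of "enc a"] by simp

lemma direction_of_enc: "direction_of (enc d) = d"
  by (cases d) (auto simp: direction_of_def)

lemma machine_of_surj: "\<exists>x. machine_of x = M"
proof
  let ?e = "\<lambda>e. ((fst (fst e), map enc (snd (fst e))), (fst (snd e), map (\<lambda>p. (enc (fst p), enc (snd p))) (snd (snd e))))"
  show "machine_of (work_tapes M, map ?e (program M)) = M"
    by (simp add: machine_of_def program_of_def comp_def symbol_of_enc direction_of_enc)
qed

lemma cmp_symbol_of [cmp_intros]: "cmp F \<Longrightarrow> cmp (\<lambda>\<Omega> x. symbol_of (F \<Omega> x))"
  by (erule cmp_same_code) (simp add: enc_symbol_of)

lemma cmp_direction_of [cmp_intros]: "cmp F \<Longrightarrow> cmp (\<lambda>\<Omega> x. direction_of (F \<Omega> x))"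
  unfolding direction_of_def by (intro cmp_intros)

lemma cmp_program_of [cmp_intros]: "cmp F \<Longrightarrow> cmp (\<lambda>\<Omega> x. program_of (F \<Omega> x))"
  unfolding program_of_def by (intro cmp_intros)

text \<open>With a constant oracle every query has the same answer, so the oracle is replaced by
  that word \<open>a\<close>. The step becomes a function of encoded data and can be simulated
  without an oracle.\<close>

definition raw_step :: "raw_machine \<Rightarrow> word \<Rightarrow> config \<Rightarrow> config option" where
  "raw_step x a c = (if fst c = 1 then Some (2, (snd c)[1 := word_tape a])
     else if map_of (program_of x) (fst c, map scanned (snd c)) = None then None
     else Some (fst (the (map_of (program_of x) (fst c, map scanned (snd c)))),
       perform (snd (the (map_of (program_of x) (fst c, map scanned (snd c))))) (snd c)))"

lemma raw_step: "raw_step x a c = step (machine_of x) (\<lambda>_. a) c"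
  by (cases c) (auto simp: raw_step_def step_def machine_of_def split: option.splits)

text \<open>Halted configurations are made fixed points. Iterating k times therefore detects halting
  within k steps, not only after exactly k.\<close>

definition advance :: "raw_machine \<Rightarrow> word \<Rightarrow> config \<Rightarrow> config" where
  "advance x a c = (if raw_step x a c = None then c else the (raw_step x a c))"

definition start :: "raw_machine \<Rightarrow> word \<Rightarrow> config" where
  "start x w = (0, word_tape w # replicate (Suc (fst x)) (word_tape []))"

lemma start: "start x w = initial_config (machine_of x) w"
  by (simp add: start_def initial_config_def machine_of_def)

text \<open>On codes of rationals r this is |r| \<le> 1/16, read off the unary numerator and
  denominator that follow the sign bit.\<close>

definition near_zero :: "word \<Rightarrow> bool" where
  "near_zero w \<longleftrightarrow> 16 * lead (tl w) \<le> lead (drop (Suc (lead (tl w))) (tl w))"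

lemma near_zero_enc_rat: "near_zero (enc_rat r) \<longleftrightarrow> 16 * nat \<bar>numer r\<bar> \<le> denom r"
  by (simp add: near_zero_def enc_rat_eq del: drop_append)

definition accepts :: "nat \<Rightarrow> raw_machine \<Rightarrow> word \<Rightarrow> word \<Rightarrow> bool" where
  "accepts k x a w \<longleftrightarrow> raw_step x a ((advance x a ^^ k) (start x w)) = None \<and>
     near_zero (word_on (hd (snd ((advance x a ^^ k) (start x w)))))"

lemma cmp_raw_step [cmp_intros]:
  "cmp F \<Longrightarrow> cmp G \<Longrightarrow> cmp H \<Longrightarrow> cmp (\<lambda>\<Omega> x. raw_step (F \<Omega> x) (G \<Omega> x) (H \<Omega> x))"
  unfolding raw_step_def by (intro cmp_intros)

lemma cmp_near_zero [cmp_intros]: "cmp F \<Longrightarrow> cmp (\<lambda>\<Omega> x. near_zero (F \<Omega> x))"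
  unfolding near_zero_def by (intro cmp_intros)

lemma cmp_accepts: "cmp (\<lambda>\<Omega> p. accepts (fst p) (fst (snd p)) (snd (snd p)) w)"
  unfolding accepts_def advance_def start_def by (intro cmp_intros)

lemma reachable_advance:
  assumes "(\<lambda>c c'. step (machine_of x) (\<lambda>_. a) c = Some c')\<^sup>*\<^sup>* c d"
  shows "\<exists>k. d = (advance x a ^^ k) c"
  using assms
proof induction
  case (step d d')
  then obtain k where "d = (advance x a ^^ k) c" by blast
  moreover have "advance x a d = d'" using step.hyps(2) by (simp add: advance_def raw_step)
  ultimately have "d' = (advance x a ^^ Suc k) c" by simp
  then show ?case by blast
qed (auto intro: exI[of _ 0])

lemma advance_reachable:
  "(\<lambda>c c'. step (machine_of x) (\<lambda>_. a) c = Some c')\<^sup>*\<^sup>* c ((advance x a ^^ k) c)"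
proof (induction k)
  case (Suc k)
  let ?d = "(advance x a ^^ k) c"
  show ?case
  proof (cases "raw_step x a ?d")
    case (Some d')
    then have "step (machine_of x) (\<lambda>_. a) ?d = Some (advance x a ?d)"
      by (simp add: advance_def raw_step[symmetric])
    then show ?thesis using Suc.IH by (simp add: rtranclp.rtrancl_into_rtrancl)
  next
    case None
    then have "advance x a ?d = ?d" by (simp add: advance_def)
    then show ?thesis using Suc.IH by simp
  qed
qed simp

lemma advance_halted:
  assumes "raw_step x a c = None" shows "(advance x a ^^ k) c = c"
  by (induction k) (use assms in \<open>auto simp: advance_def\<close>)

lemma advance_halted_unique:
  assumes "raw_step x a ((advance x a ^^ k) c) = None" "raw_step x a ((advance x a ^^ l) c) = None"
  shows "(advance x a ^^ k) c = (advance x a ^^ l) c"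
proof -
  have *: "(advance x a ^^ k) c = (advance x a ^^ l) c"
    if "raw_step x a ((advance x a ^^ k) c) = None" "k \<le> l" for k l
  proof -
    have "(advance x a ^^ l) c = (advance x a ^^ (l - k)) ((advance x a ^^ k) c)"
      using that(2) by (metis comp_apply funpow_add le_add_diff_inverse2)
    then show ?thesis using advance_halted[OF that(1)] by simp
  qed
  show ?thesis using *[of k l] *[of l k] assms by (metis nat_le_linear)
qed

lemma outputs_iff:
  "outputs (machine_of x) (\<lambda>_. a) w v \<longleftrightarrow> (\<exists>k. raw_step x a ((advance x a ^^ k) (start x w)) = None \<and>
     v = word_on (snd ((advance x a ^^ k) (start x w)) ! 0))" (is "?L \<longleftrightarrow> ?R")
proof
  assume ?L
  then obtain c where c: "(\<lambda>c c'. step (machine_of x) (\<lambda>_. a) c = Some c')\<^sup>*\<^sup>* (start x w) c"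
    "step (machine_of x) (\<lambda>_. a) c = None" "word_on (snd c ! 0) = v"
    by (auto simp: outputs_def start)
  then show ?R using reachable_advance[OF c(1)] by (auto simp: raw_step)
next
  assume ?R
  then obtain k where k: "raw_step x a ((advance x a ^^ k) (start x w)) = None"
     "v = word_on (snd ((advance x a ^^ k) (start x w)) ! 0)" by blast
  then show ?L unfolding outputs_def start[symmetric] using advance_reachable[of x a "start x w" k]
    by (metis prod.collapse raw_step)
qed

lemma outputs_unique:
  assumes "outputs M (\<lambda>_. a) w v" "outputs M (\<lambda>_. a) w v'" shows "v = v'"
proof -
  obtain x where "machine_of x = M" using machine_of_surj by blast
  then show ?thesis using assms advance_halted_unique by (metis outputs_iff)
qed

lemma perform_eq_Nil: "perform as ts = [] \<longleftrightarrow> ts = []"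
  by (cases as; cases ts) auto

lemma tapes_nonempty: "snd ((advance x a ^^ k) (start x w)) \<noteq> []"
proof (induction k)
  case (Suc k)
  then show ?case by (auto simp: advance_def raw_step_def perform_eq_Nil)
qed (simp add: start_def)

lemma accepts_iff:
  "(\<exists>k. accepts k x a w) \<longleftrightarrow> (\<exists>v. outputs (machine_of x) (\<lambda>_. a) w v \<and> near_zero v)"
  unfolding outputs_iff accepts_def using tapes_nonempty by (metis hd_conv_nth)

section \<open>Numbering of the machines and the diagonal predicate\<close>

lemma surj_enc_nat: "\<exists>x :: nat. enc x = n"
  by (rule exI[of _ n]) simp

lemma surj_enc_prod:
  assumes "\<And>n. \<exists>x :: 'a::enc. enc x = n" "\<And>n. \<exists>y :: 'b::enc. enc y = n"
  shows "\<exists>p :: 'a \<times> 'b. enc p = n"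
proof -
  obtain x :: 'a and y :: 'b where "enc x = fst (prod_decode n)" "enc y = snd (prod_decode n)"
    using assms by blast
  then show ?thesis by (intro exI[of _ "(x, y)"]) simp
qed

lemma surj_enc_list:
  assumes "\<And>n. \<exists>x :: 'a::enc. enc x = n" shows "\<exists>xs :: 'a list. enc xs = n"
proof -
  have "\<exists>xs :: 'a list. map enc xs = ns" for ns
  proof (induction ns)
    case (Cons n ns)
    then obtain x :: 'a and xs :: "'a list" where "enc x = n" "map enc xs = ns" using assms by blast
    then show ?case by (intro exI[of _ "x # xs"]) simp
  qed simp
  then show ?thesis unfolding enc_list by (metis list_decode_inverse)
qed

lemma surj_enc_raw_machine: "\<exists>x :: raw_machine. enc x = n"
  by (intro surj_enc_prod surj_enc_list surj_enc_nat)

text \<open>If every number is a code, then \<open>inv enc\<close> is a right inverse of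
  \<open>enc\<close>, and decoding does nothing on the level of codes.\<close>

lemma cmp_decode:
  fixes F :: "'a::enc \<Rightarrow> 'b::enc"
  assumes "\<And>n. \<exists>x :: 'a. enc x = n" "cmp (\<lambda>\<Omega>. F)" shows "cmp (\<lambda>\<Omega> n. F (inv enc n))"
proof -
  obtain G where G: "impl G" "\<And>\<Omega> x. enc (F x) = G \<Omega> (enc x)" using assms(2) by (auto simp: cmp_def)
  have "enc (inv (enc :: 'a \<Rightarrow> nat) n) = n" for n
    using assms(1)[of n] by (metis f_inv_into_f rangeI)
  then have "enc (F (inv enc n)) = G \<Omega> (enc n)" for \<Omega> n
    using G(2)[of "inv enc n" \<Omega>] by simp
  then show ?thesis by (rule cmpI[OF G(1)])
qed

text \<open>The number e is read as a machine whose queries are all answered by the word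
  \<open>answer e\<close>. Only runs of bounded length are inspected, so \<open>h\<close> is
  computable even if its projection to e is not. A given machine meets itself at the code of its own
  description.\<close>

theorem diagonal:
  fixes answer :: "nat \<Rightarrow> word"
  assumes "cmp (\<lambda>\<Omega>. answer)"
  shows "\<exists>h :: nat \<Rightarrow> nat \<Rightarrow> bool. cmp (\<lambda>\<Omega> p. h (fst p) (snd p)) \<and>
    (\<forall>M. \<exists>e. (\<exists>k. h k e) \<longleftrightarrow> (\<exists>v. outputs M (\<lambda>_. answer e) w v \<and> near_zero v))"
proof -
  let ?F = "\<lambda>e. inv (enc :: raw_machine \<Rightarrow> nat) e"
  let ?h = "\<lambda>k e. accepts k (?F e) (answer e) w"
  have dec: "cmp (\<lambda>\<Omega> n. ?F n)"
    by (rule cmp_decode[OF surj_enc_raw_machine cmp_id])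
  have "cmp (\<lambda>\<Omega> p. ?h (fst p) (snd p))"
  proof -
    have "cmp (\<lambda>\<Omega> p :: nat \<times> nat. (fst p, ?F (snd p), answer (snd p)))"
      by (intro cmp_Pair cmp_fst cmp_id cmp_compose[OF dec] cmp_compose[OF assms] cmp_snd)
    from cmp_compose[OF cmp_accepts this, of w] show ?thesis by simp
  qed
  moreover have "\<exists>e. (\<exists>k. ?h k e) \<longleftrightarrow> (\<exists>v. outputs M (\<lambda>_. answer e) w v \<and> near_zero v)" for M
  proof -
    obtain x where x: "machine_of x = M" using machine_of_surj by blast
    have "?F (enc x) = x" by (rule inv_f_f) (simp add: inj_def)
    then have "(\<exists>k. ?h k (enc x)) \<longleftrightarrow> (\<exists>v. outputs M (\<lambda>_. answer (enc x)) w v \<and> near_zero v)"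
      using accepts_iff[of x "answer (enc x)" w] x by simp
    then show ?thesis by blast
  qed
  ultimately show ?thesis by (intro exI[of _ ?h]) blast
qed

section \<open>Smooth functions\<close>

text \<open>The notion \<open>C_k\<close> for arbitrary normed spaces. The coordinates of the field
  are real-valued functions of seven variables composed with functions of one real variable;
  \<open>C_k_vec\<close> leads back to vector-valued maps.\<close>

primrec Ck :: "nat \<Rightarrow> ('a::real_normed_vector \<Rightarrow> 'b::real_normed_vector) \<Rightarrow> bool" where
  "Ck 0 f \<longleftrightarrow> continuous_on UNIV f"
| "Ck (Suc k) f \<longleftrightarrow>
     (\<forall>x. f differentiable (at x)) \<and> (\<forall>v. Ck k (\<lambda>x. frechet_derivative f (at x) v))"

lemma Ck_SucI:
  assumes "\<And>x. (f has_derivative D x) (at x)" "\<And>v. Ck k (\<lambda>x. D x v)" shows "Ck (Suc k) f"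
proof -
  have "frechet_derivative f (at x) = D x" for x
    using assms(1)[of x] by (metis frechet_derivative_at)
  then show ?thesis using assms by (auto simp: differentiable_def)
qed

lemma Ck_SucD:
  assumes "Ck (Suc k) f"
  shows "(f has_derivative frechet_derivative f (at x)) (at x)" "Ck k (\<lambda>x. frechet_derivative f (at x) v)"
  using assms by (auto simp: frechet_derivative_works[symmetric])

lemma Ck_Suc_imp: "Ck (Suc k) f \<Longrightarrow> Ck k f"
proof (induction k arbitrary: f)
  case 0
  then show ?case
    by (auto intro!: continuous_at_imp_continuous_on differentiable_imp_continuous_within)
next
  case (Suc k)
  then show ?case by (intro Ck_SucI[OF Ck_SucD(1)[OF Suc.prems]] Suc.IH Ck_SucD(2)[OF Suc.prems])
qed

lemma Ck_const: "Ck k (\<lambda>x. c)"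
proof (induction k arbitrary: c)
  case (Suc k)
  show ?case by (rule Ck_SucI[of _ "\<lambda>x v. 0"]) (auto intro: Suc.IH)
qed simp

lemma Ck_bounded_linear: "bounded_linear f \<Longrightarrow> Ck k f"
proof (cases k)
  case 0
  then show "bounded_linear f \<Longrightarrow> ?thesis"
    by (auto simp: linear_continuous_on)
next
  case (Suc k)
  then show "bounded_linear f \<Longrightarrow> ?thesis"
    using Ck_SucI[of f "\<lambda>x. f"] by (auto intro: bounded_linear_imp_has_derivative Ck_const)
qed

lemma Ck_id: "Ck k (\<lambda>x. x)"
  by (rule Ck_bounded_linear) (rule bounded_linear_ident)

lemma Ck_add: "Ck k f \<Longrightarrow> Ck k g \<Longrightarrow> Ck k (\<lambda>x. f x + g x)"
proof (induction k arbitrary: f g)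
  case (Suc k)
  show ?case
    by (rule Ck_SucI[OF has_derivative_add[OF Ck_SucD(1)[OF Suc.prems(1)] Ck_SucD(1)[OF Suc.prems(2)]]])
       (intro Suc.IH Ck_SucD(2)[OF Suc.prems(1)] Ck_SucD(2)[OF Suc.prems(2)])
qed (auto intro: continuous_on_add)

lemma Ck_mult:
  fixes f g :: "'a::real_normed_vector \<Rightarrow> real"
  shows "Ck k f \<Longrightarrow> Ck k g \<Longrightarrow> Ck k (\<lambda>x. f x * g x)"
proof (induction k arbitrary: f g)
  case (Suc k)
  show ?case
    by (rule Ck_SucI[OF has_derivative_mult[OF Ck_SucD(1)[OF Suc.prems(1)] Ck_SucD(1)[OF Suc.prems(2)]]])
       (intro Ck_add Suc.IH Ck_Suc_imp[OF Suc.prems(1)] Ck_Suc_imp[OF Suc.prems(2)] Ck_SucD(2)[OF Suc.prems(1)] Ck_SucD(2)[OF Suc.prems(2)])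
qed (auto intro: continuous_on_mult)

lemma Ck_uminus: "Ck k f \<Longrightarrow> Ck k (\<lambda>x. - f x :: real)"
  using Ck_mult[OF Ck_const[of k "-1"]] by simp

lemma Ck_diff: "Ck k f \<Longrightarrow> Ck k g \<Longrightarrow> Ck k (\<lambda>x. f x - g x :: real)"
  using Ck_add[OF _ Ck_uminus] by simp

lemma Ck_inverse:
  fixes f :: "'a::real_normed_vector \<Rightarrow> real"
  assumes "\<And>x. f x \<noteq> 0" shows "Ck k f \<Longrightarrow> Ck k (\<lambda>x. inverse (f x))"
proof (induction k)
  case 0
  then show ?case using assms by (auto intro: continuous_on_inverse)
next
  case (Suc k)
  have *: "Ck k (\<lambda>x. inverse (f x))" by (rule Suc.IH[OF Ck_Suc_imp[OF Suc.prems]])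
  show ?case
    by (rule Ck_SucI[OF Deriv.has_derivative_inverse[OF assms Ck_SucD(1)[OF Suc.prems]]])
       (intro Ck_uminus Ck_mult * Ck_SucD(2)[OF Suc.prems])
qed

text \<open>For a real outer function the chain rule is a product, since a linear map of the line is
  multiplication by its value at 1. So the induction needs only products and compositions of lower
  order.\<close>

lemma Ck_compose:
  fixes f :: "'a::real_normed_vector \<Rightarrow> real" and g :: "real \<Rightarrow> real"
  shows "Ck k g \<Longrightarrow> Ck k f \<Longrightarrow> Ck k (\<lambda>x. g (f x))"
proof (induction k arbitrary: f g)
  case 0
  then show ?case using continuous_on_compose2[of UNIV g UNIV f] by simp
next
  case (Suc k)
  let ?Dg = "\<lambda>y. frechet_derivative g (at y)" let ?Df = "\<lambda>x. frechet_derivative f (at x)"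
  have "((\<lambda>x. g (f x)) has_derivative (\<lambda>v. ?Df x v * ?Dg (f x) 1)) (at x)" for x
  proof -
    have "((\<lambda>x. g (f x)) has_derivative (\<lambda>v. ?Dg (f x) (?Df x v))) (at x)"
      using has_derivative_compose[OF Ck_SucD(1)[OF Suc.prems(2)] Ck_SucD(1)[OF Suc.prems(1)]] .
    moreover have "?Dg (f x) (?Df x v) = ?Df x v * ?Dg (f x) 1" for v
      using linear_scale[OF has_derivative_linear[OF Ck_SucD(1)[OF Suc.prems(1)]], of "f x" "?Df x v" 1] by simp
    ultimately show ?thesis by simp
  qed
  note D = this
  have 1: "Ck k (\<lambda>x. ?Dg (f x) 1)"
    by (rule Suc.IH[OF Ck_SucD(2)[OF Suc.prems(1)] Ck_Suc_imp[OF Suc.prems(2)]])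
  show ?case
    by (rule Ck_SucI[OF D]) (intro Ck_mult Ck_SucD(2)[OF Suc.prems(2)] 1)
qed

text \<open>This allows the floors in the field to be replaced by constants near each point.\<close>

lemma Ck_local:
  assumes "\<And>x. \<exists>S g. open S \<and> x \<in> S \<and> (\<forall>y\<in>S. f y = g y) \<and> Ck k g" shows "Ck k f"
  using assms
proof (induction k arbitrary: f)
  case 0
  have "isCont f x" for x
  proof -
    obtain S g where S: "open S" "x \<in> S" "\<forall>y\<in>S. f y = g y" "Ck 0 g" using 0 by blast
    have "isCont g x" using S(4) by (simp add: continuous_on_eq_continuous_at)
    moreover have "eventually (\<lambda>y. f y = g y) (nhds x)" using S eventually_nhds by blast
    ultimately show ?thesis using isCont_cong by blast
  qed
  then show ?case by (simp add: continuous_on_eq_continuous_at)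
next
  case (Suc k)
  have loc: "\<exists>S g. open S \<and> x \<in> S \<and> Ck (Suc k) g \<and>
      (\<forall>y\<in>S. (f has_derivative frechet_derivative g (at y)) (at y))" for x
  proof -
    obtain S g where S: "open S" "x \<in> S" "\<forall>y\<in>S. f y = g y" "Ck (Suc k) g" using Suc.prems by blast
    have "(f has_derivative frechet_derivative g (at y)) (at y)" if "y \<in> S" for y
      using has_derivative_transform_within_open[OF Ck_SucD(1)[OF S(4)] S(1) that] S(3) by metis
    then show ?thesis using S by blast
  qed
  show ?case
  proof (rule Ck_SucI)
    show "(f has_derivative frechet_derivative f (at x)) (at x)" for x
      using loc[of x] by (metis frechet_derivative_at)
    show "Ck k (\<lambda>x. frechet_derivative f (at x) v)" for v
    proof (rule Suc.IH)
      fix x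
      obtain S g where S: "open S" "x \<in> S" "Ck (Suc k) g"
        "\<forall>y\<in>S. (f has_derivative frechet_derivative g (at y)) (at y)" using loc by blast
      have "frechet_derivative f (at y) v = frechet_derivative g (at y) v" if "y \<in> S" for y
        by (simp only: frechet_derivative_at[OF S(4)[rule_format, OF that], symmetric])
      then show "\<exists>S g. open S \<and> x \<in> S \<and> (\<forall>y\<in>S. frechet_derivative f (at y) v = g y) \<and> Ck k g"
        by (intro exI[of _ S] exI[of _ "\<lambda>y. frechet_derivative g (at y) v"] conjI ballI S(1,2) Ck_SucD(2)[OF S(3)])
    qed
  qed
qed

lemma C_k_vec:
  fixes f :: "real ^ 'n \<Rightarrow> real ^ 'm"
  assumes "\<And>i. Ck k (\<lambda>x. f x $ i)" shows "C_k k f"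
  using assms
proof (induction k arbitrary: f)
  case 0
  have "continuous_on UNIV (\<lambda>x. \<chi> i. f x $ i)"
    using 0 by (intro continuous_on_vec_lambda) simp
  then show ?case by simp
next
  case (Suc k)
  let ?D = "\<lambda>x v. \<chi> i. frechet_derivative (\<lambda>x. f x $ i) (at x) v"
  have D: "(f has_derivative ?D x) (at x)" for x
    unfolding has_derivative_componentwise_within[of f]
  proof
    fix b :: "real ^ 'm" assume "b \<in> Basis"
    then obtain i where b: "b = axis i 1" by (auto simp: Basis_vec_def)
    show "((\<lambda>x. f x \<bullet> b) has_derivative (\<lambda>v. ?D x v \<bullet> b)) (at x)"
      using Ck_SucD(1)[OF Suc.prems, of i x] by (simp add: b inner_axis)
  qed
  have "frechet_derivative f (at x) = ?D x" for x
    by (rule frechet_derivative_at[OF D, symmetric])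
  moreover have "C_k k (\<lambda>x. ?D x v)" for v
    by (rule Suc.IH) (simp add: Ck_SucD(2)[OF Suc.prems])
  ultimately show ?case using D by (auto simp: differentiable_def)
qed

lemma C_infinity_vec:
  fixes f :: "real ^ 'n \<Rightarrow> real ^ 'm"
  assumes "\<And>k i. Ck k (\<lambda>x. f x $ i)" shows "C_infinity f"
  unfolding C_infinity_def using C_k_vec[of _ f] assms by blast

subsection \<open>A smooth step\<close>

text \<open>The polynomial makes the class closed under differentiation: the derivative is of the
  same form, with X^2 (p - p') in place of p. Smoothness then follows by one induction for all p.
  The case p = 1 is the usual flat function exp (- 1/x).\<close>

definition poly_flat :: "real poly \<Rightarrow> real \<Rightarrow> real" where
  "poly_flat p x = (if x > 0 then poly p (inverse x) * exp (- inverse x) else 0)"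

lemma poly_exp_tendsto_0: "((\<lambda>y :: real. poly p y * exp (- y)) \<longlongrightarrow> 0) at_top"
proof -
  have "((\<lambda>y. \<Sum>i\<le>degree p. coeff p i * (y ^ i / exp y)) \<longlongrightarrow> (\<Sum>i\<le>degree p. coeff p i * 0)) at_top"
    by (intro tendsto_sum tendsto_mult tendsto_const tendsto_power_div_exp_0)
  moreover have "(\<Sum>i\<le>degree p. coeff p i * (y ^ i / exp y)) = poly p y * exp (- y)" for y
    by (simp add: poly_altdef sum_distrib_right exp_minus divide_inverse mult.assoc)
  ultimately show ?thesis by simp
qed

lemma poly_flat_deriv:
  "(poly_flat p has_real_derivative poly_flat ([:0, 0, 1:] * (p - pderiv p)) x) (at x)"
proof -
  consider "x > 0" | "x < 0" | "x = 0" by linarith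
  then show ?thesis
  proof cases
    case 1
    have "((\<lambda>x. poly p (inverse x) * exp (- inverse x)) has_real_derivative
        poly_flat ([:0, 0, 1:] * (p - pderiv p)) x) (at x)"
      using 1 by (auto intro!: derivative_eq_intros DERIV_chain2[OF poly_DERIV]
          simp: poly_flat_def power2_eq_square field_simps)
    then show ?thesis
      by (rule DERIV_cong_ev[THEN iffD1, OF refl _ refl, rotated])
         (use 1 in \<open>auto simp: poly_flat_def intro!: eventually_nhds_in_open[of "{0<..}", THEN eventually_mono]\<close>)
  next
    case 2
    have "((\<lambda>x. 0) has_real_derivative poly_flat ([:0, 0, 1:] * (p - pderiv p)) x) (at x)"
      using 2 by (simp add: poly_flat_def)
    then show ?thesis
      by (rule DERIV_cong_ev[THEN iffD1, OF refl _ refl, rotated])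
         (use 2 in \<open>auto simp: poly_flat_def intro!: eventually_nhds_in_open[of "{..<0}", THEN eventually_mono]\<close>)
  next
    case 3
    \<comment> \<open>From the right, the difference quotient at 0 is the flat function of the
      polynomial X p, a polynomial in 1/h times exp (- 1/h).\<close>
    have "((\<lambda>h. poly ([:0, 1:] * p) (inverse h) * exp (- inverse h)) \<longlongrightarrow> 0) (at_right 0)"
      by (rule filterlim_compose[OF poly_exp_tendsto_0 filterlim_inverse_at_top_right])
    moreover have "eventually (\<lambda>h. poly ([:0, 1:] * p) (inverse h) * exp (- inverse h) = poly_flat p h / h) (at_right 0)"
      by (auto simp: eventually_at_right_field poly_flat_def divide_inverse mult.commute mult.left_commute intro!: exI[of _ 1])
    ultimately have r: "((\<lambda>h. poly_flat p h / h) \<longlongrightarrow> 0) (at_right 0)"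
      by (rule Lim_transform_eventually)
    have "eventually (\<lambda>h. 0 = poly_flat p h / h) (at_left 0)"
      by (auto simp: eventually_at_left_field poly_flat_def intro!: exI[of _ "-1"])
    with tendsto_const have l: "((\<lambda>h. poly_flat p h / h) \<longlongrightarrow> 0) (at_left 0)"
      by (rule Lim_transform_eventually)
    have "((\<lambda>h. poly_flat p h / h) \<longlongrightarrow> 0) (at 0)" by (rule filterlim_split_at[OF l r])
    then show ?thesis using 3 by (simp add: DERIV_def poly_flat_def)
  qed
qed

lemma Ck_poly_flat: "Ck k (poly_flat p)"
proof (induction k arbitrary: p)
  case 0
  show ?case using poly_flat_deriv[of p] by (auto intro!: continuous_at_imp_continuous_on DERIV_isCont)
next
  case (Suc k)
  show ?case
    by (rule Ck_SucI[OF poly_flat_deriv[unfolded has_field_derivative_def]]) (intro Ck_mult Ck_const Suc.IH)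
qed

definition sstep :: "real \<Rightarrow> real" where
  "sstep x = poly_flat 1 x * inverse (poly_flat 1 x + poly_flat 1 (1 - x))"

lemma sstep_denom_pos: "poly_flat 1 x + poly_flat 1 (1 - x) > 0"
  by (cases "x > 0") (auto simp: poly_flat_def add_pos_nonneg)

lemma Ck_sstep: "Ck k sstep"
proof -
  have "Ck k (\<lambda>x. poly_flat 1 x * inverse (poly_flat 1 x + poly_flat 1 (1 - x)))"
    using sstep_denom_pos
    by (intro Ck_mult Ck_inverse Ck_add Ck_poly_flat Ck_compose[OF Ck_poly_flat] Ck_diff Ck_const Ck_id)
       (metis less_irrefl)
  moreover have "sstep = (\<lambda>x. poly_flat 1 x * inverse (poly_flat 1 x + poly_flat 1 (1 - x)))"
    by (rule ext) (rule sstep_def)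
  ultimately show ?thesis by simp
qed

lemma sstep_0: "x \<le> 0 \<Longrightarrow> sstep x = 0"
  by (simp add: sstep_def poly_flat_def)

lemma sstep_1: "x \<ge> 1 \<Longrightarrow> sstep x = 1"
  by (simp add: sstep_def poly_flat_def)

lemma sstep_bounds: "0 \<le> sstep x" "sstep x \<le> 1"
proof -
  have "poly_flat 1 x \<ge> 0" "poly_flat 1 (1 - x) \<ge> 0" by (auto simp: poly_flat_def)
  then show "0 \<le> sstep x" "sstep x \<le> 1"
    using sstep_denom_pos[of x] by (auto simp: sstep_def field_simps)
qed

text \<open>The logistic form contains a single exponential, whose argument is rational for rational
  x. This is the formula that gets approximated.\<close>

lemma sstep_eq:
  assumes "0 < x" "x < 1" shows "sstep x = 1 / (1 + exp (1 / x - 1 / (1 - x)))"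
proof -
  have "exp (1 / x - 1 / (1 - x)) = exp (- inverse (1 - x)) / exp (- inverse x)"
  proof -
    have "1 / x - 1 / (1 - x) = - inverse (1 - x) - - inverse x" by (simp add: divide_inverse)
    then show ?thesis by (simp only: exp_diff)
  qed
  moreover have "a * inverse (a + b) = 1 / (1 + b / a)" if "a > 0" "b > 0" for a b :: real
    using that by (simp add: field_simps)
  ultimately show ?thesis using assms by (simp add: sstep_def poly_flat_def)
qed

lemma sstep_Lipschitz: "\<exists>B\<ge>1. \<forall>x y. \<bar>sstep x - sstep y\<bar> \<le> B * \<bar>x - y\<bar>"
proof -
  let ?D = "\<lambda>x. frechet_derivative sstep (at x) 1"
  have d: "(sstep has_real_derivative ?D x) (at x)" for x
  proof -
    have D: "(sstep has_derivative frechet_derivative sstep (at x)) (at x)" by (rule Ck_SucD(1)[OF Ck_sstep])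
    moreover have "frechet_derivative sstep (at x) v = ?D x * v" for v
      using linear_scale[OF has_derivative_linear[OF D], of v 1] by simp
    then have "frechet_derivative sstep (at x) = (*) (?D x)" by (rule ext)
    ultimately show ?thesis by (simp add: has_field_derivative_def)
  qed
  have "continuous_on {0..1} ?D"
    using Ck_SucD(2)[of 0, OF Ck_sstep] by (auto intro: continuous_on_subset)
  then have "bounded (?D ` {0..1})" by (intro compact_imp_bounded compact_continuous_image) auto
  then obtain B where B: "B > 0" "\<And>x. x \<in> {0..1} \<Longrightarrow> \<bar>?D x\<bar> \<le> B" by (auto simp: bounded_pos)
  \<comment> \<open>The step is constant outside [0, 1], so it factors through the clamp to this
    interval, where its derivative is bounded by compactness.\<close>
  let ?c = "\<lambda>x :: real. max 0 (min 1 x)"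
  have clamp: "sstep x = sstep (?c x)" for x
    using sstep_0[of x] sstep_0[of 0] sstep_1[of x] sstep_1[of 1] by (auto simp: max_def min_def)
  have "\<bar>sstep x - sstep y\<bar> \<le> (B + 1) * \<bar>x - y\<bar>" for x y
  proof -
    have "norm (sstep (?c x) - sstep (?c y)) \<le> B * norm (?c x - ?c y)"
      using B(2) by (intro field_differentiable_bound[of "{0..1}" _ ?D]) (auto intro: has_field_derivative_at_within d)
    also have "\<dots> \<le> (B + 1) * \<bar>x - y\<bar>" using B(1) by (intro mult_mono) auto
    finally show ?thesis using clamp[of x] clamp[of y] by simp
  qed
  then show ?thesis using B(1) by (intro exI[of _ "B + 1"]) auto
qed

section \<open>Ordinary differential equations\<close>

subsection \<open>Global existence for Lipschitz fields\<close>

text \<open>Integration divides growth of order exp (c s) by c. With A = L times a distance this is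
  the contraction estimate, with A = norm (g 0) it bounds the Picard image of 0.\<close>

lemma weighted_integral_bound:
  fixes F :: "real \<Rightarrow> 'a::euclidean_space"
  assumes "continuous_on {0..} F" "\<And>s. s \<ge> 0 \<Longrightarrow> norm (F s) \<le> A * exp (c * s)" "c > 0" "A \<ge> 0" "t \<ge> 0"
  shows "norm (exp (- c * t) *\<^sub>R integral {0..t} F) \<le> A / c"
proof -
  have cont: "continuous_on {0..t} F" using assms(1) by (rule continuous_on_subset) auto
  have I: "((\<lambda>s. A * exp (c * s)) has_integral (A / c * exp (c * t) - A / c * exp (c * 0))) {0..t}"
    using assms by (intro fundamental_theorem_of_calculus)
      (auto intro!: derivative_eq_intros simp flip: has_real_derivative_iff_has_vector_derivative)
  have "norm (integral {0..t} F) \<le> integral {0..t} (\<lambda>s. A * exp (c * s))"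
    using assms cont I by (intro integral_norm_bound_integral) (auto intro: integrable_continuous_real has_integral_integrable)
  also have "\<dots> \<le> A / c * exp (c * t)" using integral_unique[OF I] assms by simp
  finally have "exp (- c * t) * norm (integral {0..t} F) \<le> exp (- c * t) * (A / c * exp (c * t))"
    by (intro mult_left_mono) auto
  also have "\<dots> = A / c * (exp (- c * t) * exp (c * t))" by (simp only: mult_ac)
  also have "\<dots> = A / c" by (simp add: exp_minus)
  finally show ?thesis by simp
qed

lemma integral_derivative:
  fixes F :: "real \<Rightarrow> 'a::euclidean_space"
  assumes "continuous_on {0..} F" "t \<ge> 0"
  shows "((\<lambda>t. integral {0..t} F) has_vector_derivative F t) (at t within {0..})"
proof -
  have "((\<lambda>t. integral {0..t} F) has_vector_derivative F t) (at t within {0..t + 1})"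
    using assms by (intro integral_has_vector_derivative continuous_on_subset[OF assms(1)]) auto
  moreover have "at t within {0..t + 1} = at t within {0..}"
    by (rule at_within_nhd[of _ "{..<t + 1}"]) auto
  ultimately show ?thesis by simp
qed

text \<open>
  The Picard operator is a contraction for the norm weighted by exp (- c t), c = 2 L + 1: on the
  rescaled functions y (t) = exp (- c t) x (t) it acts on bounded continuous functions.
\<close>

theorem Lipschitz_solution_exists:
  fixes g :: "real ^ 'n \<Rightarrow> real ^ 'n"
  assumes L: "\<And>x y. norm (g x - g y) \<le> L * norm (x - y)"
  shows "\<exists>x. is_forward_solution g x0 x"
proof -
  have "L \<ge> 0"
  proof -
    have "0 \<le> L * norm (axis undefined 1 - 0 :: real ^ 'n)"
      using L[of "axis undefined 1" 0] norm_ge_zero order_trans by blast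
    then show ?thesis by (simp add: zero_le_mult_iff)
  qed
  define c where "c = 2 * L + 1"
  have c: "c > 0" "2 * L \<le> c" using \<open>L \<ge> 0\<close> by (auto simp: c_def)
  have contg: "continuous_on UNIV g"
    by (rule lipschitz_on_continuous_on[OF lipschitz_onI]) (use L \<open>L \<ge> 0\<close> in \<open>auto simp: dist_norm\<close>)
  define F where "F = (\<lambda>(y :: real \<Rightarrow>\<^sub>C (real ^ 'n)) s. g (exp (c * s) *\<^sub>R y s))"
  \<comment> \<open>Bounded continuous functions are defined on the whole line, so for negative
    times the image is frozen at its value at 0.\<close>
  define T where "T = (\<lambda>(y :: real \<Rightarrow>\<^sub>C (real ^ 'n)) t. exp (- c * max 0 t) *\<^sub>R (x0 + integral {0..max 0 t} (F y)))"
  have contF: "continuous_on S (F y)" for S y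
    unfolding F_def by (intro continuous_on_compose2[OF contg] continuous_intros) auto
  have dF: "norm (F y s - F z s) \<le> L * dist y z * exp (c * s)" for y z s
  proof -
    have "norm (F y s - F z s) \<le> L * norm (exp (c * s) *\<^sub>R y s - exp (c * s) *\<^sub>R z s)"
      unfolding F_def by (rule L)
    also have "\<dots> = L * (exp (c * s) * dist (y s) (z s))"
      by (simp add: dist_norm flip: scaleR_diff_right)
    also have "\<dots> \<le> L * (exp (c * s) * dist y z)"
      using \<open>L \<ge> 0\<close> dist_bounded[of y s z] by (intro mult_left_mono) auto
    finally show ?thesis by (simp add: mult_ac)
  qed
  have dT: "dist (T y t) (T z t) \<le> 1 / 2 * dist y z" for y z t
  proof -
    let ?t = "max 0 t"
    have "T y t - T z t = exp (- c * ?t) *\<^sub>R integral {0..?t} (\<lambda>s. F y s - F z s)"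
      unfolding T_def by (subst Henstock_Kurzweil_Integration.integral_diff)
        (auto intro: integrable_continuous_real contF simp flip: scaleR_diff_right)
    also have "norm \<dots> \<le> L * dist y z / c"
      by (intro weighted_integral_bound continuous_on_diff contF dF) (use c \<open>L \<ge> 0\<close> in auto)
    also have "\<dots> \<le> 1 / 2 * dist y z"
      using c mult_right_mono[OF c(2), of "dist y z"] by (simp add: field_simps)
    finally show ?thesis by (simp add: dist_norm)
  qed
  have T: "T y \<in> bcontfun" for y
  proof (unfold bcontfun_def, intro CollectI conjI)
    have "continuous_on {0..} (\<lambda>t. integral {0..t} (F y))"
      unfolding continuous_on_eq_continuous_within
      using integral_derivative[OF contF] by (auto intro: has_vector_derivative_continuous)
    then have "continuous_on UNIV (\<lambda>t. integral {0..max 0 t} (F y))"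
      by (rule continuous_on_compose2) (auto intro!: continuous_intros)
    then show "continuous_on UNIV (T y)" unfolding T_def by (intro continuous_intros)
    have F0: "norm (F 0 s) \<le> norm (g 0) * exp (c * s)" if "s \<ge> 0" for s
      using that c by (simp add: F_def mult_le_cancel_left1)
    have T0: "norm (T 0 t) \<le> norm x0 + norm (g 0) / c" for t
    proof -
      let ?t = "max 0 t"
      have "norm (T 0 t) \<le> norm (exp (- c * ?t) *\<^sub>R x0) + norm (exp (- c * ?t) *\<^sub>R integral {0..?t} (F 0))"
        unfolding T_def scaleR_add_right by (rule norm_triangle_ineq)
      also have "norm (exp (- c * ?t) *\<^sub>R x0) \<le> norm x0"
        using c by (simp add: mult_left_le_one_le)
      also have "norm (exp (- c * ?t) *\<^sub>R integral {0..?t} (F 0)) \<le> norm (g 0) / c"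
        by (intro weighted_integral_bound contF F0) (use c in auto)
      finally show ?thesis by simp
    qed
    \<comment> \<open>Boundedness passes from the image of 0 to every image, since \<open>T\<close>
      at most halves distances.\<close>
    have "norm (T y t) \<le> norm x0 + norm (g 0) / c + 1 / 2 * dist y 0" for t
      using dT[of y t 0] norm_triangle_ineq2[of "T y t" "T 0 t"] T0[of t]
      unfolding dist_norm[of "T y t"] by linarith
    then show "bounded (range (T y))" by (auto simp: bounded_iff)
  qed
  have "\<exists>!y. Bcontfun (T y) = y"
  proof (rule banach_fix_type)
    show "\<forall>y z. dist (Bcontfun (T y)) (Bcontfun (T z)) \<le> 1 / 2 * dist y z"
      by (intro allI dist_bound) (simp only: Bcontfun_inverse[OF T] dT)
  qed auto
  then obtain y where "Bcontfun (T y) = y" by blast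
  then have y: "y t = T y t" for t using Bcontfun_inverse[OF T[of y]] by (metis)
  define x where "x = (\<lambda>t. exp (c * t) *\<^sub>R y t)"
  have x: "x t = x0 + integral {0..t} (\<lambda>s. g (x s))" if "t \<ge> 0" for t
  proof -
    have "x t = exp (c * t) *\<^sub>R T y t" unfolding x_def using y by simp
    also have "\<dots> = x0 + integral {0..t} (F y)"
      using that by (simp add: T_def exp_minus)
    finally show ?thesis by (simp add: F_def x_def)
  qed
  have "(x has_vector_derivative g (x t)) (at t within {0..})" if "t \<ge> 0" for t
  proof -
    have "continuous_on {0..} (\<lambda>s. g (x s))"
      using contF[of "{0..}" y] by (simp add: F_def x_def)
    from integral_derivative[OF this that]
    have "((\<lambda>u. x0 + integral {0..u} (\<lambda>s. g (x s))) has_vector_derivative g (x t)) (at t within {0..})"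
      by (auto intro!: derivative_eq_intros)
    then show ?thesis
      by (rule has_vector_derivative_transform[rotated 2]) (use that x in auto)
  qed
  moreover have "x 0 = x0" using x[of 0] by simp
  ultimately show ?thesis unfolding is_forward_solution_def by blast
qed

subsection \<open>Trapping\<close>

lemma derivative_bounds:
  fixes u :: "real \<Rightarrow> real"
  assumes "\<And>t. t \<ge> 0 \<Longrightarrow> (u has_real_derivative u' t) (at t within {0..})" "0 \<le> a" "a \<le> b"
  shows "(\<And>t. a \<le> t \<Longrightarrow> t \<le> b \<Longrightarrow> l \<le> u' t) \<Longrightarrow> l * (b - a) \<le> u b - u a"
    and "(\<And>t. a \<le> t \<Longrightarrow> t \<le> b \<Longrightarrow> u' t \<le> r) \<Longrightarrow> u b - u a \<le> r * (b - a)"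
proof -
  have "(u has_derivative (*) (u' t)) (at t within {a..b})" if "a \<le> t" "t \<le> b" for t
  proof -
    have "(u has_real_derivative u' t) (at t within {a..b})"
      using that assms(2) by (intro DERIV_subset[OF assms(1)]) auto
    then show ?thesis by (simp add: has_field_derivative_def)
  qed
  then have "\<exists>t\<in>{a..b}. u b - u a = u' t * (b - a)"
    by (rule mvt_very_simple[OF assms(3)])
  then obtain t where t: "t \<in> {a..b}" "u b - u a = u' t * (b - a)" by blast
  show "l * (b - a) \<le> u b - u a" if "\<And>t. a \<le> t \<Longrightarrow> t \<le> b \<Longrightarrow> l \<le> u' t"
    using t that assms(3) by (auto intro: mult_right_mono)
  show "u b - u a \<le> r * (b - a)" if "\<And>t. a \<le> t \<Longrightarrow> t \<le> b \<Longrightarrow> u' t \<le> r"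
    using t that assms(3) by (auto intro: mult_right_mono)
qed

text \<open>At the first time when some quantity reaches its bound, all bounds still hold as
  non-strict inequalities, so \<open>inward\<close> applies to the touching quantity; a negative
  derivative means that it was larger just before. Treating several quantities together matters,
  since each wall repels only while the other bounds hold.\<close>

lemma no_exit:
  fixes u :: "'i \<Rightarrow> real \<Rightarrow> real"
  assumes der: "\<And>i t. i \<in> I \<Longrightarrow> t \<ge> 0 \<Longrightarrow> (u i has_real_derivative u' i t) (at t within {0..})"
    and "finite I" "0 \<le> \<tau>" and init: "\<And>i. i \<in> I \<Longrightarrow> u i \<tau> < a i"
    and inward: "\<And>j t. t \<ge> \<tau> \<Longrightarrow> (\<And>i. i \<in> I \<Longrightarrow> u i t \<le> a i) \<Longrightarrow> j \<in> I \<Longrightarrow> u j t = a j \<Longrightarrow> u' j t < 0"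
    and "i \<in> I" "t \<ge> \<tau>"
  shows "u i t < a i"
proof (rule ccontr)
  assume "\<not> u i t < a i"
  define B where "B = (\<Union>i\<in>I. {\<tau>..} \<inter> u i -` {a i..})"
  have cont: "continuous_on {\<tau>..} (u i)" if "i \<in> I" for i
    using der[OF that] \<open>0 \<le> \<tau>\<close> by (intro continuous_on_subset[OF DERIV_continuous_on[of "{0..}"]]) auto
  have "closed B" unfolding B_def
    using cont \<open>finite I\<close> by (intro closed_UN ballI continuous_closed_preimage) auto
  moreover have "t \<in> B" using \<open>\<not> u i t < a i\<close> assms(6,7) by (auto simp: B_def intro!: bexI[of _ i])
  moreover have bdd: "bdd_below B" by (auto simp: B_def intro!: bdd_belowI[of _ \<tau>])
  ultimately have "Inf B \<in> B" by (intro closed_contains_Inf) auto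
  define T where "T = Inf B"
  obtain j where j: "j \<in> I" "T \<ge> \<tau>" "u j T \<ge> a j" using \<open>Inf B \<in> B\<close> by (auto simp: B_def T_def)
  have "T \<noteq> \<tau>" using init[OF j(1)] j by auto
  then have "T > \<tau>" using j by simp
  have before: "u i s < a i" if "\<tau> \<le> s" "s < T" "i \<in> I" for i s
    using that cInf_lower[OF _ bdd, of s] by (force simp: B_def T_def)
  have le: "u i T \<le> a i" if "i \<in> I" for i
  proof (rule tendsto_upperbound)
    have "(u i \<longlongrightarrow> u i T) (at T within {\<tau>..})"
      using cont[OF that] \<open>T > \<tau>\<close> by (auto simp: continuous_on)
    then show "(u i \<longlongrightarrow> u i T) (at T within {\<tau>..<T})" by (rule tendsto_within_subset) auto
    show "eventually (\<lambda>s. u i s \<le> a i) (at T within {\<tau>..<T})"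
      using before that by (auto simp: eventually_at_filter less_imp_le)
    show "at T within {\<tau>..<T} \<noteq> bot"
    proof -
      have "at T within {\<tau>..<T} = at_left T"
        by (rule at_within_nhd[of _ "{\<tau><..}"]) (use \<open>T > \<tau>\<close> in auto)
      then show ?thesis using trivial_limit_at_left_real by simp
    qed
  qed
  have "u j T = a j" using le[OF j(1)] j(3) by simp
  then have "u' j T < 0" using inward[OF j(2) le j(1)] by simp
  then obtain d where d: "d > 0" "\<And>h. h > 0 \<Longrightarrow> T - h \<in> {0..} \<Longrightarrow> h < d \<Longrightarrow> u j T < u j (T - h)"
    using has_real_derivative_neg_dec_left[OF der[OF j(1), of T]] j \<open>0 \<le> \<tau>\<close> by force
  define h where "h = min (d / 2) (T - \<tau>)"
  have "u j T < u j (T - h)" using d \<open>T > \<tau>\<close> \<open>0 \<le> \<tau>\<close> by (intro d(2)) (auto simp: h_def min_def)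
  moreover have "u j (T - h) < a j" using d(1) \<open>T > \<tau>\<close> j by (intro before) (auto simp: h_def min_def)
  ultimately show False using \<open>u j T = a j\<close> by simp
qed

text \<open>The definite rate of decrease brings \<open>u\<close> below \<open>a\<close> in finite
  time, and \<open>no_exit\<close> with a single wall keeps it there.\<close>

lemma eventually_below:
  fixes u :: "real \<Rightarrow> real"
  assumes der: "\<And>t. t \<ge> 0 \<Longrightarrow> (u has_real_derivative u' t) (at t within {0..})"
    and "0 \<le> \<tau>" "c > 0" and dec: "\<And>t. t \<ge> \<tau> \<Longrightarrow> u t \<ge> a \<Longrightarrow> u' t \<le> - c"
  shows "\<exists>\<tau>'\<ge>\<tau>. \<forall>t\<ge>\<tau>'. u t < a"
proof -
  have "\<exists>t\<ge>\<tau>. u t < a"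
  proof (rule ccontr)
    assume "\<not> ?thesis"
    then have ge: "u t \<ge> a" if "t \<ge> \<tau>" for t using that by force
    \<comment> \<open>By this time a decrease at rate \<open>c\<close> would have brought
      \<open>u\<close> down to a - 1.\<close>
    define t where "t = \<tau> + (u \<tau> - a + 1) / c"
    have "t \<ge> \<tau>" using ge[of \<tau>] \<open>c > 0\<close> by (simp add: t_def)
    have "u t - u \<tau> \<le> - c * (t - \<tau>)"
      by (rule derivative_bounds(2)[OF der \<open>0 \<le> \<tau>\<close> \<open>t \<ge> \<tau>\<close>]) (auto intro: dec ge)
    also have "\<dots> = - (u \<tau> - a + 1)" using \<open>c > 0\<close> by (simp add: t_def)
    finally show False using ge[OF \<open>t \<ge> \<tau>\<close>] by simp
  qed
  then obtain s where s: "s \<ge> \<tau>" "u s < a" by blast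
  have neg: "u' t < 0" if "t \<ge> s" "u t = a" for t
    using dec[of t] that s(1) \<open>c > 0\<close> by simp
  have "u t < a" if "t \<ge> s" for t
    by (rule no_exit[of "{()}" "\<lambda>_. u" "\<lambda>_. u'" s "\<lambda>_. a" "()" t]) (use der neg s that \<open>0 \<le> \<tau>\<close> in auto)
  then show ?thesis using s(1) by blast
qed

text \<open>The squared distance V to s satisfies V' \<le> - V, so exp t V does not
  increase.\<close>

lemma exponential_convergence:
  fixes x :: "real \<Rightarrow> 'a::real_inner"
  assumes der: "\<And>t. t \<ge> 0 \<Longrightarrow> (x has_vector_derivative x' t) (at t within {0..})"
    and "0 \<le> \<tau>" and dec: "\<And>t. t \<ge> \<tau> \<Longrightarrow> 2 * ((x t - s) \<bullet> x' t) \<le> - ((x t - s) \<bullet> (x t - s))"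
  shows "(x \<longlongrightarrow> s) at_top"
proof -
  let ?V = "\<lambda>t. (x t - s) \<bullet> (x t - s)"
  have V: "(?V has_real_derivative 2 * ((x t - s) \<bullet> x' t)) (at t within {0..})" if "t \<ge> 0" for t
  proof -
    have "(x has_derivative (\<lambda>h. h *\<^sub>R x' t)) (at t within {0..})"
      using der[OF that] by (simp add: has_vector_derivative_def)
    then have "(?V has_derivative (\<lambda>h. (x t - s) \<bullet> (h *\<^sub>R x' t) + (h *\<^sub>R x' t) \<bullet> (x t - s))) (at t within {0..})"
      by (auto intro!: derivative_eq_intros)
    moreover have "(\<lambda>h. (x t - s) \<bullet> (h *\<^sub>R x' t) + (h *\<^sub>R x' t) \<bullet> (x t - s)) = (*) (2 * ((x t - s) \<bullet> x' t))"
      by (auto simp: fun_eq_iff inner_commute)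
    ultimately show ?thesis by (simp add: has_field_derivative_def)
  qed
  have "exp t * ?V t \<le> exp \<tau> * ?V \<tau>" if "t \<ge> \<tau>" for t
  proof -
    have W: "((\<lambda>t. exp t * ?V t) has_real_derivative (exp t * ?V t + 2 * ((x t - s) \<bullet> x' t) * exp t)) (at t within {0..})"
      if "t \<ge> 0" for t
      by (rule DERIV_mult[OF has_field_derivative_at_within[OF DERIV_exp] V[OF that]])
    have "exp t * ?V t - exp \<tau> * ?V \<tau> \<le> 0 * (t - \<tau>)"
    proof (rule derivative_bounds(2)[OF W \<open>0 \<le> \<tau>\<close> that])
      fix t assume "\<tau> \<le> t"
      then have "?V t + 2 * ((x t - s) \<bullet> x' t) \<le> 0" using dec[OF \<open>\<tau> \<le> t\<close>] by linarith
      then have "exp t * (?V t + 2 * ((x t - s) \<bullet> x' t)) \<le> 0" by (intro mult_nonneg_nonpos) auto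
      then show "exp t * ?V t + 2 * ((x t - s) \<bullet> x' t) * exp t \<le> 0"
        by (simp only: distrib_left mult.commute[of _ "exp t"])
    qed
    then show ?thesis by simp
  qed
  then have bound: "(norm (x t - s))\<^sup>2 \<le> exp \<tau> * ?V \<tau> * exp (- t)" if "t \<ge> \<tau>" for t
    using that by (simp add: power2_norm_eq_inner exp_minus field_simps)
  have "((\<lambda>t :: real. exp (- t)) \<longlongrightarrow> 0) at_top"
    by (rule filterlim_compose[OF exp_at_bot filterlim_uminus_at_bot_at_top])
  then have "((\<lambda>t. exp \<tau> * ?V \<tau> * exp (- t)) \<longlongrightarrow> 0) at_top"
    by (rule tendsto_mult_right_zero)
  then have "((\<lambda>t. (norm (x t - s))\<^sup>2) \<longlongrightarrow> 0) at_top"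
    by (rule tendsto_sandwich[OF _ _ tendsto_const, rotated 2])
       (use bound in \<open>auto intro!: eventually_at_top_linorderI[of \<tau>]\<close>)
  then have "((\<lambda>t. sqrt ((norm (x t - s))\<^sup>2)) \<longlongrightarrow> sqrt 0) at_top" by (rule tendsto_real_sqrt)
  then have "((\<lambda>t. x t - s) \<longlongrightarrow> 0) at_top" by (simp add: tendsto_norm_zero_iff)
  then show ?thesis by (simp add: LIM_zero_iff)
qed


section \<open>Perturbations in the maximum norm\<close>

lemma infnorm_le_iff: "infnorm (x :: real ^ 'n) \<le> b \<longleftrightarrow> (\<forall>i. \<bar>x $ i\<bar> \<le> b)"
proof
  show "\<forall>i. \<bar>x $ i\<bar> \<le> b" if "infnorm x \<le> b"
    using that component_le_infnorm_cart order_trans by blast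
  show "infnorm x \<le> b" if "\<forall>i. \<bar>x $ i\<bar> \<le> b"
    unfolding infnorm_cart using that by (intro cSup_least) auto
qed

lemma norm_le_card_infnorm: "norm (x :: real ^ 'n) \<le> real CARD('n) * infnorm x"
proof -
  have "norm x \<le> (\<Sum>i\<in>UNIV. \<bar>x $ i\<bar>)" by (rule norm_le_l1_cart)
  also have "\<dots> \<le> (\<Sum>i\<in>(UNIV :: 'n set). infnorm x)"
    by (intro sum_mono component_le_infnorm_cart)
  finally show ?thesis by simp
qed

text \<open>A real supremum is an upper bound only if the set is bounded; here this comes from the
  Euclidean operator norm, since the unit sphere of the max-norm is Euclidean bounded. The rest is
  scaling.\<close>

lemma mat_norm_bound:
  fixes A :: "real ^ 'n ^ 'm"
  shows "infnorm (A *v v) \<le> mat_norm A * infnorm v"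
proof (cases "v = 0")
  case False
  have "bdd_above ((\<lambda>v. infnorm (A *v v)) ` {v. infnorm v = 1})"
  proof (rule bdd_aboveI2)
    fix v :: "real ^ 'n" assume "v \<in> {v. infnorm v = 1}"
    then have "norm v \<le> real CARD('n)" using norm_le_card_infnorm[of v] by simp
    have "infnorm (A *v v) \<le> norm (A *v v)" by (rule infnorm_le_norm)
    also have "\<dots> \<le> onorm ((*v) A) * norm v"
      by (rule onorm) (rule matrix_vector_mul_bounded_linear)
    also have "\<dots> \<le> onorm ((*v) A) * real CARD('n)"
      using \<open>norm v \<le> _\<close> by (intro mult_left_mono onorm_pos_le matrix_vector_mul_bounded_linear)
    finally show "infnorm (A *v v) \<le> onorm ((*v) A) * real CARD('n)" .
  qed
  moreover have "infnorm ((1 / infnorm v) *\<^sub>R v) = 1"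
    using False by (simp add: infnorm_mul infnorm_eq_0 infnorm_pos_le)
  ultimately have "infnorm (A *v ((1 / infnorm v) *\<^sub>R v)) \<le> mat_norm A"
    unfolding mat_norm_def by (intro cSUP_upper) auto
  moreover have "A *v ((1 / infnorm v) *\<^sub>R v) = (1 / infnorm v) *\<^sub>R (A *v v)"
    by (simp add: matrix_vector_mult_scaleR)
  moreover have "infnorm v > 0" using False by (simp add: infnorm_pos_lt)
  ultimately show ?thesis by (simp add: infnorm_mul field_simps)
qed (simp add: infnorm_0)

lemma mat_norm_nonneg: "mat_norm (A :: real ^ 'n ^ 'm) \<ge> 0"
proof -
  let ?v = "axis undefined 1 :: real ^ 'n"
  have "\<bar>?v $ undefined\<bar> \<le> infnorm ?v" by (rule component_le_infnorm_cart)
  then have "infnorm ?v > 0" by (simp add: axis_def)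
  moreover have "0 \<le> mat_norm A * infnorm ?v"
    using mat_norm_bound[of A ?v] infnorm_pos_le order_trans by blast
  ultimately show ?thesis by (simp add: zero_le_mult_iff)
qed

text \<open>Both suprema are nonnegative, so each of them inherits the bound on the sum.\<close>

lemma C1_norm_le:
  fixes h :: "real ^ 'n \<Rightarrow> real ^ 'm"
  assumes "C1_norm h \<le> ereal \<epsilon>"
  shows "infnorm (h x) \<le> \<epsilon>" "mat_norm (jacobian h (at x)) \<le> \<epsilon>"
proof -
  let ?a = "SUP x. ereal (infnorm (h x))" let ?b = "SUP x. ereal (mat_norm (jacobian h (at x)))"
  have "0 \<le> ?a" by (rule SUP_upper2[of undefined]) (auto simp: infnorm_pos_le)
  moreover have "0 \<le> ?b" by (rule SUP_upper2[of undefined]) (auto simp: mat_norm_nonneg)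
  ultimately have "?a \<le> ereal \<epsilon>" "?b \<le> ereal \<epsilon>"
    using assms add_increasing2[of ?b ?a ?a] add_increasing[of ?a ?b ?b] unfolding C1_norm_def
    by (auto intro: order_trans)
  moreover have "ereal (infnorm (h x)) \<le> ?a" "ereal (mat_norm (jacobian h (at x))) \<le> ?b"
    by (auto intro: SUP_upper)
  ultimately show "infnorm (h x) \<le> \<epsilon>" "mat_norm (jacobian h (at x)) \<le> \<epsilon>"
    by (meson ereal_less_eq(3) order_trans)+
qed

text \<open>The mean value theorem is applied to each coordinate along the segment from y to x; in
  the max-norm this loses no dimension factor.\<close>

lemma C1_norm_Lipschitz:
  fixes h :: "real ^ 'n \<Rightarrow> real ^ 'm"
  assumes "C1_norm h \<le> ereal \<epsilon>" "\<And>x. h differentiable (at x)"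
  shows "infnorm (h x - h y) \<le> \<epsilon> * infnorm (x - y)"
  unfolding infnorm_le_iff
proof
  fix i
  let ?\<phi> = "\<lambda>t :: real. h (y + t *\<^sub>R (x - y)) $ i"
  let ?J = "\<lambda>t. jacobian h (at (y + t *\<^sub>R (x - y)))"
  have "(?\<phi> has_derivative (\<lambda>s. s * (?J t *v (x - y)) $ i)) (at t within {0..1})" for t
  proof -
    have "(h has_derivative (\<lambda>v. ?J t *v v)) (at (y + t *\<^sub>R (x - y)))"
      using assms(2) jacobian_works by blast
    moreover have "((\<lambda>t. y + t *\<^sub>R (x - y)) has_derivative (\<lambda>s. s *\<^sub>R (x - y))) (at t within {0..1})"
      by (auto intro!: derivative_eq_intros)
    ultimately have "((\<lambda>t. h (y + t *\<^sub>R (x - y))) has_derivative (\<lambda>s. ?J t *v (s *\<^sub>R (x - y)))) (at t within {0..1})"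
      by (rule has_derivative_compose[rotated])
    then have "(?\<phi> has_derivative (\<lambda>s. (?J t *v (s *\<^sub>R (x - y))) $ i)) (at t within {0..1})"
      by (rule bounded_linear.has_derivative[OF bounded_linear_vec_nth])
    then show ?thesis by (simp add: matrix_vector_mult_scaleR)
  qed
  then obtain t where "?\<phi> 1 - ?\<phi> 0 = (1 - 0) * (?J t *v (x - y)) $ i"
    using mvt_very_simple[of 0 1 ?\<phi> "\<lambda>t s. s * (?J t *v (x - y)) $ i"] by auto
  then have "\<bar>(h x - h y) $ i\<bar> \<le> infnorm (?J t *v (x - y))"
    using component_le_infnorm_cart[of "?J t *v (x - y)" i] by simp
  also have "\<dots> \<le> mat_norm (?J t) * infnorm (x - y)" by (rule mat_norm_bound)
  also have "\<dots> \<le> \<epsilon> * infnorm (x - y)"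
    by (intro mult_right_mono C1_norm_le(2)[OF assms(1)] infnorm_pos_le)
  finally show "\<bar>(h x - h y) $ i\<bar> \<le> \<epsilon> * infnorm (x - y)" .
qed

text \<open>A Gershgorin argument: the entries of A + I are at most \<epsilon>, and in a row where
  the eigenvector has its largest coordinate this gives |\<mu> + 1| \<le> n \<epsilon> < 1.\<close>

lemma eigenvalue_near_minus_one:
  fixes A :: "real ^ 'n ^ 'n"
  assumes "\<And>v. infnorm (A *v v + v) \<le> \<epsilon> * infnorm v" "real CARD('n) * \<epsilon> < 1" "complex_eigenvalue A \<mu>"
  shows "Re \<mu> < 0"
proof -
  obtain v :: "complex ^ 'n" where v: "v \<noteq> 0" "map_matrix complex_of_real A *v v = \<mu> *s v"
    using assms(3) unfolding complex_eigenvalue_def by blast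
  define P where "P = A + mat 1"
  have P: "\<bar>P $ i $ j\<bar> \<le> \<epsilon>" for i j
  proof -
    have "P *v axis j 1 = A *v axis j 1 + axis j 1"
      by (simp add: P_def matrix_vector_mult_add_rdistrib)
    then have "infnorm (P *v axis j 1) \<le> \<epsilon> * infnorm (axis j (1 :: real) :: real ^ 'n)" using assms(1) by metis
    moreover have "infnorm (axis j (1 :: real) :: real ^ 'n) = 1"
    proof (rule antisym)
      show "infnorm (axis j 1 :: real ^ 'n) \<le> 1" unfolding infnorm_le_iff by (simp add: axis_def)
      show "1 \<le> infnorm (axis j 1 :: real ^ 'n)"
        using component_le_infnorm_cart[of "axis j 1 :: real ^ 'n" j] by simp
    qed
    moreover have "(P *v axis j 1) $ i = P $ i $ j"
      by (simp add: matrix_vector_mul_component inner_axis)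
    ultimately show ?thesis using component_le_infnorm_cart[of "P *v axis j 1" i] by simp
  qed
  define m where "m = Max (range (\<lambda>j. norm (v $ j)))"
  have "m \<in> range (\<lambda>j. norm (v $ j))" unfolding m_def by (rule Max_in) auto
  then obtain i where i: "norm (v $ i) = m" by auto
  have le: "norm (v $ j) \<le> m" for j unfolding m_def by (rule Max_ge) auto
  have "m > 0"
  proof -
    obtain j where "v $ j \<noteq> 0" using v(1) by (auto simp: vec_eq_iff)
    then show ?thesis using le[of j] by (metis norm_le_zero_iff not_le order_trans)
  qed
  have "(\<mu> + 1) * v $ i = (\<Sum>j\<in>UNIV. complex_of_real (P $ i $ j) * v $ j)"
  proof -
    have "(\<Sum>j\<in>UNIV. complex_of_real (A $ i $ j) * v $ j) = \<mu> * v $ i"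
      using arg_cong[OF v(2), of "\<lambda>w. w $ i"] by (simp add: matrix_vector_mult_def map_matrix_def)
    moreover have "(\<Sum>j\<in>UNIV. complex_of_real (if i = j then 1 else 0) * v $ j) = v $ i"
      by (subst sum.remove[of _ i]) (auto intro!: sum.neutral)
    ultimately show ?thesis
      by (simp add: P_def mat_def sum.distrib distrib_right)
  qed
  also have "norm \<dots> \<le> (\<Sum>j\<in>(UNIV :: 'n set). \<epsilon> * m)"
    using P le by (intro order_trans[OF norm_sum] sum_mono) (auto simp: norm_mult intro!: mult_mono order_trans[OF abs_ge_zero P])
  finally have "norm (\<mu> + 1) * m \<le> real CARD('n) * \<epsilon> * m"
    by (simp add: norm_mult i mult.assoc)
  then have "norm (\<mu> + 1) < 1" using \<open>m > 0\<close> assms(2) by simp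
  then show ?thesis using abs_Re_le_cmod[of "\<mu> + 1"] by simp
qed

section \<open>The vector field\<close>

text \<open>
  The definitions are generic so that the same formulas make sense for rational arguments, with a
  rational approximation in place of the smooth step S.
\<close>

definition fr :: "'a::floor_ceiling \<Rightarrow> 'a" where
  "fr y = y - of_nat (nat \<lfloor>y\<rfloor>)"

text \<open>With the exact step, a plateau of height 1 on [1/4, 3/4]. It vanishes within 1/8 of the
  walls of the cell, which hides the jumps of the floor, and at negative arguments, where
  \<open>fr\<close> is the identity and not the fractional part.\<close>

definition bump :: "('a::floor_ceiling \<Rightarrow> 'a) \<Rightarrow> 'a \<Rightarrow> 'a" where
  "bump S y = S (8 * y - 1) * S (7 - 8 * y)"

text \<open>With the exact step, the identity on [-1, 1] and constant 1 or -1 from absolute value 2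
  on. In the field it is multiplied by a function of z; with the unbounded factor y in its place the
  product would not be globally Lipschitz.\<close>

definition clip :: "('a::floor_ceiling \<Rightarrow> 'a) \<Rightarrow> 'a \<Rightarrow> 'a" where
  "clip S y = y - (y - 1) * S (y - 1) - (y + 1) * S (- y - 1)"

definition kick :: "('a::floor_ceiling \<Rightarrow> 'a) \<Rightarrow> (nat \<Rightarrow> nat \<Rightarrow> bool) \<Rightarrow> 'a \<Rightarrow> 'a \<Rightarrow> 'a" where
  "kick S h t n = (if h (nat \<lfloor>t\<rfloor>) (nat \<lfloor>n\<rfloor>) then bump S (fr t) * bump S (fr n) else 0)"

definition drift_t :: "('a::floor_ceiling \<Rightarrow> 'a) \<Rightarrow> 'a \<Rightarrow> 'a \<Rightarrow> 'a" where
  "drift_t S t z = (1 - S (z - 2)) - S (z - 2) * clip S t"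

definition drift_n :: "('a::floor_ceiling \<Rightarrow> 'a) \<Rightarrow> 'a \<Rightarrow> 'a \<Rightarrow> 'a" where
  "drift_n S n z = (1 - S (z - 2)) * ((1 / 2 - fr n) * bump S (fr n)) - S (z - 2) * clip S n"

text \<open>With the exact step this is 20 kick - z for z \<le> 1 and 20 - z for z \<ge> 2. The
  blend is such that a kick of size 1 gives 20 - z at every height, so a lift cannot stall in
  between.\<close>

definition drift_z :: "('a::floor_ceiling \<Rightarrow> 'a) \<Rightarrow> (nat \<Rightarrow> nat \<Rightarrow> bool) \<Rightarrow> 'a \<Rightarrow> 'a \<Rightarrow> 'a \<Rightarrow> 'a" where
  "drift_z S h t n z = - z + 20 * S (z - 1) + (1 - S (z - 1)) * (20 * kick S h t n)"

text \<open>Coordinates are named by their place in the enumeration, so t, n and z are the first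
  three entries of an encoded point.\<close>

abbreviation ct :: 7 where "ct \<equiv> enum_class.enum ! 0"
abbreviation cn :: 7 where "cn \<equiv> enum_class.enum ! Suc 0"
abbreviation cz :: 7 where "cz \<equiv> enum_class.enum ! 2"

text \<open>The four remaining coordinates only decay; they raise the dimension to seven.\<close>

definition vfield :: "(nat \<Rightarrow> nat \<Rightarrow> bool) \<Rightarrow> real ^ 7 \<Rightarrow> real ^ 7" where
  "vfield h x = (\<chi> i. if i = ct then drift_t sstep (x $ ct) (x $ cz)
     else if i = cn then drift_n sstep (x $ cn) (x $ cz)
     else if i = cz then drift_z sstep h (x $ ct) (x $ cn) (x $ cz) else - x $ i)"

definition rest_point :: "real ^ 7" where
  "rest_point = (\<chi> i. if i = cz then 20 else 0)"

definition channel_point :: "nat \<Rightarrow> real ^ 7" where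
  "channel_point m = (\<chi> i. if i = cn then real m + 1 / 2 else 0)"

lemma coordinates_distinct: "ct \<noteq> cn" "ct \<noteq> cz" "cn \<noteq> cz" "cn \<noteq> ct" "cz \<noteq> ct" "cz \<noteq> cn"
proof -
  have "length (enum_class.enum :: 7 list) = 7"
    by (simp flip: card_UNIV_length_enum)
  then show "ct \<noteq> cn" "ct \<noteq> cz" "cn \<noteq> cz" "cn \<noteq> ct" "cz \<noteq> ct" "cz \<noteq> cn"
    by (simp_all add: nth_eq_iff_index_eq[OF enum_distinct])
qed

lemma vfield_nth:
  "vfield h x $ ct = drift_t sstep (x $ ct) (x $ cz)"
  "vfield h x $ cn = drift_n sstep (x $ cn) (x $ cz)"
  "vfield h x $ cz = drift_z sstep h (x $ ct) (x $ cn) (x $ cz)"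
  "i \<noteq> ct \<Longrightarrow> i \<noteq> cn \<Longrightarrow> i \<noteq> cz \<Longrightarrow> vfield h x $ i = - x $ i"
  using coordinates_distinct by (simp_all add: vfield_def)

lemma bump_bounds: "0 \<le> bump sstep y" "bump sstep y \<le> 1"
  by (auto simp: bump_def sstep_bounds intro!: mult_nonneg_nonneg mult_le_one)

lemma bump_1: "1 / 4 \<le> y \<Longrightarrow> y \<le> 3 / 4 \<Longrightarrow> bump sstep y = 1"
  by (simp add: bump_def sstep_1)

lemma bump_0: "y \<le> 1 / 8 \<or> 7 / 8 \<le> y \<Longrightarrow> bump sstep y = 0"
  by (auto simp: bump_def sstep_0)

lemma clip_id: "\<bar>y\<bar> \<le> 1 \<Longrightarrow> clip sstep y = y"
  by (simp add: clip_def sstep_0)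

lemma clip_ge: "y \<ge> 1 \<Longrightarrow> clip sstep y \<ge> 1"
proof -
  assume "y \<ge> 1"
  moreover from this have "(y - 1) * sstep (y - 1) \<le> (y - 1) * 1"
    by (intro mult_left_mono sstep_bounds) simp
  ultimately show ?thesis by (simp add: clip_def sstep_0)
qed

lemma clip_minus: "clip sstep (- y) = - clip sstep y"
  by (simp add: clip_def algebra_simps)

lemma clip_bounded: "\<bar>clip sstep y\<bar> \<le> 2"
proof -
  have *: "\<bar>clip sstep y\<bar> \<le> 2" if "y \<ge> 0" for y
  proof (cases "y \<le> 2")
    case True
    have "(y - 1) * sstep (y - 1) \<ge> 0" by (cases "y \<ge> 1") (auto simp: sstep_bounds sstep_0)
    then have "clip sstep y \<le> 2" using True that by (simp add: clip_def sstep_0)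
    moreover have "clip sstep y \<ge> 0"
      using clip_ge[of y] clip_id[of y] that by (cases "y \<ge> 1") auto
    ultimately show ?thesis by simp
  next
    case False
    then show ?thesis by (simp add: clip_def sstep_0 sstep_1)
  qed
  show ?thesis using *[of y] *[of "- y"] by (cases "y \<ge> 0") (auto simp: clip_minus)
qed

text \<open>The floor jumps only where the bump is 0 on both sides, so near any point it may be
  replaced by one number m. Smoothness and the Lipschitz bound both rest on this.\<close>

lemma cell_constant:
  fixes n0 :: real
  shows "\<exists>m. \<forall>n. \<bar>n - n0\<bar> \<le> 1 / 16 \<longrightarrow>
     nat \<lfloor>n\<rfloor> = m \<or> bump sstep (fr n) = 0 \<and> bump sstep (n - real m) = 0"
proof (intro exI allI impI)
  fix n assume n: "\<bar>n - n0\<bar> \<le> 1 / 16"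
  \<comment> \<open>The cell of the right end of the neighbourhood. A point with a smaller floor
    lies at most 1/8 to the left of the wall at m.\<close>
  let ?m = "nat \<lfloor>n0 + 1 / 16\<rfloor>"
  show "nat \<lfloor>n\<rfloor> = ?m \<or> bump sstep (fr n) = 0 \<and> bump sstep (n - real ?m) = 0"
  proof (cases "nat \<lfloor>n\<rfloor> = ?m")
    case False
    have n': "n0 - 1 / 16 \<le> n" "n \<le> n0 + 1 / 16" using n unfolding abs_le_iff by linarith+
    have le: "\<lfloor>n\<rfloor> \<le> \<lfloor>n0 + 1 / 16\<rfloor>" by (rule floor_mono[OF n'(2)])
    then have m: "\<lfloor>n0 + 1 / 16\<rfloor> > 0" "\<lfloor>n\<rfloor> < \<lfloor>n0 + 1 / 16\<rfloor>" using False by linarith+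
    have "real_of_int \<lfloor>n0 + 1 / 16\<rfloor> \<le> n0 + 1 / 16" by simp
    then have ge: "n \<ge> real ?m - 1 / 8" using n'(1) m by linarith
    have lt: "n < real ?m" using m by (simp add: floor_less_iff)
    have "n > 0" using ge m by linarith
    have "real (nat \<lfloor>n\<rfloor>) \<le> real ?m - 1" using m \<open>n > 0\<close> by linarith
    then have "fr n \<ge> 7 / 8" using ge by (simp add: fr_def)
    then show ?thesis using lt by (auto intro: bump_0)
  qed simp
qed

subsection \<open>Smoothness\<close>

lemma Ck_nth: "Ck k (\<lambda>x :: real ^ 'n. x $ i)"
  by (rule Ck_bounded_linear) (rule bounded_linear_vec_nth)

lemmas Ck_intros = Ck_add Ck_diff Ck_mult Ck_uminus Ck_const Ck_nth Ck_compose[OF Ck_sstep]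

lemma Ck_bump: "Ck k f \<Longrightarrow> Ck k (\<lambda>x. bump sstep (f x))"
  unfolding bump_def by (intro Ck_intros)

lemma Ck_clip: "Ck k f \<Longrightarrow> Ck k (\<lambda>x. clip sstep (f x))"
  unfolding clip_def by (intro Ck_intros)

lemma kick_local:
  assumes "nat \<lfloor>t\<rfloor> = k \<or> bump sstep (fr t) = 0 \<and> bump sstep (t - real k) = 0"
    and "nat \<lfloor>n\<rfloor> = m \<or> bump sstep (fr n) = 0 \<and> bump sstep (n - real m) = 0"
  shows "kick sstep h t n = of_bool (h k m) * (bump sstep (t - real k) * bump sstep (n - real m))"
  using assms by (auto simp: kick_def fr_def)

lemma restoring_local:
  assumes "nat \<lfloor>n\<rfloor> = m \<or> bump sstep (fr n) = 0 \<and> bump sstep (n - real m) = 0"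
  shows "(1 / 2 - fr n) * bump sstep (fr n) = (1 / 2 - (n - real m)) * bump sstep (n - real m)"
  using assms by (auto simp: fr_def)

lemma open_coordinate_ball: "open {x :: real ^ 'n. \<bar>x $ i - a\<bar> < b}"
  by (intro open_Collect_less continuous_intros)

lemma Ck_restoring: "Ck k (\<lambda>x :: real ^ 'n. (1 / 2 - fr (x $ i)) * bump sstep (fr (x $ i)))"
proof (rule Ck_local)
  fix x :: "real ^ 'n"
  obtain m where m: "\<And>n. \<bar>n - x $ i\<bar> \<le> 1 / 16 \<Longrightarrow>
      nat \<lfloor>n\<rfloor> = m \<or> bump sstep (fr n) = 0 \<and> bump sstep (n - real m) = 0"
    using cell_constant[of "x $ i"] by blast
  let ?S = "{y :: real ^ 'n. \<bar>y $ i - x $ i\<bar> < 1 / 16}"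
  let ?g = "\<lambda>y :: real ^ 'n. (1 / 2 - (y $ i - real m)) * bump sstep (y $ i - real m)"
  have "\<forall>y\<in>?S. (1 / 2 - fr (y $ i)) * bump sstep (fr (y $ i)) = ?g y"
    using restoring_local[OF m] by auto
  moreover have "Ck k ?g" by (intro Ck_intros Ck_bump)
  ultimately show "\<exists>S g. open S \<and> x \<in> S \<and>
      (\<forall>y\<in>S. (1 / 2 - fr (y $ i)) * bump sstep (fr (y $ i)) = g y) \<and> Ck k g"
    by (intro exI[of _ ?S] exI[of _ ?g] conjI open_coordinate_ball) simp_all
qed

lemma Ck_kick: "Ck k (\<lambda>x :: real ^ 'n. kick sstep h (x $ i) (x $ j))"
proof (rule Ck_local)
  fix x :: "real ^ 'n"
  obtain l where l: "\<And>n. \<bar>n - x $ i\<bar> \<le> 1 / 16 \<Longrightarrow>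
      nat \<lfloor>n\<rfloor> = l \<or> bump sstep (fr n) = 0 \<and> bump sstep (n - real l) = 0"
    using cell_constant[of "x $ i"] by blast
  obtain m where m: "\<And>n. \<bar>n - x $ j\<bar> \<le> 1 / 16 \<Longrightarrow>
      nat \<lfloor>n\<rfloor> = m \<or> bump sstep (fr n) = 0 \<and> bump sstep (n - real m) = 0"
    using cell_constant[of "x $ j"] by blast
  let ?S = "{y :: real ^ 'n. \<bar>y $ i - x $ i\<bar> < 1 / 16} \<inter> {y. \<bar>y $ j - x $ j\<bar> < 1 / 16}"
  let ?g = "\<lambda>y :: real ^ 'n. of_bool (h l m) * (bump sstep (y $ i - real l) * bump sstep (y $ j - real m))"
  have "\<forall>y\<in>?S. kick sstep h (y $ i) (y $ j) = ?g y"
    using kick_local[OF l m] by auto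
  moreover have "Ck k ?g" by (intro Ck_intros Ck_bump)
  ultimately show "\<exists>S g. open S \<and> x \<in> S \<and> (\<forall>y\<in>S. kick sstep h (y $ i) (y $ j) = g y) \<and> Ck k g"
    by (intro exI[of _ ?S] exI[of _ ?g] conjI open_Int open_coordinate_ball) simp_all
qed

lemma smooth_vfield: "C_infinity (vfield h)"
proof (rule C_infinity_vec)
  fix k i
  consider "i = ct" | "i = cn" | "i = cz" | "i \<noteq> ct" "i \<noteq> cn" "i \<noteq> cz" by blast
  then show "Ck k (\<lambda>x. vfield h x $ i)"
  proof cases
    case 1
    then show ?thesis unfolding 1 vfield_nth drift_t_def by (intro Ck_intros Ck_clip)
  next
    case 2
    then show ?thesis unfolding 2 vfield_nth drift_n_def by (intro Ck_restoring Ck_intros Ck_clip)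
  next
    case 3
    then show ?thesis unfolding 3 vfield_nth drift_z_def by (intro Ck_intros Ck_kick)
  next
    case 4
    then show ?thesis by (simp add: vfield_nth Ck_uminus Ck_nth)
  qed
qed

subsection \<open>Lipschitz continuity\<close>

definition lip :: "('a::metric_space \<Rightarrow> real) \<Rightarrow> bool" where
  "lip f \<longleftrightarrow> (\<exists>L\<ge>0. \<forall>x y. \<bar>f x - f y\<bar> \<le> L * dist x y)"

lemma lipI: "L \<ge> 0 \<Longrightarrow> (\<And>x y. \<bar>f x - f y\<bar> \<le> L * dist x y) \<Longrightarrow> lip f"
  by (auto simp: lip_def)

lemma lip_const: "lip (\<lambda>x. c)"
  by (rule lipI[of 0]) auto

lemma lip_id: "lip (\<lambda>x :: real. x)"
  by (rule lipI[of 1]) (auto simp: dist_real_def)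

lemma lip_nth: "lip (\<lambda>x :: real ^ 'n. x $ i)"
  by (rule lipI[of 1]) (use dist_vec_nth_le in \<open>auto simp: dist_real_def[symmetric]\<close>)

lemma lip_add: "lip f \<Longrightarrow> lip g \<Longrightarrow> lip (\<lambda>x. f x + g x)"
proof -
  assume "lip f" "lip g"
  then obtain L M where "L \<ge> 0" "M \<ge> 0" "\<And>x y. \<bar>f x - f y\<bar> \<le> L * dist x y" "\<And>x y. \<bar>g x - g y\<bar> \<le> M * dist x y"
    by (auto simp: lip_def)
  moreover from this have "\<bar>(f x + g x) - (f y + g y)\<bar> \<le> (L + M) * dist x y" for x y
    using abs_triangle_ineq[of "f x - f y" "g x - g y"] by (simp add: distrib_right add_diff_add order_trans[OF _ add_mono])
  ultimately show ?thesis by (intro lipI[of "L + M"]) auto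
qed

lemma lip_uminus: "lip f \<Longrightarrow> lip (\<lambda>x. - f x)"
  by (auto simp: lip_def abs_minus_commute)

lemma lip_diff: "lip f \<Longrightarrow> lip g \<Longrightarrow> lip (\<lambda>x. f x - g x)"
  using lip_add[OF _ lip_uminus] by simp

text \<open>The rule asks for bounded factors; hence the clipping in the field, and the clamping of
  the unbounded factors in the proofs below.\<close>

lemma lip_mult:
  assumes "lip f" "lip g" "\<And>x. \<bar>f x\<bar> \<le> C" "\<And>x. \<bar>g x\<bar> \<le> D"
  shows "lip (\<lambda>x. f x * g x)"
proof -
  obtain L M where LM: "L \<ge> 0" "M \<ge> 0" "\<And>x y. \<bar>f x - f y\<bar> \<le> L * dist x y" "\<And>x y. \<bar>g x - g y\<bar> \<le> M * dist x y"
    using assms by (auto simp: lip_def)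
  have CD: "C \<ge> 0" "D \<ge> 0" using assms(3,4) abs_ge_zero order_trans by blast+
  show ?thesis
  proof (rule lipI[of "C * M + D * L"])
    fix x y
    have "\<bar>f x * g x - f y * g y\<bar> = \<bar>f x * (g x - g y) + g y * (f x - f y)\<bar>" by (simp add: algebra_simps)
    also have "\<dots> \<le> \<bar>f x\<bar> * \<bar>g x - g y\<bar> + \<bar>g y\<bar> * \<bar>f x - f y\<bar>"
      using abs_triangle_ineq[of "f x * (g x - g y)" "g y * (f x - f y)"] by (simp add: abs_mult)
    also have "\<dots> \<le> C * (M * dist x y) + D * (L * dist x y)"
      by (intro add_mono mult_mono assms LM CD) auto
    finally show "\<bar>f x * g x - f y * g y\<bar> \<le> (C * M + D * L) * dist x y" by (simp add: algebra_simps)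
  qed (use LM CD in auto)
qed

lemma lip_compose: "lip (g :: real \<Rightarrow> real) \<Longrightarrow> lip f \<Longrightarrow> lip (\<lambda>x. g (f x))"
proof -
  assume "lip g" "lip f"
  then obtain L M where LM: "L \<ge> 0" "M \<ge> 0" "\<And>x y. \<bar>g x - g y\<bar> \<le> L * \<bar>x - y\<bar>" "\<And>x y. \<bar>f x - f y\<bar> \<le> M * dist x y"
    by (auto simp: lip_def dist_real_def)
  have "\<bar>g (f x) - g (f y)\<bar> \<le> L * M * dist x y" for x y
    using order_trans[OF LM(3) mult_left_mono[OF LM(4) LM(1)]] by (simp add: mult.assoc)
  then show ?thesis using LM by (intro lipI[of "L * M"]) auto
qed

lemma lip_scale: "lip f \<Longrightarrow> lip (\<lambda>x. c * f x)"
proof -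
  have "lip (\<lambda>y :: real. c * y)"
    by (rule lipI[of "\<bar>c\<bar>"]) (auto simp: dist_real_def abs_mult simp flip: right_diff_distrib)
  then show "lip f \<Longrightarrow> ?thesis" by (rule lip_compose)
qed

lemma lip_max: "lip f \<Longrightarrow> lip (\<lambda>x. max c (f x))"
proof -
  have "lip (\<lambda>y :: real. max c y)" by (rule lipI[of 1]) (auto simp: dist_real_def max_def)
  then show "lip f \<Longrightarrow> ?thesis" by (rule lip_compose)
qed

lemma lip_min: "lip f \<Longrightarrow> lip (\<lambda>x. min c (f x))"
proof -
  have "lip (\<lambda>y :: real. min c y)" by (rule lipI[of 1]) (auto simp: dist_real_def min_def)
  then show "lip f \<Longrightarrow> ?thesis" by (rule lip_compose)
qed

lemma lip_sstep: "lip f \<Longrightarrow> lip (\<lambda>x. sstep (f x))"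
proof -
  obtain B where "B \<ge> 1" "\<And>x y. \<bar>sstep x - sstep y\<bar> \<le> B * \<bar>x - y\<bar>" using sstep_Lipschitz by blast
  then have "lip sstep" by (intro lipI[of B]) (auto simp: dist_real_def)
  then show "lip f \<Longrightarrow> ?thesis" by (rule lip_compose)
qed

lemma abs_sstep: "\<bar>sstep x\<bar> \<le> 1" "\<bar>1 - sstep x\<bar> \<le> 1"
  using sstep_bounds[of x] by auto

lemma abs_bump: "\<bar>bump sstep x\<bar> \<le> 1"
  using bump_bounds[of x] by auto

lemma lip_bump: "lip f \<Longrightarrow> lip (\<lambda>x. bump sstep (f x))"
  unfolding bump_def
  by (intro lip_mult[where C = 1 and D = 1] lip_sstep lip_diff lip_scale lip_const abs_sstep)

lemma lip_clip: "lip f \<Longrightarrow> lip (\<lambda>x. clip sstep (f x))"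
proof -
  \<comment> \<open>The factor x in x sstep x is unbounded. It is clamped to [0, 1], which changes
    nothing up to x = 1, and the excess x - 1 beyond is added as a separate summand.\<close>
  let ?q = "\<lambda>x. max 0 (min 1 x) * sstep x + max 0 (x - 1)"
  have q: "x * sstep x = ?q x" for x
    using sstep_0[of x] sstep_1[of x] by (auto simp: max_def min_def)
  have lq: "lip ?q"
    by (intro lip_add lip_mult[where C = 1 and D = 1] lip_max lip_min lip_sstep lip_diff lip_id lip_const abs_sstep) auto
  have "lip (\<lambda>y. y - ?q (y - 1) + ?q (- y - 1))"
    by (intro lip_add[OF lip_diff] lip_compose[OF lq] lip_diff lip_uminus lip_id lip_const)
  moreover have "clip sstep = (\<lambda>y. y - ?q (y - 1) + ?q (- y - 1))"
    unfolding q[symmetric] by (auto simp: clip_def algebra_simps)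
  ultimately show "lip f \<Longrightarrow> ?thesis" using lip_compose by metis
qed

text \<open>At distances above 1/16 a function bounded by C varies by at most 2 C, hence by at most
  32 C times the distance. So short-range estimates suffice, and at short range the floors can be
  taken constant.\<close>

lemma lip_local:
  assumes L: "L \<ge> 0" "\<And>x y. dist x y \<le> 1 / 16 \<Longrightarrow> \<bar>f x - f y\<bar> \<le> L * dist x y" and C: "\<And>x. \<bar>f x\<bar> \<le> C"
  shows "lip f"
proof (rule lipI[of "L + 32 * C"])
  have "C \<ge> 0" using C abs_ge_zero order_trans by blast
  then show "L + 32 * C \<ge> 0" using L by simp
  fix x y
  show "\<bar>f x - f y\<bar> \<le> (L + 32 * C) * dist x y"
  proof (cases "dist x y \<le> 1 / 16")
    case True
    have "L * dist x y \<le> (L + 32 * C) * dist x y" using \<open>C \<ge> 0\<close> by (intro mult_right_mono) auto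
    then show ?thesis using L(2)[OF True] by simp
  next
    case False
    have "\<bar>f x - f y\<bar> \<le> 2 * C" using C[of x] C[of y] by linarith
    also have "\<dots> \<le> 32 * C * dist x y" using False \<open>C \<ge> 0\<close> mult_left_mono[of "1 / 16" "dist x y" "32 * C"] by simp
    also have "\<dots> \<le> (L + 32 * C) * dist x y" using L(1) by (intro mult_right_mono) auto
    finally show ?thesis .
  qed
qed

lemma restoring_bounded: "\<bar>(1 / 2 - y) * bump sstep y\<bar> \<le> 1"
proof (cases "0 \<le> y \<and> y \<le> 1")
  case True
  then show ?thesis unfolding abs_mult using abs_bump by (intro mult_le_one) auto
qed (auto simp: bump_0)

lemma lip_restoring: "lip (\<lambda>x :: real. (1 / 2 - fr x) * bump sstep (fr x))"
proof -
  let ?r = "\<lambda>y. (1 / 2 - y) * bump sstep y"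
  \<comment> \<open>Where the bump is nonzero the factor 1/2 - y lies in [-1/2, 1/2], so clamping it
    changes nothing and makes the product rule applicable.\<close>
  have "?r = (\<lambda>y. max (- 1 / 2) (min (1 / 2) (1 / 2 - y)) * bump sstep y)"
  proof
    fix y show "?r y = max (- 1 / 2) (min (1 / 2) (1 / 2 - y)) * bump sstep y"
      using bump_0[of y] by (cases "y \<le> 1 / 8 \<or> 7 / 8 \<le> y") (auto simp: max_def min_def)
  qed
  moreover have "lip (\<lambda>y. max (- 1 / 2) (min (1 / 2) (1 / 2 - y)) * bump sstep y)"
  proof (rule lip_mult[where C = 1 and D = 1])
    show "\<bar>max (- 1 / 2) (min (1 / 2) (1 / 2 - y))\<bar> \<le> 1" for y :: real by (auto simp: max_def min_def)
  qed (intro lip_max lip_min lip_diff lip_const lip_id lip_bump abs_bump)+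
  ultimately have "lip ?r" by simp
  then obtain L where L: "L \<ge> 0" "\<And>x y. \<bar>?r x - ?r y\<bar> \<le> L * \<bar>x - y\<bar>" by (auto simp: lip_def dist_real_def)
  show ?thesis
  proof (rule lip_local[OF L(1)])
    fix x y :: real assume "dist x y \<le> 1 / 16"
    then have xy: "\<bar>x - x\<bar> \<le> 1 / 16" "\<bar>y - x\<bar> \<le> 1 / 16" by (simp_all add: dist_real_def abs_minus_commute)
    obtain m where m: "\<And>n. \<bar>n - x\<bar> \<le> 1 / 16 \<Longrightarrow>
        nat \<lfloor>n\<rfloor> = m \<or> bump sstep (fr n) = 0 \<and> bump sstep (n - real m) = 0"
      using cell_constant[of x] by blast
    show "\<bar>?r (fr x) - ?r (fr y)\<bar> \<le> L * dist x y"
      using L(2)[of "x - real m" "y - real m"]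
      unfolding restoring_local[OF m[OF xy(1)]] restoring_local[OF m[OF xy(2)]] by (simp add: dist_real_def)
  qed (rule restoring_bounded)
qed

lemma kick_bounds: "0 \<le> kick sstep h t n" "kick sstep h t n \<le> 1"
  by (auto simp: kick_def bump_bounds intro!: mult_nonneg_nonneg mult_le_one)

lemma abs_kick: "\<bar>kick sstep h t n\<bar> \<le> 1"
  using kick_bounds[of h t n] by auto

lemma lip_kick: "lip (\<lambda>x :: real ^ 'n. kick sstep h (x $ i) (x $ j))"
proof -
  have "lip (bump sstep)" using lip_bump[OF lip_id] .
  then obtain L where L: "L \<ge> 0" "\<And>x y. \<bar>bump sstep x - bump sstep y\<bar> \<le> L * \<bar>x - y\<bar>"
    by (auto simp: lip_def dist_real_def)
  show ?thesis
  proof (rule lip_local[of "2 * L"])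
    fix x y :: "real ^ 'n" assume xy: "dist x y \<le> 1 / 16"
    have d: "\<bar>y $ i - x $ i\<bar> \<le> dist x y" for i
      using dist_vec_nth_le[of x i y] by (simp add: dist_real_def)
    obtain l where l: "\<And>n. \<bar>n - x $ i\<bar> \<le> 1 / 16 \<Longrightarrow>
        nat \<lfloor>n\<rfloor> = l \<or> bump sstep (fr n) = 0 \<and> bump sstep (n - real l) = 0"
      using cell_constant[of "x $ i"] by blast
    obtain m where m: "\<And>n. \<bar>n - x $ j\<bar> \<le> 1 / 16 \<Longrightarrow>
        nat \<lfloor>n\<rfloor> = m \<or> bump sstep (fr n) = 0 \<and> bump sstep (n - real m) = 0"
      using cell_constant[of "x $ j"] by blast
    let ?a = "bump sstep (x $ i - real l)" and ?b = "bump sstep (x $ j - real m)"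
    let ?c = "bump sstep (y $ i - real l)" and ?d = "bump sstep (y $ j - real m)"
    have k: "kick sstep h (x $ i) (x $ j) = of_bool (h l m) * (?a * ?b)"
      "kick sstep h (y $ i) (y $ j) = of_bool (h l m) * (?c * ?d)"
      by (intro kick_local l m; use d[of i] d[of j] xy in \<open>simp\<close>)+
    have "\<bar>?a * ?b - ?c * ?d\<bar> = \<bar>?a * (?b - ?d) + ?d * (?a - ?c)\<bar>" by (simp add: algebra_simps)
    also have "\<dots> \<le> \<bar>?a\<bar> * \<bar>?b - ?d\<bar> + \<bar>?d\<bar> * \<bar>?a - ?c\<bar>"
      using abs_triangle_ineq[of "?a * (?b - ?d)" "?d * (?a - ?c)"] by (simp add: abs_mult)
    also have "\<dots> \<le> 1 * (L * dist x y) + 1 * (L * dist x y)"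
    proof (intro add_mono mult_mono abs_bump)
      show "\<bar>?b - ?d\<bar> \<le> L * dist x y" "\<bar>?a - ?c\<bar> \<le> L * dist x y"
        using L(2)[of "x $ j - real m" "y $ j - real m"] L(2)[of "x $ i - real l" "y $ i - real l"]
          mult_left_mono[OF d[of i] L(1)] mult_left_mono[OF d[of j] L(1)] by (simp_all add: abs_minus_commute)
    qed auto
    finally show "\<bar>kick sstep h (x $ i) (x $ j) - kick sstep h (y $ i) (y $ j)\<bar> \<le> 2 * L * dist x y"
      unfolding k using L(1) by (cases "h l m") auto
  qed (use L abs_kick in auto)
qed

lemma vfield_Lipschitz: "\<exists>L\<ge>0. \<forall>x y. norm (vfield h x - vfield h y) \<le> L * norm (x - y)"
proof -
  have "lip (\<lambda>x. vfield h x $ i)" for i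
  proof -
    consider "i = ct" | "i = cn" | "i = cz" | "i \<noteq> ct" "i \<noteq> cn" "i \<noteq> cz" by blast
    then show ?thesis
    proof cases
      case 1
      show ?thesis unfolding 1 vfield_nth drift_t_def
        by (intro lip_diff lip_mult[where C = 1 and D = 2] lip_sstep lip_clip lip_const lip_nth abs_sstep clip_bounded)
    next
      case 2
      have "lip (\<lambda>x :: real ^ 7. (1 - sstep (x $ cz - 2)) * ((1 / 2 - fr (x $ cn)) * bump sstep (fr (x $ cn))))"
        by (intro lip_mult[where C = 1 and D = 1] lip_compose[OF lip_restoring] lip_diff lip_sstep lip_const lip_nth
            abs_sstep restoring_bounded)
      moreover have "lip (\<lambda>x :: real ^ 7. sstep (x $ cz - 2) * clip sstep (x $ cn))"
        by (intro lip_mult[where C = 1 and D = 2] lip_diff lip_sstep lip_clip lip_const lip_nth abs_sstep clip_bounded)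
      ultimately show ?thesis unfolding 2 vfield_nth drift_n_def by (rule lip_diff)
    next
      case 3
      have "\<bar>20 * kick sstep h t n\<bar> \<le> 20" for t n using abs_kick[of h t n] by (simp add: abs_mult)
      then show ?thesis unfolding 3 vfield_nth drift_z_def
        by (intro lip_add lip_uminus lip_mult[where C = 1 and D = 20] lip_scale lip_kick lip_diff lip_sstep lip_const lip_nth abs_sstep)
    next
      case 4
      then show ?thesis by (simp add: vfield_nth lip_uminus lip_nth)
    qed
  qed
  then obtain L where L: "\<And>i. L i \<ge> 0" "\<And>i x y. \<bar>vfield h x $ i - vfield h y $ i\<bar> \<le> L i * dist x y"
    unfolding lip_def by metis
  have "norm (vfield h x - vfield h y) \<le> (\<Sum>i\<in>UNIV. L i) * norm (x - y)" for x y
  proof -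
    have "norm (vfield h x - vfield h y) \<le> (\<Sum>i\<in>UNIV. \<bar>(vfield h x - vfield h y) $ i\<bar>)" by (rule norm_le_l1_cart)
    also have "\<dots> \<le> (\<Sum>i\<in>UNIV. L i * norm (x - y))"
      using L(2) by (intro sum_mono) (simp add: dist_norm)
    finally show ?thesis by (simp add: sum_distrib_right)
  qed
  then show ?thesis using L(1) by (intro exI[of _ "\<Sum>i\<in>UNIV. L i"]) (auto intro: sum_nonneg)
qed

section \<open>Perturbed flows\<close>

definition perturbation :: "(nat \<Rightarrow> nat \<Rightarrow> bool) \<Rightarrow> (real ^ 7 \<Rightarrow> real ^ 7) \<Rightarrow> real ^ 7 \<Rightarrow> real ^ 7" where
  "perturbation h g x = vfield h x - g x"

text \<open>Near the rest point the field is \<open>rest_point\<close> - x, so the zeros of g there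
  are fixed points of this map, which is a contraction of the whole space because the derivative of
  the perturbation is small.\<close>

definition sink_of :: "(nat \<Rightarrow> nat \<Rightarrow> bool) \<Rightarrow> (real ^ 7 \<Rightarrow> real ^ 7) \<Rightarrow> real ^ 7" where
  "sink_of h g = (THE s. rest_point - perturbation h g s = s)"

lemma C_infinity_differentiable: "C_infinity f \<Longrightarrow> f differentiable (at x)"
proof -
  assume "C_infinity f"
  then have "C_k (Suc 0) f" unfolding C_infinity_def by blast
  then show ?thesis by simp
qed

text \<open>Within distance 1 the height z is at least 19, so the steps are saturated, and clipping
  is the identity on t and n. By this exact linearity, all questions about the sink concern the
  perturbation alone.\<close>

lemma vfield_near_rest:
  assumes "infnorm (x - rest_point) \<le> 1" shows "vfield h x = rest_point - x"
proof -
  have c: "\<bar>x $ i - rest_point $ i\<bar> \<le> 1" for i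
    using assms by (simp add: infnorm_le_iff)
  have z: "\<bar>x $ cz - 20\<bar> \<le> 1" using c[of cz] by (simp add: rest_point_def)
  then have S: "sstep (x $ cz - 1) = 1" "sstep (x $ cz - 2) = 1" by (auto intro!: sstep_1)
  have t: "\<bar>x $ ct\<bar> \<le> 1" and n: "\<bar>x $ cn\<bar> \<le> 1"
    using c[of ct] c[of cn] coordinates_distinct by (simp_all add: rest_point_def)
  show ?thesis
  proof (rule vec_eq_iff[THEN iffD2, rule_format])
    fix i
    consider "i = ct" | "i = cn" | "i = cz" | "i \<noteq> ct" "i \<noteq> cn" "i \<noteq> cz" by blast
    then show "vfield h x $ i = (rest_point - x) $ i"
      by cases (use S t n coordinates_distinct in
        \<open>auto simp: vfield_nth drift_t_def drift_n_def drift_z_def clip_id rest_point_def\<close>)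
  qed
qed

context
  fixes h :: "nat \<Rightarrow> nat \<Rightarrow> bool" and g :: "real ^ 7 \<Rightarrow> real ^ 7"
  assumes g: "g \<in> C1_neighbourhood (vfield h) (1 / 100)"
begin

abbreviation "p \<equiv> perturbation h g"
abbreviation "s \<equiv> sink_of h g"

lemma g_differentiable: "g differentiable (at x)"
  using g by (auto simp: C1_neighbourhood_def C_infinity_differentiable)

lemma p_C1: "C1_norm p \<le> ereal (1 / 100)"
  using g unfolding C1_neighbourhood_def perturbation_def[abs_def] by blast

lemma p_differentiable: "p differentiable (at x)"
  unfolding perturbation_def[abs_def]
  by (intro differentiable_diff g_differentiable C_infinity_differentiable smooth_vfield)

lemma p_bound: "\<bar>p x $ i\<bar> \<le> 1 / 100"
  using C1_norm_le(1)[OF p_C1, of x] unfolding infnorm_le_iff by blast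

lemma p_bounds: "p x $ i \<le> 1 / 100" "- (1 / 100) \<le> p x $ i"
  using p_bound[of x i] unfolding abs_le_iff by linarith+

lemma p_Lipschitz: "infnorm (p x - p y) \<le> 1 / 100 * infnorm (x - y)"
  by (rule C1_norm_Lipschitz[OF p_C1 p_differentiable])

text \<open>The fixed point theorem and the Cauchy-Schwarz inequality are used in the Euclidean
  norm; comparing it with the max-norm costs the dimension 7.\<close>

lemma p_norm: "norm (p x - p y) \<le> 7 / 100 * norm (x - y)"
proof -
  have "norm (p x - p y) \<le> 7 * infnorm (p x - p y)"
    using norm_le_card_infnorm[of "p x - p y"] by simp
  also have "\<dots> \<le> 7 * (1 / 100 * norm (x - y))"
    using p_Lipschitz[of x y] infnorm_le_norm[of "x - y"] by simp
  finally show ?thesis by simp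
qed

lemma g_nth: "g x $ i = vfield h x $ i - p x $ i"
  by (simp add: perturbation_def)

lemma g_Lipschitz: "\<exists>L. \<forall>x y. norm (g x - g y) \<le> L * norm (x - y)"
proof -
  obtain L where L: "\<And>x y. norm (vfield h x - vfield h y) \<le> L * norm (x - y)"
    using vfield_Lipschitz by blast
  have "norm (g x - g y) \<le> (L + 7 / 100) * norm (x - y)" for x y
  proof -
    have "g x - g y = (vfield h x - vfield h y) - (p x - p y)" by (simp add: perturbation_def)
    then have "norm (g x - g y) \<le> norm (vfield h x - vfield h y) + norm (p x - p y)"
      using norm_triangle_ineq4 by metis
    then show ?thesis using L[of x y] p_norm[of x y] unfolding distrib_right by linarith
  qed
  then show ?thesis by blast
qed

section \<open>The sink of the perturbed field\<close>

lemma sink_fixpoint: "rest_point - p s = s"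
proof -
  have "\<exists>!s. rest_point - p s = s"
  proof (rule banach_fix_type)
    show "\<forall>x y. dist (rest_point - p x) (rest_point - p y) \<le> 7 / 100 * dist x y"
      using p_norm by (simp add: dist_norm norm_minus_commute)
  qed auto
  then show ?thesis unfolding sink_of_def by (rule theI')
qed

text \<open>By the fixed point equation the sink is displaced by minus the perturbation at the sink.
  This yields the continuity of the sink at the unperturbed field.\<close>

lemma sink_near_rest:
  assumes "\<And>x. infnorm (p x) \<le> \<eta>" shows "infnorm (s - rest_point) \<le> \<eta>"
proof -
  have "s - rest_point = - p s" using sink_fixpoint by (simp add: algebra_simps)
  then show ?thesis using assms[of s] by (simp add: infnorm_neg)
qed

lemma sink_in_box: "infnorm (s - rest_point) \<le> 1 / 100"
  by (rule sink_near_rest) (rule C1_norm_le(1)[OF p_C1])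

lemma g_near_rest:
  assumes "infnorm (x - rest_point) \<le> 1" shows "g x = (s - x) - (p x - p s)"
proof -
  have "g x = rest_point - x - p x"
    using vfield_near_rest[OF assms, of h] by (simp add: perturbation_def algebra_simps)
  then show ?thesis using sink_fixpoint by (simp add: algebra_simps)
qed

lemma sink_zero: "g s = 0"
  using g_near_rest[of s] sink_in_box by simp

text \<open>Near the sink g x = (s - x) - (p x - p s), so its derivative there is - I - Dp with Dp
  of norm at most 1/100, and 7/100 < 1 controls the eigenvalues.\<close>

lemma is_sink_sink: "is_sink g s"
  unfolding is_sink_def
proof (intro conjI allI impI sink_zero g_differentiable)
  fix \<mu> assume \<mu>: "complex_eigenvalue (jacobian g (at s)) \<mu>"
  let ?J = "jacobian p (at s)"
  have lin: "((\<lambda>x. (s - x) - (p x - p s)) has_derivative (\<lambda>v. - v - ?J *v v)) (at s)"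
    using p_differentiable[of s] unfolding jacobian_works by (auto intro!: derivative_eq_intros)
  have eq: "(s - x) - (p x - p s) = g x" if "x \<in> ball s (1 / 2)" for x
  proof -
    have "infnorm (x - rest_point) \<le> infnorm (x - s) + infnorm (s - rest_point)"
      using infnorm_triangle[of "x - s" "s - rest_point"] by simp
    also have "\<dots> \<le> 1"
      using sink_in_box infnorm_le_norm[of "x - s"] that by (simp add: dist_norm norm_minus_commute)
    finally show ?thesis using g_near_rest by simp
  qed
  have "s \<in> ball s (1 / 2)" by simp
  then have "(g has_derivative (\<lambda>v. - v - ?J *v v)) (at s)"
    using has_derivative_transform_within_open[OF lin open_ball _ eq] by blast
  moreover have "(g has_derivative (\<lambda>v. jacobian g (at s) *v v)) (at s)"
    using g_differentiable unfolding jacobian_works .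
  ultimately have D: "(\<lambda>v. jacobian g (at s) *v v) = (\<lambda>v. - v - ?J *v v)"
    by (rule has_derivative_unique[rotated])
  have eq: "jacobian g (at s) *v v + v = - (?J *v v)" for v
    using fun_cong[OF D, of v] by simp
  show "Re \<mu> < 0"
  proof (rule eigenvalue_near_minus_one[OF _ _ \<mu>, of "1 / 100"])
    show "infnorm (jacobian g (at s) *v v + v) \<le> 1 / 100 * infnorm v" for v
      unfolding eq infnorm_neg
      by (rule order_trans[OF mat_norm_bound mult_right_mono[OF C1_norm_le(2)[OF p_C1] infnorm_pos_le]])
  qed simp
qed


section \<open>Confinement to a channel and the switch\<close>

lemma solution_nth:
  assumes "is_forward_solution g x0 x" "t \<ge> 0"
  shows "((\<lambda>t. x t $ i) has_real_derivative vfield h (x t) $ i - p (x t) $ i) (at t within {0..})"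
proof -
  have "(x has_vector_derivative g (x t)) (at t within {0..})"
    using assms by (auto simp: is_forward_solution_def)
  from bounded_linear.has_vector_derivative[OF bounded_linear_vec_nth this, of i]
  show ?thesis by (simp add: has_real_derivative_iff_has_vector_derivative g_nth)
qed

lemma channel_cell:
  assumes "\<bar>n - (real m + 1 / 2)\<bar> \<le> 1 / 4"
  shows "nat \<lfloor>n\<rfloor> = m" "fr n = n - real m" "bump sstep (fr n) = 1"
proof -
  have n: "real m + 1 / 4 \<le> n" "n \<le> real m + 3 / 4" using assms unfolding abs_le_iff by linarith+
  then have "\<lfloor>n\<rfloor> = int m" by (intro floor_unique) auto
  then show 1: "nat \<lfloor>n\<rfloor> = m" by simp
  then show 2: "fr n = n - real m" by (simp add: fr_def)
  show "bump sstep (fr n) = 1" unfolding 2 using n by (intro bump_1) auto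
qed

lemma drift_n_channel:
  assumes "\<bar>n - (real m + 1 / 2)\<bar> \<le> 1 / 4" "z \<le> 2"
  shows "drift_n sstep n z = real m + 1 / 2 - n"
  using assms(2) channel_cell(3)[OF assms(1)]
  by (simp add: drift_n_def channel_cell(2)[OF assms(1)] sstep_0)

text \<open>
  The excesses of n over the two walls of channel m and of c z over a. The flow is confined as long
  as all three are negative.
\<close>

definition confined :: "nat \<Rightarrow> real \<Rightarrow> real \<Rightarrow> real ^ 7 \<Rightarrow> nat \<Rightarrow> real" where
  "confined m a c y j = (if j = 0 then y $ cn - (real m + 1 / 2) - 1 / 4
     else if j = 1 then real m + 1 / 2 - y $ cn - 1 / 4 else c * y $ cz - a)"

lemma confined_simps:
  "confined m a c y 0 = y $ cn - (real m + 1 / 2) - 1 / 4"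
  "confined m a c y 1 = real m + 1 / 2 - y $ cn - 1 / 4"
  "confined m a c y 2 = c * y $ cz - a"
  by (simp_all add: confined_def)

text \<open>At the walls of the channel the restoring drift has size 1/4, against a perturbation of
  at most 1/100. This drift is at full strength only for z \<le> 2, which \<open>z2\<close>
  guarantees. The wall for z is left to the application: c = 1 bounds z from above, c = - 1 from
  below.\<close>

lemma confined_channel:
  assumes sol: "is_forward_solution g x0 x"
    and init: "\<bar>x0 $ cn - (real m + 1 / 2)\<bar> < 1 / 4" "c * x0 $ cz < a"
    and z2: "\<And>t. t \<ge> 0 \<Longrightarrow> c * x t $ cz \<le> a \<Longrightarrow> x t $ cz \<le> 2"
    and z: "\<And>t. t \<ge> 0 \<Longrightarrow> \<bar>x t $ cn - (real m + 1 / 2)\<bar> \<le> 1 / 4 \<Longrightarrow> c * x t $ cz = a \<Longrightarrow>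
       c * (drift_z sstep h (x t $ ct) (x t $ cn) (x t $ cz) - p (x t) $ cz) < 0"
    and "t \<ge> 0"
  shows "\<bar>x t $ cn - (real m + 1 / 2)\<bar> < 1 / 4" "c * x t $ cz < a"
proof -
  have x0: "x 0 = x0" using sol by (simp add: is_forward_solution_def)
  let ?u' = "\<lambda>j t. if j = 0 then g (x t) $ cn else if j = 1 then - g (x t) $ cn else c * g (x t) $ cz"
  have "confined m a c (x t) j < 0" if "j < 3" for j
  proof (rule no_exit[where I = "{..<3}" and u = "\<lambda>j t. confined m a c (x t) j" and u' = ?u' and \<tau> = 0])
    fix i :: nat and t :: real assume "t \<ge> 0"
    then show "((\<lambda>t. confined m a c (x t) i) has_real_derivative ?u' i t) (at t within {0..})"
      unfolding confined_def g_nth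
      by (auto intro!: derivative_eq_intros solution_nth[OF sol])
  next
    fix i :: nat
    have "x0 $ cn - (real m + 1 / 2) - 1 / 4 < 0" "real m + 1 / 2 - x0 $ cn - 1 / 4 < 0" "c * x0 $ cz - a < 0"
      using init unfolding abs_less_iff by linarith+
    then show "confined m a c (x 0) i < 0" by (simp add: confined_def x0)
  next
    fix j t assume t: "t \<ge> 0" and le: "\<And>i. i \<in> {..<3::nat} \<Longrightarrow> confined m a c (x t) i \<le> 0"
      and j: "j \<in> {..<3::nat}" "confined m a c (x t) j = 0"
    have n: "\<bar>x t $ cn - (real m + 1 / 2)\<bar> \<le> 1 / 4" "c * x t $ cz \<le> a"
      using le[of 0] le[of 1] le[of 2] unfolding confined_simps abs_le_iff by simp_all
    have gn: "g (x t) $ cn = real m + 1 / 2 - x t $ cn - p (x t) $ cn"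
      using drift_n_channel[OF n(1) z2[OF t n(2)]] by (simp add: g_nth vfield_nth)
    have pn: "\<bar>p (x t) $ cn\<bar> \<le> 1 / 100" by (rule p_bound)
    consider "j = 0" | "j = 1" | "j = 2" using j(1) by fastforce
    then show "?u' j t < 0"
    proof cases
      case 1
      have "g (x t) $ cn < 0" using j(2) gn pn unfolding 1 confined_simps abs_le_iff by linarith
      then show ?thesis using 1 by simp
    next
      case 2
      have "g (x t) $ cn > 0" using j(2) gn pn unfolding 2 confined_simps abs_le_iff by linarith
      then show ?thesis using 2 by simp
    next
      case 3
      then show ?thesis using j(2) z[OF t n(1)] by (simp add: confined_def g_nth vfield_nth)
    qed
  qed (use that \<open>t \<ge> 0\<close> in auto)
  from this[of 0] this[of 1] this[of 2]
  show "\<bar>x t $ cn - (real m + 1 / 2)\<bar> < 1 / 4" "c * x t $ cz < a"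
    unfolding confined_simps abs_less_iff by linarith+
qed

text \<open>The height 1/2 is a barrier: in a channel without kicks the drift of z there is - 1/2,
  which the perturbation cannot reverse, while the sink has z \<ge> 19.\<close>

lemma channel_not_in_basin:
  assumes "\<not> (\<exists>k. h k m)" shows "channel_point m \<notin> basin g s"
proof
  assume "channel_point m \<in> basin g s"
  then obtain x where sol: "is_forward_solution g (channel_point m) x" and lim: "(x \<longlongrightarrow> s) at_top"
    unfolding basin_def by blast
  have low: "x t $ cz < 1 / 2" if "t \<ge> 0" for t
  proof -
    have "1 * x t $ cz < 1 / 2"
    proof (rule confined_channel(2)[OF sol _ _ _ _ that])
      show "\<bar>channel_point m $ cn - (real m + 1 / 2)\<bar> < 1 / 4" "1 * channel_point m $ cz < 1 / 2"
        using coordinates_distinct by (simp_all add: channel_point_def)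
      fix t assume n: "\<bar>x t $ cn - (real m + 1 / 2)\<bar> \<le> 1 / 4" and z: "1 * x t $ cz = 1 / 2"
      have "kick sstep h (x t $ ct) (x t $ cn) = 0"
        using assms by (simp add: kick_def channel_cell[OF n])
      then have "drift_z sstep h (x t $ ct) (x t $ cn) (x t $ cz) = - 1 / 2"
        using z by (simp add: drift_z_def sstep_0)
      then show "1 * (drift_z sstep h (x t $ ct) (x t $ cn) (x t $ cz) - p (x t) $ cz) < 0"
        using p_bounds[of "x t" cz] by (simp add: abs_le_iff)
    qed auto
    then show ?thesis by simp
  qed
  have "((\<lambda>t. x t $ cz) \<longlongrightarrow> s $ cz) at_top" by (rule tendsto_vec_nth[OF lim])
  then have "s $ cz \<le> 1 / 2"
    by (rule tendsto_upperbound) (use low in \<open>auto intro!: eventually_at_top_linorderI[of 0] less_imp_le\<close>)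
  moreover have "\<bar>(s - rest_point) $ cz\<bar> \<le> 1 / 100"
    using sink_in_box unfolding infnorm_le_iff by blast
  then have "s $ cz \<ge> 19" unfolding abs_le_iff by (simp add: rest_point_def)
  ultimately show False by simp
qed

text \<open>If z stayed at most 2, the clock would run at speed between 99/100 and 101/100 and n
  would stay in its channel. The orbit would then spend time 1/4 on the plateau of cell k, and the
  full kick would lift z above 2.\<close>

lemma switch_reached:
  assumes k: "h k m" and near: "infnorm (x0 - channel_point m) \<le> 1 / 8" and sol: "is_forward_solution g x0 x"
  shows "\<exists>t\<ge>0. x t $ cz > 2"
proof (rule ccontr)
  assume "\<not> ?thesis"
  then have z2: "x t $ cz \<le> 2" if "t \<ge> 0" for t using that by force
  have c: "\<bar>x0 $ i - channel_point m $ i\<bar> \<le> 1 / 8" for i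
    using near unfolding infnorm_le_iff by simp
  have init: "\<bar>x0 $ cn - (real m + 1 / 2)\<bar> \<le> 1 / 8" "\<bar>x0 $ cz\<bar> \<le> 1 / 8" "\<bar>x0 $ ct\<bar> \<le> 1 / 8"
    using c[of cn] c[of cz] c[of ct] coordinates_distinct by (simp_all add: channel_point_def)
  have init': "x0 $ ct \<le> 1 / 8" "- (1 / 8) \<le> x0 $ ct" "- (1 / 8) \<le> x0 $ cz"
    using init(2,3) unfolding abs_le_iff by linarith+
  have conf: "\<bar>x t $ cn - (real m + 1 / 2)\<bar> < 1 / 4" "- 1 * x t $ cz < 1" if "t \<ge> 0" for t
  proof -
    have i: "\<bar>x0 $ cn - (real m + 1 / 2)\<bar> < 1 / 4" "- 1 * x0 $ cz < 1" using init(1) init'(3) by linarith+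
    have w: "- 1 * (drift_z sstep h (x t $ ct) (x t $ cn) (x t $ cz) - p (x t) $ cz) < 0" if "- 1 * x t $ cz = 1" for t
      using that p_bounds[of "x t" cz] kick_bounds(1)[of h "x t $ ct" "x t $ cn"]
      by (simp add: drift_z_def sstep_0 abs_le_iff)
    show "\<bar>x t $ cn - (real m + 1 / 2)\<bar> < 1 / 4" "- 1 * x t $ cz < 1"
      using confined_channel[OF sol i z2 w that] by blast+
  qed
  have x0: "x 0 = x0" using sol by (simp add: is_forward_solution_def)
  have dt: "99 / 100 \<le> vfield h (x t) $ ct - p (x t) $ ct" "vfield h (x t) $ ct - p (x t) $ ct \<le> 101 / 100" if "t \<ge> 0" for t
    using p_bounds[of "x t" ct] z2[OF that] by (simp_all add: vfield_nth drift_t_def sstep_0 abs_le_iff)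
  \<comment> \<open>By this time the clock has passed k + 1/4, even if it starts at - 1/8 and runs
    at speed 99/100.\<close>
  define b where "b = 2 * (real k + 1)"
  have "b \<ge> 0" by (simp add: b_def)
  have "99 / 100 * (b - 0) \<le> x b $ ct - x 0 $ ct"
    by (rule derivative_bounds(1)[OF solution_nth[OF sol] order_refl \<open>b \<ge> 0\<close>]) (use dt in auto)
  then have "x b $ ct \<ge> real k + 1 / 4" using init'(2) by (simp add: b_def x0)
  moreover have "x 0 $ ct \<le> real k + 1 / 4" using init'(1) by (simp add: x0)
  moreover have "continuous_on {0..b} (\<lambda>t. x t $ ct)"
    by (rule continuous_on_subset[OF DERIV_continuous_on[of "{0..}"]]) (use solution_nth[OF sol] in auto)
  ultimately obtain \<tau> where \<tau>: "0 \<le> \<tau>" "x \<tau> $ ct = real k + 1 / 4"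
    using IVT'[of "\<lambda>t. x t $ ct" 0 "real k + 1 / 4" b] \<open>b \<ge> 0\<close> by auto
  have cell: "\<bar>x t $ ct - (real k + 1 / 2)\<bar> \<le> 1 / 4" if "\<tau> \<le> t" "t \<le> \<tau> + 1 / 4" for t
  proof -
    have "99 / 100 * (t - \<tau>) \<le> x t $ ct - x \<tau> $ ct" "x t $ ct - x \<tau> $ ct \<le> 101 / 100 * (t - \<tau>)"
      by (rule derivative_bounds[OF solution_nth[OF sol] \<tau>(1) that(1)]; use dt \<tau>(1) in auto)+
    moreover have "101 / 100 * (t - \<tau>) \<le> 101 / 100 * (1 / 4)"
      using that(2) by (intro mult_left_mono) simp_all
    moreover have "0 \<le> 99 / 100 * (t - \<tau>)" using that(1) by simp
    ultimately have "x t $ ct \<le> real k + 1 / 4 + 101 / 100 * (1 / 4)" "real k + 1 / 4 \<le> x t $ ct"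
      using \<tau>(2) by linarith+
    then show ?thesis by (intro abs_leI) simp_all
  qed
  define \<sigma> where "\<sigma> = \<tau> + 1 / 4"
  have "\<tau> \<le> \<sigma>" unfolding \<sigma>_def by simp
  \<comment> \<open>While z \<le> 2 the lift has speed at least 20 - 2 - 1/100 > 17. In time 1/4
    this gains 17/4, more than the distance 3 from the lower bound - 1 to the height 2.\<close>
  have "17 * (\<sigma> - \<tau>) \<le> x \<sigma> $ cz - x \<tau> $ cz"
  proof (rule derivative_bounds(1)[OF solution_nth[OF sol] \<tau>(1) \<open>\<tau> \<le> \<sigma>\<close>])
    fix t assume t: "\<tau> \<le> t" "t \<le> \<sigma>"
    then have "t \<ge> 0" using \<tau>(1) by simp
    have "kick sstep h (x t $ ct) (x t $ cn) = 1"
      using k conf(1)[OF \<open>t \<ge> 0\<close>] channel_cell[OF cell[OF t[unfolded \<sigma>_def]]] channel_cell[of "x t $ cn" m] by (simp add: kick_def)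
    then have "vfield h (x t) $ cz = 20 - x t $ cz" by (simp add: vfield_nth drift_z_def algebra_simps)
    then show "17 \<le> vfield h (x t) $ cz - p (x t) $ cz"
      using z2[OF \<open>t \<ge> 0\<close>] p_bounds[of "x t" cz] by (simp add: abs_le_iff)
  qed
  moreover have "17 * (\<sigma> - \<tau>) = 17 / 4" by (simp add: \<sigma>_def)
  moreover have "- x \<tau> $ cz < 1" using conf(2)[OF \<tau>(1)] by simp
  moreover have "x \<sigma> $ cz \<le> 2" using z2 \<tau>(1) by (simp add: \<sigma>_def)
  ultimately show False by linarith
qed

text \<open>The height 2 is not crossed downwards again, since the drift there is 18. Above it z
  approaches 20 up to the perturbation, and once |z - 20| < 1 every other coordinate outside (-1, 1)
  moves inwards at speed at least 1 - 1/100.\<close>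

lemma eventually_in_box:
  assumes sol: "is_forward_solution g x0 x" and \<tau>: "\<tau> \<ge> 0" "x \<tau> $ cz > 2"
  shows "\<exists>\<tau>'\<ge>0. \<forall>t\<ge>\<tau>'. infnorm (x t - rest_point) \<le> 1"
proof -
  note der = solution_nth[OF sol]
  have der': "((\<lambda>t. - x t $ i) has_real_derivative - (vfield h (x t) $ i - p (x t) $ i)) (at t within {0..})"
    if "t \<ge> 0" for i t
    by (rule DERIV_minus[OF der[OF that]])
  have vz: "vfield h (x t) $ cz = 20 - x t $ cz" if "x t $ cz \<ge> 2" for t
    using that by (simp add: vfield_nth drift_z_def sstep_1)
  have up: "- x t $ cz < - 2" if "t \<ge> \<tau>" for t
  proof (rule no_exit[where I = "{()}" and u = "\<lambda>_ t. - x t $ cz" and a = "\<lambda>_. - 2" and \<tau> = \<tau> and i = "()"])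
    fix t assume "- x t $ cz = - 2"
    then show "- (vfield h (x t) $ cz - p (x t) $ cz) < 0"
      using vz[of t] p_bounds[of "x t" cz] by (simp add: abs_le_iff)
  qed (use der' \<tau> that in auto)
  have "\<exists>\<tau>'\<ge>\<tau>. \<forall>t\<ge>\<tau>'. x t $ cz < 21"
  proof (rule eventually_below[where c = "1 / 2", OF der \<tau>(1)])
    fix t assume "t \<ge> \<tau>" "x t $ cz \<ge> 21"
    then show "vfield h (x t) $ cz - p (x t) $ cz \<le> - (1 / 2)"
      using vz[of t] p_bounds[of "x t" cz] by (simp add: abs_le_iff)
  qed auto
  then obtain \<tau>1 where \<tau>1: "\<tau>1 \<ge> \<tau>" "\<forall>t\<ge>\<tau>1. x t $ cz < 21" by blast
  have "\<exists>\<tau>'\<ge>\<tau>. \<forall>t\<ge>\<tau>'. - x t $ cz < - 19"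
  proof (rule eventually_below[where c = "1 / 2", OF der' \<tau>(1)])
    fix t assume "t \<ge> \<tau>" "- x t $ cz \<ge> - 19"
    then show "- (vfield h (x t) $ cz - p (x t) $ cz) \<le> - (1 / 2)"
      using vz[of t] up[of t] p_bounds[of "x t" cz] by (simp add: abs_le_iff)
  qed auto
  then obtain \<tau>2 where \<tau>2: "\<tau>2 \<ge> \<tau>" "\<forall>t\<ge>\<tau>2. - x t $ cz < - 19" by blast
  define T where "T = max \<tau>1 \<tau>2"
  have T: "T \<ge> 0" using \<tau>(1) \<tau>1(1) by (simp add: T_def)
  have z: "\<bar>x t $ cz - 20\<bar> < 1" if "t \<ge> T" for t
    using \<tau>1(2)[rule_format, of t] \<tau>2(2)[rule_format, of t] that by (simp add: T_def abs_less_iff)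
  have v: "y \<ge> 1 \<Longrightarrow> vfield h (x t) $ i \<le> - 1" "y \<le> - 1 \<Longrightarrow> vfield h (x t) $ i \<ge> 1"
    if "t \<ge> T" "i \<noteq> cz" "y = x t $ i" for t i y
  proof -
    have "sstep (x t $ cz - 2) = 1" using z[OF that(1)] by (intro sstep_1) (simp add: abs_less_iff)
    then have "vfield h (x t) $ i = (if i = ct \<or> i = cn then - clip sstep y else - y)"
      using that by (auto simp: vfield_nth drift_t_def drift_n_def)
    then show "y \<ge> 1 \<Longrightarrow> vfield h (x t) $ i \<le> - 1" "y \<le> - 1 \<Longrightarrow> vfield h (x t) $ i \<ge> 1"
      using clip_ge[of y] clip_ge[of "- y"] by (auto simp: clip_minus)
  qed
  have "\<exists>\<tau>i. \<forall>t\<ge>\<tau>i. \<bar>x t $ i - rest_point $ i\<bar> < 1" for i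
  proof (cases "i = cz")
    case True
    then show ?thesis using z by (auto simp: rest_point_def)
  next
    case False
    have "\<exists>\<tau>'\<ge>T. \<forall>t\<ge>\<tau>'. x t $ i < 1"
    proof (rule eventually_below[where c = "1 / 2", OF der T])
      fix t assume "t \<ge> T" "x t $ i \<ge> 1"
      then show "vfield h (x t) $ i - p (x t) $ i \<le> - (1 / 2)"
        using v(1)[OF _ False refl, of t] p_bounds[of "x t" i] by (simp add: abs_le_iff)
    qed auto
    then obtain \<sigma> where \<sigma>: "\<forall>t\<ge>\<sigma>. x t $ i < 1" by blast
    have "\<exists>\<tau>'\<ge>T. \<forall>t\<ge>\<tau>'. - x t $ i < 1"
    proof (rule eventually_below[where c = "1 / 2", OF der' T])
      fix t assume "t \<ge> T" "- x t $ i \<ge> 1"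
      then show "- (vfield h (x t) $ i - p (x t) $ i) \<le> - (1 / 2)"
        using v(2)[OF _ False refl, of t] p_bounds[of "x t" i] by (simp add: abs_le_iff)
    qed auto
    then obtain \<sigma>' where \<sigma>': "\<forall>t\<ge>\<sigma>'. - x t $ i < 1" by blast
    show ?thesis
      by (rule exI[of _ "max \<sigma> \<sigma>'"]) (use \<sigma> \<sigma>' False in \<open>auto simp: rest_point_def abs_less_iff\<close>)
  qed
  then obtain \<tau>' where \<tau>': "\<And>i t. t \<ge> \<tau>' i \<Longrightarrow> \<bar>x t $ i - rest_point $ i\<bar> < 1" by metis
  show ?thesis
  proof (intro exI conjI allI impI)
    show "max 0 (Max (range \<tau>')) \<ge> 0" by simp
    fix t assume t: "t \<ge> max 0 (Max (range \<tau>'))"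
    have "\<tau>' i \<le> t" for i using t Max_ge[of "range \<tau>'" "\<tau>' i"] by simp
    then show "infnorm (x t - rest_point) \<le> 1"
      using \<tau>' by (simp add: infnorm_le_iff less_imp_le)
  qed
qed

text \<open>With y = x - s, the linear part contributes - |y|^2 to the inner product of y and g x,
  and the perturbation at most 7/100 |y|^2; half of the decay would be enough.\<close>

lemma box_convergence:
  assumes sol: "is_forward_solution g x0 x" and "\<tau> \<ge> 0"
    and box: "\<And>t. t \<ge> \<tau> \<Longrightarrow> infnorm (x t - rest_point) \<le> 1"
  shows "(x \<longlongrightarrow> s) at_top"
proof (rule exponential_convergence[OF _ \<open>\<tau> \<ge> 0\<close>])
  show "(x has_vector_derivative g (x t)) (at t within {0..})" if "t \<ge> 0" for t
    using sol that by (simp add: is_forward_solution_def)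
  fix t assume "t \<ge> \<tau>"
  let ?y = "x t - s"
  have "?y \<bullet> g (x t) = - (?y \<bullet> ?y) - ?y \<bullet> (p (x t) - p s)"
    unfolding g_near_rest[OF box[OF \<open>t \<ge> \<tau>\<close>]] by (simp add: inner_diff_right inner_diff_left)
  moreover have "\<bar>?y \<bullet> (p (x t) - p s)\<bar> \<le> norm ?y * (7 / 100 * norm ?y)"
    by (rule order_trans[OF Cauchy_Schwarz_ineq2 mult_left_mono[OF p_norm norm_ge_zero]])
  moreover have "norm ?y * (7 / 100 * norm ?y) = 7 / 100 * (?y \<bullet> ?y)"
    by (simp add: power2_norm_eq_inner[symmetric] power2_eq_square)
  moreover have "?y \<bullet> ?y \<ge> 0" by simp
  ultimately show "2 * (?y \<bullet> g (x t)) \<le> - (?y \<bullet> ?y)" unfolding abs_le_iff by linarith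
qed

lemma channel_ball_in_basin:
  assumes "h k m" "infnorm (x0 - channel_point m) \<le> 1 / 8" shows "x0 \<in> basin g s"
proof -
  obtain L where "\<And>x y. norm (g x - g y) \<le> L * norm (x - y)" using g_Lipschitz by blast
  then obtain x where sol: "is_forward_solution g x0 x" using Lipschitz_solution_exists by blast
  obtain \<tau> where "\<tau> \<ge> 0" "x \<tau> $ cz > 2" using switch_reached[OF assms sol] by blast
  then obtain \<tau>' where "\<tau>' \<ge> 0" "\<forall>t\<ge>\<tau>'. infnorm (x t - rest_point) \<le> 1"
    using eventually_in_box[OF sol] by blast
  then have "(x \<longlongrightarrow> s) at_top" using box_convergence[OF sol] by blast
  then show ?thesis using sol unfolding basin_def by blast
qed

end

hide_const (open) p s

section \<open>Rational approximation of the vector field\<close>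

text \<open>Uniformity in y matters, since the exponent of the smooth step is unbounded near the
  ends of (0, 1). With u = y/N the upper bound comes from 1 - u \<le> exp (- u). For the lower one,
  exp (- u) (1 - u^2) \<le> 1 - u and Bernoulli's inequality lose exp (- y) y^2 / N \<le>
  2/N.\<close>

lemma exp_minus_approx:
  fixes y :: real
  assumes "0 \<le> y" "N > 0"
  shows "\<bar>exp (- y) - (if y \<le> real N then (1 - y / real N) ^ N else 0)\<bar> \<le> 2 / real N"
proof (cases "y \<le> real N")
  case True
  define u where "u = y / real N"
  have u: "0 \<le> u" "u \<le> 1" "real N * u = y" using assms True by (auto simp: u_def)
  have "1 - u \<le> exp (- u)" using exp_ge_add_one_self[of "- u"] by simp
  then have "(1 - u) ^ N \<le> exp (- u) ^ N" using u by (intro power_mono) auto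
  also have "exp (- u) ^ N = exp (- y)" using u(3) by (simp add: exp_of_nat_mult[symmetric])
  finally have upper: "(1 - u) ^ N \<le> exp (- y)" .
  have "exp (- u) * (1 - u\<^sup>2) \<le> 1 - u"
  proof -
    have "exp (- u) \<le> inverse (1 + u)"
      unfolding exp_minus using u exp_ge_add_one_self[of u] by (intro le_imp_inverse_le) auto
    then have "exp (- u) * (1 - u\<^sup>2) \<le> inverse (1 + u) * (1 - u\<^sup>2)"
      using u by (intro mult_right_mono) (auto simp: power_le_one)
    also have "inverse (1 + u) * (1 - u\<^sup>2) = 1 - u"
    proof -
      have "1 - u\<^sup>2 = (1 + u) * (1 - u)" by (simp add: power2_eq_square algebra_simps)
      then show ?thesis using u by simp
    qed
    finally show ?thesis .
  qed
  then have "(exp (- u) * (1 - u\<^sup>2)) ^ N \<le> (1 - u) ^ N"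
    using u by (intro power_mono mult_nonneg_nonneg) (auto simp: power_le_one)
  moreover have "(exp (- u) * (1 - u\<^sup>2)) ^ N = exp (- y) * (1 - u\<^sup>2) ^ N"
    using u(3) by (simp add: power_mult_distrib exp_of_nat_mult[symmetric])
  moreover have "1 + real N * (- u\<^sup>2) \<le> (1 + - u\<^sup>2) ^ N"
    using u by (intro Bernoulli_inequality) (simp add: power_le_one)
  then have "exp (- y) * (1 - real N * u\<^sup>2) \<le> exp (- y) * (1 - u\<^sup>2) ^ N"
    by (intro mult_left_mono) auto
  ultimately have lower: "exp (- y) - exp (- y) * (real N * u\<^sup>2) \<le> (1 - u) ^ N"
    by (simp add: right_diff_distrib)
  have "1 + y + y\<^sup>2 / 2 \<le> exp y" by (rule exp_lower_Taylor_quadratic[OF assms(1)])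
  then have "y\<^sup>2 \<le> 2 * exp y" using assms(1) by linarith
  then have "exp (- y) * y\<^sup>2 \<le> exp (- y) * (2 * exp y)" by (intro mult_left_mono) auto
  also have "exp (- y) * (2 * exp y) = 2" by (simp add: exp_minus)
  finally have "exp (- y) * y\<^sup>2 \<le> 2" .
  moreover have "exp (- y) * (real N * u\<^sup>2) = exp (- y) * y\<^sup>2 / real N"
    using assms(2) by (simp add: u_def power2_eq_square)
  ultimately have "exp (- y) * (real N * u\<^sup>2) \<le> 2 / real N"
    using assms(2) by (simp add: divide_right_mono)
  then show ?thesis using upper lower True unfolding u_def[symmetric] by simp
next
  case False
  have "exp (- y) \<le> inverse (real N)"
    unfolding exp_minus using False assms(2) exp_ge_add_one_self[of y] by (intro le_imp_inverse_le) linarith+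
  also have "\<dots> \<le> 2 / real N" by (simp add: divide_inverse)
  finally show ?thesis using False by simp
qed

definition rexp :: "nat \<Rightarrow> rat \<Rightarrow> rat" where
  "rexp N y = (if y \<le> of_nat N then (1 - y / of_nat N) ^ N else 0)"

text \<open>The logistic form of the step, split by the sign of the exponent so that
  \<open>rexp\<close> is applied to a nonnegative argument, where its error is uniform.\<close>

definition rstep :: "nat \<Rightarrow> rat \<Rightarrow> rat" where
  "rstep N r = (if r \<le> 0 then 0 else if 1 \<le> r then 1
     else if 0 \<le> 1 / r - 1 / (1 - r)
       then rexp N (1 / r - 1 / (1 - r)) / (1 + rexp N (1 / r - 1 / (1 - r)))
       else 1 / (1 + rexp N (1 / (1 - r) - 1 / r)))"

lemma rexp_approx:
  assumes "0 \<le> y" "N > 0"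
  shows "\<bar>of_rat (rexp N y) - exp (- of_rat y)\<bar> \<le> 2 / real N" "0 \<le> rexp N y"
proof -
  have "(of_rat (rexp N y) :: real) = (if of_rat y \<le> real N then (1 - of_rat y / real N) ^ N else 0)"
  proof -
    have "y \<le> of_nat N \<longleftrightarrow> (of_rat y :: real) \<le> of_rat (of_nat N)" by (simp only: of_rat_less_eq)
    then show ?thesis by (simp add: rexp_def of_rat_power of_rat_diff of_rat_divide)
  qed
  then show "\<bar>of_rat (rexp N y) - exp (- of_rat y)\<bar> \<le> 2 / real N"
    using exp_minus_approx[of "of_rat y" N] assms by (simp add: abs_minus_commute)
  show "0 \<le> rexp N y" using assms by (auto simp: rexp_def field_simps intro!: zero_le_power)
qed

lemma logistic_contraction:
  fixes a b :: real
  assumes "0 \<le> a" "0 \<le> b"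
  shows "\<bar>1 / (1 + a) - 1 / (1 + b)\<bar> \<le> \<bar>a - b\<bar>"
proof -
  have "1 / (1 + a) - 1 / (1 + b) = (b - a) / ((1 + a) * (1 + b))"
    using assms by (simp add: field_simps)
  moreover have "1 \<le> (1 + a) * (1 + b)" using assms mult_mono[of 1 "1 + a" 1 "1 + b"] by simp
  then have "\<bar>b - a\<bar> / ((1 + a) * (1 + b)) \<le> \<bar>b - a\<bar> / 1"
    by (intro divide_left_mono) auto
  ultimately show ?thesis using assms by (simp add: abs_divide abs_mult abs_minus_commute)
qed

lemma logistic_reflection: "1 / (1 + exp w) = 1 - 1 / (1 + exp (- w :: real))"
proof -
  have "1 / (1 + a) = 1 - 1 / (1 + inverse a)" if "a > 0" for a :: real
    using that by (simp add: field_simps add_pos_pos)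
  then show ?thesis by (simp only: exp_minus exp_gt_zero)
qed

lemma rstep_approx:
  assumes "N > 0"
  shows "\<bar>of_rat (rstep N r) - sstep (of_rat r)\<bar> \<le> 2 / real N" "0 \<le> rstep N r" "rstep N r \<le> 1"
    "r \<le> 0 \<Longrightarrow> rstep N r = 0" "1 \<le> r \<Longrightarrow> rstep N r = 1"
proof -
  let ?y = "1 / r - 1 / (1 - r)"
  have y: "(of_rat ?y :: real) = 1 / of_rat r - 1 / (1 - of_rat r)"
    by (simp add: of_rat_diff of_rat_divide)
  show "\<bar>of_rat (rstep N r) - sstep (of_rat r)\<bar> \<le> 2 / real N"
  proof (cases "0 < r \<and> r < 1")
    case True
    then have S: "sstep (of_rat r) = 1 / (1 + exp (of_rat ?y))"
      unfolding y by (intro sstep_eq) auto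
    show ?thesis
    proof (cases "0 \<le> ?y")
      case pos: True
      define e where "e = rexp N ?y"
      have e: "\<bar>of_rat e - exp (- of_rat ?y)\<bar> \<le> 2 / real N" "0 \<le> e"
        using rexp_approx[OF pos assms] by (simp_all add: e_def)
      have "(of_rat (rstep N r) :: real) = of_rat e / (1 + of_rat e)"
        using True pos by (simp add: rstep_def e_def[symmetric] of_rat_divide of_rat_add)
      also have "\<dots> = 1 - 1 / (1 + of_rat e)" using e(2) by (simp add: field_simps add_nonneg_eq_0_iff)
      finally have 1: "(of_rat (rstep N r) :: real) = 1 - 1 / (1 + of_rat e)" .
      have "1 / (1 + exp (of_rat ?y)) = 1 - 1 / (1 + exp (- of_rat ?y) :: real)"
        by (rule logistic_reflection)
      then have "\<bar>of_rat (rstep N r) - sstep (of_rat r)\<bar> = \<bar>1 / (1 + of_rat e) - 1 / (1 + exp (- of_rat ?y))\<bar>"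
        unfolding S 1 by simp
      also have "\<dots> \<le> 2 / real N" using e by (intro order_trans[OF logistic_contraction]) auto
      finally show ?thesis .
    next
      case neg: False
      define e where "e = rexp N (1 / (1 - r) - 1 / r)"
      have e: "\<bar>of_rat e - exp (- of_rat (1 / (1 - r) - 1 / r))\<bar> \<le> 2 / real N" "0 \<le> e"
        unfolding e_def by (rule rexp_approx[OF _ assms]; use neg in simp)+
      have "- (1 / (1 - r) - 1 / r) = ?y" by simp
      then have "- of_rat (1 / (1 - r) - 1 / r) = (of_rat ?y :: real)" by (metis of_rat_minus)
      then have e': "\<bar>of_rat e - exp (of_rat ?y)\<bar> \<le> 2 / real N" using e(1) by simp
      have "(of_rat (rstep N r) :: real) = 1 / (1 + of_rat e)"
        using True neg by (simp add: rstep_def e_def[symmetric] of_rat_divide of_rat_add)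
      then have "\<bar>of_rat (rstep N r) - sstep (of_rat r)\<bar> \<le> \<bar>of_rat e - exp (of_rat ?y)\<bar>"
        unfolding S using e(2) by (simp add: logistic_contraction)
      then show ?thesis using e' by simp
    qed
  next
    case False
    then consider "r \<le> 0" | "r \<ge> 1" by linarith
    then show ?thesis
    proof cases
      case 1
      then have "(of_rat r :: real) \<le> 0" by simp
      then show ?thesis using 1 by (simp add: rstep_def sstep_0)
    next
      case 2
      then have "(of_rat r :: real) \<ge> 1" by simp
      then show ?thesis using 2 by (simp add: rstep_def sstep_1)
    qed
  qed
  have frac: "0 \<le> e / (1 + e) \<and> e / (1 + e) \<le> 1 \<and> 0 \<le> 1 / (1 + e) \<and> 1 / (1 + e) \<le> 1" if "0 \<le> e" for e :: rat
    using that by (simp add: divide_le_eq_1)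
  have "0 \<le> rstep N r \<and> rstep N r \<le> 1"
  proof (cases "0 \<le> ?y")
    case True
    show ?thesis using frac[OF rexp_approx(2)[OF True assms]] True unfolding rstep_def by simp
  next
    case False
    then have ge: "0 \<le> 1 / (1 - r) - 1 / r" by linarith
    show ?thesis using frac[OF rexp_approx(2)[OF ge assms]] False unfolding rstep_def by simp
  qed
  then show "0 \<le> rstep N r" "rstep N r \<le> 1" by blast+
qed (auto simp: rstep_def)

text \<open>What the error estimates use of an approximate step. The exact values outside (0, 1)
  keep terms such as y S y close to their counterparts for unbounded y.\<close>

locale step_approximation =
  fixes S :: "real \<Rightarrow> real" and \<delta> :: real
  assumes close: "\<bar>S x - sstep x\<bar> \<le> \<delta>" and nonneg: "0 \<le> S x" and le_one: "S x \<le> 1"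
    and zero: "x \<le> 0 \<Longrightarrow> S x = 0" and one: "1 \<le> x \<Longrightarrow> S x = 1"
begin

lemma product_close:
  fixes a b a' b' :: real
  assumes "\<bar>a - a'\<bar> \<le> \<alpha>" "\<bar>b - b'\<bar> \<le> \<beta>" "\<bar>a\<bar> \<le> A" "\<bar>b'\<bar> \<le> B" "0 \<le> \<alpha>" "0 \<le> \<beta>"
  shows "\<bar>a * b - a' * b'\<bar> \<le> A * \<beta> + \<alpha> * B"
proof -
  have "a * b - a' * b' = a * (b - b') + (a - a') * b'" by (simp add: algebra_simps)
  also have "\<bar>\<dots>\<bar> \<le> \<bar>a\<bar> * \<bar>b - b'\<bar> + \<bar>a - a'\<bar> * \<bar>b'\<bar>"
    using abs_triangle_ineq[of "a * (b - b')" "(a - a') * b'"] by (simp add: abs_mult)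
  also have "\<dots> \<le> A * \<beta> + \<alpha> * B"
    using assms abs_ge_zero order_trans by (intro add_mono mult_mono) (auto intro: order_trans[OF abs_ge_zero])
  finally show ?thesis .
qed

lemma delta_nonneg: "0 \<le> \<delta>"
  using close[of 0] by (rule order_trans[OF abs_ge_zero])

lemma abs_S: "\<bar>S x\<bar> \<le> 1" "\<bar>1 - S x\<bar> \<le> 1"
  using nonneg[of x] le_one[of x] by auto

lemma bump_close: "\<bar>bump S y - bump sstep y\<bar> \<le> 2 * \<delta>"
  unfolding bump_def
  using product_close[OF close close abs_S(1) abs_sstep(1) delta_nonneg delta_nonneg, of "8 * y - 1" "7 - 8 * y"]
  by simp

lemma abs_bump_S: "\<bar>bump S y\<bar> \<le> 1"
  unfolding bump_def abs_mult using abs_S by (intro mult_le_one) auto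

lemma linear_close: "\<bar>y * S y - y * sstep y\<bar> \<le> \<delta>"
proof (cases "0 \<le> y \<and> y \<le> 1")
  case True
  then have "\<bar>y\<bar> * \<bar>S y - sstep y\<bar> \<le> 1 * \<delta>" by (intro mult_mono close) auto
  then show ?thesis by (simp add: abs_mult flip: right_diff_distrib)
next
  case False
  then show ?thesis using zero[of y] one[of y] sstep_0[of y] sstep_1[of y] delta_nonneg by auto
qed

lemma clip_close: "\<bar>clip S y - clip sstep y\<bar> \<le> 2 * \<delta>"
proof -
  have "clip S y - clip sstep y = ((- y - 1) * S (- y - 1) - (- y - 1) * sstep (- y - 1)) -
      ((y - 1) * S (y - 1) - (y - 1) * sstep (y - 1))"
    by (simp add: clip_def algebra_simps)
  then show ?thesis using linear_close[of "y - 1"] linear_close[of "- y - 1"] by linarith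
qed

lemma drift_t_close: "\<bar>drift_t S t z - drift_t sstep t z\<bar> \<le> 128 * \<delta>"
proof -
  have "\<bar>S (z - 2) * clip S t - sstep (z - 2) * clip sstep t\<bar> \<le> 1 * (2 * \<delta>) + \<delta> * 2"
    using delta_nonneg by (intro product_close close clip_close abs_S clip_bounded) auto
  then show ?thesis using close[of "z - 2"] delta_nonneg unfolding drift_t_def by linarith
qed

lemma one_minus_close: "\<bar>(1 - S x) - (1 - sstep x)\<bar> \<le> \<delta>"
  using close[of x] by (simp add: abs_minus_commute)

lemma restoring_close: "\<bar>(1 / 2 - y) * bump S y - (1 / 2 - y) * bump sstep y\<bar> \<le> 2 * \<delta>"
proof (cases "0 \<le> y \<and> y \<le> 1")
  case True
  then have "\<bar>1 / 2 - y\<bar> * \<bar>bump S y - bump sstep y\<bar> \<le> 1 * (2 * \<delta>)" by (intro mult_mono bump_close) auto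
  then show ?thesis by (simp add: abs_mult flip: right_diff_distrib)
next
  case False
  then have "bump S y = 0" "bump sstep y = 0" by (auto simp: bump_def zero sstep_0)
  then show ?thesis using delta_nonneg by simp
qed

lemma drift_n_close: "\<bar>drift_n S n z - drift_n sstep n z\<bar> \<le> 128 * \<delta>"
proof -
  have "\<bar>S (z - 2) * clip S n - sstep (z - 2) * clip sstep n\<bar> \<le> 1 * (2 * \<delta>) + \<delta> * 2"
    using delta_nonneg by (intro product_close close clip_close abs_S clip_bounded) auto
  moreover have "\<bar>(1 - S (z - 2)) * ((1 / 2 - fr n) * bump S (fr n)) - (1 - sstep (z - 2)) * ((1 / 2 - fr n) * bump sstep (fr n))\<bar>
      \<le> 1 * (2 * \<delta>) + \<delta> * 1"
    using delta_nonneg by (intro product_close one_minus_close restoring_close abs_S restoring_bounded) auto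
  ultimately show ?thesis using delta_nonneg unfolding drift_n_def by linarith
qed

lemma kick_close: "\<bar>kick S h t n - kick sstep h t n\<bar> \<le> 4 * \<delta>"
proof -
  have "\<bar>bump S (fr t) * bump S (fr n) - bump sstep (fr t) * bump sstep (fr n)\<bar> \<le> 1 * (2 * \<delta>) + 2 * \<delta> * 1"
    using delta_nonneg by (intro product_close bump_close abs_bump_S abs_bump) auto
  then show ?thesis using delta_nonneg by (simp add: kick_def)
qed

text \<open>The level term contributes 20 \<delta> and the kick term 80 \<delta> + 20 \<delta>. The
  next power of two above the sum is 128, used for all three coordinates.\<close>

lemma drift_z_close: "\<bar>drift_z S h t n z - drift_z sstep h t n z\<bar> \<le> 128 * \<delta>"
proof -
  have "\<bar>(1 - S (z - 1)) * (20 * kick S h t n) - (1 - sstep (z - 1)) * (20 * kick sstep h t n)\<bar> \<le> 1 * (80 * \<delta>) + \<delta> * 20"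
  proof (rule product_close[OF one_minus_close _ abs_S(2) _ delta_nonneg])
    show "\<bar>20 * kick S h t n - 20 * kick sstep h t n\<bar> \<le> 80 * \<delta>" using kick_close[of h t n] by linarith
    show "\<bar>20 * kick sstep h t n\<bar> \<le> 20" using abs_kick[of h t n] by linarith
  qed (use delta_nonneg in simp)
  then show ?thesis using close[of "z - 1"] delta_nonneg unfolding drift_z_def by linarith
qed

end

section \<open>Transfer between rational and real formulas\<close>

lemma of_rat_fr: "(of_rat (fr r) :: real) = fr (of_rat r)"
  by (simp add: fr_def of_rat_diff of_rat_floor)

context
  fixes T :: "rat \<Rightarrow> rat" and S :: "real \<Rightarrow> real"
  assumes TS: "\<And>r. of_rat (T r) = S (of_rat r)"
begin

lemma of_rat_bump: "of_rat (bump T r) = bump S (of_rat r)"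
  by (simp add: bump_def of_rat_mult TS of_rat_diff)

lemma of_rat_clip: "of_rat (clip T r) = clip S (of_rat r)"
  by (simp add: clip_def of_rat_mult TS of_rat_diff of_rat_minus of_rat_add)

lemma of_rat_drift_t: "of_rat (drift_t T t z) = drift_t S (of_rat t) (of_rat z)"
  by (simp add: drift_t_def of_rat_mult TS of_rat_diff of_rat_clip)

lemma of_rat_drift_n: "of_rat (drift_n T n z) = drift_n S (of_rat n) (of_rat z)"
  by (simp add: drift_n_def of_rat_mult TS of_rat_diff of_rat_clip of_rat_bump of_rat_fr of_rat_divide)

lemma of_rat_kick: "of_rat (kick T h t n) = kick S h (of_rat t) (of_rat n)"
  by (simp add: kick_def of_rat_mult of_rat_bump of_rat_fr of_rat_floor)

lemma of_rat_drift_z: "of_rat (drift_z T h t n z) = drift_z S h (of_rat t) (of_rat n) (of_rat z)"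
  by (simp add: drift_z_def of_rat_mult TS of_rat_diff of_rat_kick of_rat_add of_rat_minus)

end

text \<open>The estimates concern functions on the real line, while \<open>rstep\<close> is given on
  the rationals. Completing it by the exact step at irrational points yields a function to which
  they apply.\<close>

lemma rational_step_approximation:
  assumes "N > 0"
  obtains S where "\<And>r. of_rat (rstep N r) = S (of_rat r)" "step_approximation S (2 / real N)"
proof
  define S where "S = (\<lambda>x. if \<exists>r. x = of_rat r then of_rat (rstep N (THE r. x = of_rat r)) else sstep x)"
  have S: "S (of_rat r) = of_rat (rstep N r)" for r by (simp add: S_def)
  then show "of_rat (rstep N r) = S (of_rat r)" for r by simp
  have S': "(\<exists>r. x = of_rat r \<and> S x = of_rat (rstep N r)) \<or> S x = sstep x" for x
    using S by (cases "\<exists>r. x = of_rat r") (auto simp: S_def)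
  show "step_approximation S (2 / real N)"
  proof
    fix x
    from S'[of x] show "\<bar>S x - sstep x\<bar> \<le> 2 / real N" "0 \<le> S x" "S x \<le> 1"
      "x \<le> 0 \<Longrightarrow> S x = 0" "1 \<le> x \<Longrightarrow> S x = 1"
      using rstep_approx[OF assms] sstep_bounds sstep_0 sstep_1 by auto
  qed
qed

definition rfield :: "(nat \<Rightarrow> nat \<Rightarrow> bool) \<Rightarrow> nat \<Rightarrow> rat list \<Rightarrow> rat list" where
  "rfield h N qs = drift_t (rstep N) (hd qs) (hd (drop 2 qs)) #
     drift_n (rstep N) (hd (drop 1 qs)) (hd (drop 2 qs)) #
     drift_z (rstep N) h (hd qs) (hd (drop 1 qs)) (hd (drop 2 qs)) # map uminus (drop 3 qs)"

lemma cmp_rstep [cmp_intros]: "cmp F \<Longrightarrow> cmp G \<Longrightarrow> cmp (\<lambda>\<Omega> x. rstep (F \<Omega> x) (G \<Omega> x))"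
  unfolding rstep_def rexp_def by (intro cmp_intros)

lemma cmp_rfield:
  assumes h: "cmp (\<lambda>\<Omega> p. h (fst p) (snd p))" and "cmp F" "cmp G"
  shows "cmp (\<lambda>\<Omega> x. rfield h (F \<Omega> x) (G \<Omega> x))"
proof (rule cmp_app2[OF _ assms(2,3)])
  show "cmp (\<lambda>\<Omega> p. rfield h (fst p) (snd p))"
    unfolding rfield_def drift_t_def drift_n_def drift_z_def kick_def clip_def bump_def fr_def
    by (intro cmp_intros cmp_app2[OF h])
qed

lemma enum_7: "length (enum_class.enum :: 7 list) = 7"
  by (simp flip: card_UNIV_length_enum)

lemma coordinate_index: "\<exists>k<7. i = enum_class.enum ! k" for i :: 7
proof -
  have "i \<in> set enum_class.enum" by (simp add: UNIV_enum[symmetric])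
  then show ?thesis by (metis enum_7 in_set_conv_nth)
qed

lemma coords_nth: "k < 7 \<Longrightarrow> coords (p :: 'a ^ 7) ! k = p $ (enum_class.enum ! k)"
  by (simp add: coords_def enum_7)

lemma rfield_approx:
  fixes p q :: "rat ^ 7"
  assumes "N > 0" and p: "coords p = rfield h N (coords q)"
  shows "infnorm (real_point p - vfield h (real_point q)) \<le> 256 / real N"
proof -
  obtain S where S: "\<And>r. of_rat (rstep N r) = S (of_rat r)" "step_approximation S (2 / real N)"
    using rational_step_approximation[OF assms(1)] by blast
  interpret step_approximation S "2 / real N" by (rule S(2))
  have hd: "hd (coords q) = q $ ct" "hd (drop 1 (coords q)) = q $ cn" "hd (drop 2 (coords q)) = q $ cz"
    using coords_nth[of 0 q] coords_nth[of 1 q] coords_nth[of 2 q]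
    by (simp_all add: hd_drop_conv_nth hd_conv_nth flip: length_0_conv)
  have "\<bar>(real_point p - vfield h (real_point q)) $ i\<bar> \<le> 256 / real N" for i
  proof -
    obtain k where k: "k < 7" "i = enum_class.enum ! k" using coordinate_index by blast
    have pk: "p $ i = rfield h N (coords q) ! k" using coords_nth[OF k(1), of p] p k(2) by simp
    consider "k = 0" | "k = 1" | "k = 2" | "k \<ge> 3" by linarith
    then show ?thesis
    proof cases
      case 1
      then show ?thesis
        using pk k drift_t_close[of "of_rat (q $ ct)" "of_rat (q $ cz)"]
        by (simp add: real_point_def rfield_def hd of_rat_drift_t[of "rstep N" S, OF S(1)] vfield_nth)
    next
      case 2
      then show ?thesis
        using pk k drift_n_close[of "of_rat (q $ cn)" "of_rat (q $ cz)"]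
        by (simp add: real_point_def rfield_def hd[simplified] of_rat_drift_n[of "rstep N" S, OF S(1)] vfield_nth)
    next
      case 3
      then show ?thesis
        using pk k drift_z_close[of h "of_rat (q $ ct)" "of_rat (q $ cn)" "of_rat (q $ cz)"]
        by (simp add: real_point_def rfield_def hd[simplified] of_rat_drift_z[of "rstep N" S, OF S(1)] vfield_nth)
    next
      case 4
      have "i \<noteq> ct" "i \<noteq> cn" "i \<noteq> cz"
        using 4 k by (simp_all add: nth_eq_iff_index_eq[OF enum_distinct] enum_7)
      moreover have "rfield h N (coords q) ! k = - (q $ i)"
      proof -
        obtain l where l: "k = 3 + l" using le_Suc_ex[OF 4] by blast
        have "coords q ! (3 + l) = q $ i" using coords_nth[OF k(1), of q] k(2) l by simp
        then show ?thesis using k(1) by (simp add: l rfield_def numeral_3_eq_3)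
      qed
      ultimately show ?thesis using pk by (simp add: real_point_def vfield_nth of_rat_minus)
    qed
  qed
  then show ?thesis unfolding infnorm_le_iff by blast
qed

lemma length_rfield: "length qs = 7 \<Longrightarrow> length (rfield h N qs) = 7"
  by (simp add: rfield_def)

section \<open>Computability of the field and of the sink\<close>

lemma infnorm_triangle_diff: "infnorm (x - z :: real ^ 'n) \<le> infnorm (x - y) + infnorm (y - z)"
  using infnorm_triangle[of "x - y" "y - z"] by simp

text \<open>The formulas are evaluated at a rational point near x, where floors and \<open>h\<close>
  can be computed. That this point may lie in another cell than x is harmless, because the field is
  Lipschitz.\<close>

lemma computable_vfield:
  assumes h: "cmp (\<lambda>\<Omega> p. h (fst p) (snd p))" shows "computable_function (vfield h)"
proof -
  obtain L where L: "L \<ge> 0" "\<And>x y. norm (vfield h x - vfield h y) \<le> L * norm (x - y)"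
    using vfield_Lipschitz by blast
  \<comment> \<open>In 14 the factor 7 compares the norms and the factor 2 leaves half of the error
    to the approximate step, whose share is 256 / 2^(n + 9).\<close>
  obtain c where c: "14 * L < 2 ^ c" using real_arch_pow[of 2 "14 * L"] by auto
  define F where "F = (\<lambda>(\<Omega> :: word \<Rightarrow> word) (w :: word). enc_rats (rfield h (2 ^ (length w + 9)) (read_rats 7 (\<Omega> (unary (length w + c))))))"
  have "cmp F" unfolding F_def by (intro cmp_intros cmp_rfield h)
  then obtain M where M: "\<And>\<Omega> w. outputs M \<Omega> w (F \<Omega> w)" using cmp_imp_machine by blast
  have "approximates M (oracle_word \<phi>) (vfield h x)" if \<phi>: "point_oracle \<phi> x" for x \<phi>
    unfolding approximates_def
  proof
    fix n
    let ?q = "\<phi> (n + c)" let ?N = "2 ^ (n + 9) :: nat"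
    have "length (rfield h ?N (coords ?q)) = CARD(7)" by (simp add: length_rfield)
    then obtain p :: "rat ^ 7" where p: "coords p = rfield h ?N (coords ?q)"
      using coords_exists by blast
    have "read_rats 7 (enc_point ?q) = coords ?q"
      using read_rats_enc_rats[of "coords ?q"] by (simp add: enc_point_coords)
    then have "F (oracle_word \<phi>) (unary n) = enc_point p"
      by (simp add: F_def oracle_word_def enc_point_coords p)
    then have "outputs M (oracle_word \<phi>) (unary n) (enc_point p)" using M by metis
    moreover have "infnorm (real_point p - vfield h x) \<le> (1 / 2) ^ n"
    proof -
      have "infnorm (vfield h (real_point ?q) - vfield h x) \<le> L * norm (real_point ?q - x)"
        using L(2) infnorm_le_norm order_trans by blast
      also have "\<dots> \<le> L * (7 * (1 / 2) ^ (n + c))"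
      proof (intro mult_left_mono L(1))
        have "norm (real_point ?q - x) \<le> 7 * infnorm (real_point ?q - x)"
          using norm_le_card_infnorm[of "real_point ?q - x"] by simp
        also have "\<dots> \<le> 7 * (1 / 2) ^ (n + c)"
          using \<phi> by (auto simp: point_oracle_def less_imp_le)
        finally show "norm (real_point ?q - x) \<le> 7 * (1 / 2) ^ (n + c)" .
      qed
      also have "\<dots> = 14 * L * (1 / 2) ^ c * ((1 / 2) ^ n / 2)" by (simp add: power_add)
      also have "\<dots> \<le> 1 * ((1 / 2) ^ n / 2)"
        using c by (intro mult_right_mono) (auto simp: power_one_over field_simps)
      finally have "infnorm (vfield h (real_point ?q) - vfield h x) \<le> (1 / 2) ^ n / 2" by simp
      moreover have "infnorm (real_point p - vfield h (real_point ?q)) \<le> 256 / real ?N"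
        by (rule rfield_approx[OF _ p]) simp
      moreover have "256 / real ?N = (1 / 2) ^ n / 2" by (simp add: power_add power_one_over)
      ultimately show ?thesis
        using infnorm_triangle_diff[of "real_point p" "vfield h x" "vfield h (real_point ?q)"] by linarith
    qed
    ultimately show "\<exists>p. outputs M (oracle_word \<phi>) (unary n) (enc_point p) \<and>
        infnorm (real_point p - vfield h x) \<le> (1 / 2) ^ n" by blast
  qed
  then show ?thesis unfolding computable_function_def by blast
qed

definition add_lists :: "rat list \<Rightarrow> rat list \<Rightarrow> rat list" where
  "add_lists xs ys = rev (fst (foldl (\<lambda>a x. ((x + hd (snd a)) # fst a, tl (snd a))) ([], ys) xs))"

lemma add_lists_eq: "length xs = length ys \<Longrightarrow> add_lists xs ys = map2 (+) xs ys"
proof -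
  assume "length xs = length ys"
  then have "rev (fst (foldl (\<lambda>a x. ((x + hd (snd a)) # fst a, tl (snd a))) (zs, ys) xs)) = rev zs @ map2 (+) xs ys" for zs
    by (induction xs ys arbitrary: zs rule: list_induct2) auto
  then show ?thesis by (simp add: add_lists_def)
qed

lemma coords_add: "coords (p + q) = add_lists (coords p) (coords q :: rat list)"
  by (subst add_lists_eq, simp, rule nth_equalityI) (auto simp: coords_def card_UNIV_length_enum)

lemma cmp_add_lists [cmp_intros]: "cmp F \<Longrightarrow> cmp G \<Longrightarrow> cmp (\<lambda>\<Omega> x. add_lists (F \<Omega> x) (G \<Omega> x))"
  unfolding add_lists_def by (intro cmp_intros)

definition rest_rat :: "rat ^ 7" where
  "rest_rat = (\<chi> i. if i = cz then 20 else 0)"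

lemma real_point_rest_rat: "real_point rest_rat = rest_point"
  by (simp add: real_point_def rest_rat_def rest_point_def vec_eq_iff)

lemma computable_rest_point: "computable_point rest_point"
proof -
  obtain M where "\<And>\<Omega> w. outputs M \<Omega> w (enc_point rest_rat)"
    using cmp_imp_machine[OF cmp_const] by blast
  then have "computable_oracle (\<lambda>_. rest_rat)" unfolding computable_oracle_def by blast
  moreover have "point_oracle (\<lambda>_. rest_rat) rest_point"
    by (simp add: point_oracle_def real_point_rest_rat infnorm_0)
  ultimately show ?thesis unfolding computable_point_def by blast
qed

text \<open>Near the sink g x = s - x up to a contraction, so x \<mapsto> x + g x is a contraction towards s.\<close>

lemma computable_sink: "computable_from_name (C1_neighbourhood (vfield h) (1 / 100)) (sink_of h)"
proof -
  define R where "R = (\<lambda>(\<Omega> :: word \<Rightarrow> word) (m :: nat) qs. add_lists qs (read_rats 7 (\<Omega> (False # enc_rats qs @ unary m))))"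
  define F where "F = (\<lambda>\<Omega> (w :: word). enc_rats ((R \<Omega> (length w + 2) ^^ (length w + 2)) (coords rest_rat)))"
  have "cmp F" unfolding F_def R_def by (intro cmp_intros)
  then obtain M where M: "\<And>\<Omega> w. outputs M \<Omega> w (F \<Omega> w)" using cmp_imp_machine by blast
  have "approximates M \<Omega> (sink_of h g)"
    if g: "g \<in> C1_neighbourhood (vfield h) (1 / 100)" and \<Omega>: "function_name \<Omega> g" for g \<Omega>
    unfolding approximates_def
  proof
    fix n :: nat
    obtain \<psi> where \<psi>: "\<And>q m. \<Omega> (False # enc_point q @ unary m) = enc_point (\<psi> q m)"
      "\<And>q m. infnorm (real_point (\<psi> q m) - g (real_point q)) < (1 / 2) ^ m"
      using \<Omega> unfolding function_name_def by blast
    \<comment> \<open>The final error is three times 2^(- m), hence the two extra digits.\<close>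
    define m :: nat where "m = n + 2"
    define X where "X = (\<lambda>k. ((\<lambda>q. q + \<psi> q m) ^^ k) rest_rat)"
    let ?s = "sink_of h g" and ?\<eta> = "(1 / 2 :: real) ^ m"
    have m: "?\<eta> \<le> 1 / 4" by (simp add: m_def power_one_over field_simps)
    have coordsX: "(R \<Omega> m ^^ k) (coords rest_rat) = coords (X k)" for k
    proof (induction k)
      case (Suc k)
      have "read_rats 7 (enc_point (\<psi> (X k) m)) = coords (\<psi> (X k) m)"
        using read_rats_enc_rats[of "coords (\<psi> (X k) m)"] by (simp add: enc_point_coords)
      then have "R \<Omega> m (coords (X k)) = coords (X k + \<psi> (X k) m)"
        by (simp add: R_def coords_add \<psi>(1) flip: enc_point_coords)
      then show ?case using Suc.IH by (simp add: X_def)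
    qed (simp add: X_def)
    \<comment> \<open>The first bound keeps the iterates where g is linear up to the perturbation.
      For the second, each round contracts by 1/100 and adds at most one error of the name.\<close>
    have inv: "infnorm (real_point (X k) - rest_point) \<le> 1 \<and>
        infnorm (real_point (X k) - ?s) \<le> (1 / 2) ^ k + 2 * ?\<eta>" for k
    proof (induction k)
      case 0
      have "infnorm (rest_point - ?s) \<le> 1 / 100"
        using sink_in_box[OF g] by (metis infnorm_sub)
      also have "\<dots> \<le> 1 + 2 * ?\<eta>" by simp
      finally show ?case by (simp add: X_def real_point_rest_rat infnorm_0)
    next
      case (Suc k)
      let ?x = "real_point (X k)" and ?p = "perturbation h g"
      define err where "err = real_point (\<psi> (X k) m) - g ?x"
      have err: "infnorm err \<le> ?\<eta>" using \<psi>(2)[of "X k" m] by (simp add: err_def)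
      have "real_point (X (Suc k)) = ?x + real_point (\<psi> (X k) m)"
        by (simp add: X_def real_point_def vec_eq_iff of_rat_add)
      then have step: "real_point (X (Suc k)) = ?x + g ?x + err" by (simp add: err_def)
      have "g ?x = (?s - ?x) - (?p ?x - ?p ?s)" using Suc.IH by (intro g_near_rest[OF g]) simp
      then have e: "real_point (X (Suc k)) - ?s = err - (?p ?x - ?p ?s)" unfolding step by simp
      have "infnorm (real_point (X (Suc k)) - ?s) \<le> infnorm err + infnorm (?p ?x - ?p ?s)"
        unfolding e using infnorm_triangle[of err "- (?p ?x - ?p ?s)"] by (simp only: infnorm_neg diff_conv_add_uminus)
      then have 1: "infnorm (real_point (X (Suc k)) - ?s) \<le> ?\<eta> + 1 / 100 * infnorm (?x - ?s)"
        using err p_Lipschitz[OF g, of ?x ?s] by linarith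
      have "infnorm (?x - ?s) \<le> (1 / 2) ^ k + 2 * ?\<eta>" using Suc.IH by blast
      moreover have "0 \<le> (1 / 2 :: real) ^ k" "0 \<le> ?\<eta>" by simp_all
      ultimately have 2: "infnorm (real_point (X (Suc k)) - ?s) \<le> (1 / 2) ^ Suc k + 2 * ?\<eta>"
        using 1 unfolding power_Suc by linarith
      have "infnorm (?x - ?s) \<le> 101 / 100"
        using infnorm_triangle_diff[of ?x ?s rest_point] Suc.IH sink_in_box[OF g] infnorm_sub[of ?s rest_point] by simp
      then have "infnorm (real_point (X (Suc k)) - ?s) \<le> 1 / 2" using 1 m by linarith
      then have "infnorm (real_point (X (Suc k)) - rest_point) \<le> 1"
        using infnorm_triangle_diff[of "real_point (X (Suc k))" rest_point ?s] sink_in_box[OF g] by linarith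
      then show ?case using 2 by blast
    qed
    have "F \<Omega> (unary n) = enc_point (X m)"
      using coordsX[of m] by (simp add: F_def enc_point_coords m_def)
    then have "outputs M \<Omega> (unary n) (enc_point (X m))" using M by metis
    moreover have "(1 / 2) ^ m + 2 * ?\<eta> \<le> (1 / 2 :: real) ^ n" by (simp add: m_def power_add)
    then have "infnorm (real_point (X m) - ?s) \<le> (1 / 2) ^ n" using inv[of m] by linarith
    ultimately show "\<exists>p. outputs M \<Omega> (unary n) (enc_point p) \<and> infnorm (real_point p - ?s) \<le> (1 / 2) ^ n"
      by blast
  qed
  then show ?thesis unfolding computable_from_name_def by blast
qed


section \<open>Non-computability of the basins\<close>

definition channel_rat :: "nat \<Rightarrow> rat ^ 7" where
  "channel_rat m = (\<chi> i. if i = cn then of_nat m + 1 / 2 else 0)"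

lemma real_point_channel_rat: "real_point (channel_rat m) = channel_point m"
  by (simp add: real_point_def channel_rat_def channel_point_def vec_eq_iff of_rat_add of_rat_divide)

text \<open>The answer word for the diagonal construction: every query about the centre of channel e
  + 1 can be answered by it.\<close>

lemma cmp_channel_word: "cmp (\<lambda>\<Omega> e. enc_point (channel_rat (Suc e)))"
proof -
  have "coords (channel_rat m) = [0, of_nat m + 1 / 2, 0, 0, 0, 0, 0]" for m
  proof (rule nth_equalityI)
    fix k assume "k < length (coords (channel_rat m))"
    then have k: "k < 7" by simp
    then have "enum_class.enum ! k = cn \<longleftrightarrow> k = Suc 0"
      by (subst nth_eq_iff_index_eq[OF enum_distinct]) (simp_all add: enum_7)
    then have "coords (channel_rat m) ! k = (if k = Suc 0 then of_nat m + 1 / 2 else 0)"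
      by (simp add: coords_nth[OF k] channel_rat_def)
    moreover have "k \<in> {0, 1, 2, 3, 4, 5, 6}" using k by auto
    ultimately show "coords (channel_rat m) ! k = [0, of_nat m + 1 / 2, 0, 0, 0, 0, 0] ! k"
      by auto
  qed simp
  then have "enc_point (channel_rat (Suc e)) = enc_rats [0, of_nat (Suc e) + 1 / 2, 0, 0, 0, 0, 0]" for e
    by (simp only: enc_point_coords)
  then show ?thesis by (simp only:) (intro cmp_intros)
qed

lemma near_zero_iff: "near_zero (enc_rat r) \<longleftrightarrow> \<bar>of_rat r :: real\<bar> \<le> 1 / 16"
proof -
  have "(of_rat r :: real) = of_int (numer r) / of_nat (denom r)"
    by (subst numer_denom[of r]) (simp add: of_rat_divide)
  then have "\<bar>of_rat r :: real\<bar> = real (nat \<bar>numer r\<bar>) / real (denom r)"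
    by (simp add: abs_divide)
  moreover have "a / b \<le> 1 / 16 \<longleftrightarrow> 16 * a \<le> b" if "b > 0" for a b :: real
    using that by (simp add: field_simps)
  ultimately have "\<bar>of_rat r :: real\<bar> \<le> 1 / 16 \<longleftrightarrow> real (16 * nat \<bar>numer r\<bar>) \<le> real (denom r)"
    by simp
  then show ?thesis unfolding near_zero_enc_rat by (simp only: of_nat_le_iff)
qed

lemma enc_point_1: "enc_point (p :: rat ^ 1) = enc_rat (p $ 1)"
  by (simp add: enc_point_def enum_num1_def)

text \<open>At the centre of channel e + 1 the distance is at least 1/8 if the channel is lifted and
  0 otherwise, so an output with error 1/32 is at most 1/16 exactly in the second case;
  \<open>diag\<close> says exactly in the first. Channel 0 provides a point of the
  complement.\<close>

lemma not_computable_from_channels: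
  fixes U :: "(real ^ 7) set"
  assumes diag: "\<And>M. \<exists>e. (\<exists>k. h k e) \<longleftrightarrow>
      (\<exists>v. outputs M (\<lambda>_. enc_point (channel_rat (Suc e))) (unary 5) v \<and> near_zero v)"
    and out: "channel_point 0 \<notin> U" "\<And>e. \<not> (\<exists>k. h k e) \<Longrightarrow> channel_point (Suc e) \<notin> U"
    and inside: "\<And>e k x. h k e \<Longrightarrow> infnorm (x - channel_point (Suc e)) \<le> 1 / 8 \<Longrightarrow> x \<in> U"
  shows "\<not> computable_open_set U"
proof
  let ?d = "\<lambda>x. INF y \<in> - U. infnorm (y - x)"
  assume "computable_open_set U"
  moreover have "U \<noteq> UNIV" using out(1) by blast
  ultimately obtain M where M: "\<And>x \<phi>. point_oracle \<phi> x \<Longrightarrow> approximates M (oracle_word \<phi>) (vec (?d x) :: real ^ 1)"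
    unfolding computable_open_set_def computable_function_def by blast
  obtain e where e: "(\<exists>k. h k e) \<longleftrightarrow>
      (\<exists>v. outputs M (\<lambda>_. enc_point (channel_rat (Suc e))) (unary 5) v \<and> near_zero v)"
    using diag by blast
  let ?x = "channel_point (Suc e)"
  \<comment> \<open>The centre is rational and serves as its own approximation at every
    precision.\<close>
  have "point_oracle (\<lambda>_. channel_rat (Suc e)) ?x"
    by (simp add: point_oracle_def real_point_channel_rat infnorm_0)
  from M[OF this] have "approximates M (\<lambda>_. enc_point (channel_rat (Suc e))) (vec (?d ?x) :: real ^ 1)"
    by (simp add: oracle_word_def[abs_def])
  then obtain p :: "rat ^ 1" where p: "outputs M (\<lambda>_. enc_point (channel_rat (Suc e))) (unary 5) (enc_point p)"
    "infnorm (real_point p - vec (?d ?x)) \<le> (1 / 2) ^ 5"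
    unfolding approximates_def by blast
  have "\<bar>(real_point p - vec (?d ?x)) $ 1\<bar> \<le> (1 / 2) ^ 5"
    using p(2) unfolding infnorm_le_iff by blast
  then have r: "\<bar>of_rat (p $ 1) - ?d ?x\<bar> \<le> 1 / 32" by (simp add: real_point_def power_one_over)
  have "(\<exists>v. outputs M (\<lambda>_. enc_point (channel_rat (Suc e))) (unary 5) v \<and> near_zero v) \<longleftrightarrow> near_zero (enc_point p)"
    using p(1) outputs_unique by blast
  then have iff: "(\<exists>k. h k e) \<longleftrightarrow> \<bar>of_rat (p $ 1) :: real\<bar> \<le> 1 / 16"
    using e near_zero_iff by (simp add: enc_point_1)
  show False
  proof (cases "\<exists>k. h k e")
    case True
    then obtain k where k: "h k e" by blast
    have "1 / 8 \<le> ?d ?x"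
    proof (rule cINF_greatest)
      show "- U \<noteq> {}" using out(1) by blast
      fix y assume "y \<in> - U"
      then show "1 / 8 \<le> infnorm (y - ?x)" using inside[OF k, of y] by force
    qed
    moreover have "\<bar>of_rat (p $ 1) :: real\<bar> \<le> 1 / 16" using iff True by blast
    ultimately show False using r unfolding abs_le_iff by linarith
  next
    case False
    have "bdd_below ((\<lambda>y. infnorm (y - ?x)) ` (- U))"
      by (rule bdd_belowI2[of _ 0]) (rule infnorm_pos_le)
    then have "?d ?x \<le> infnorm (?x - ?x)" using out(2)[OF False] by (intro cINF_lower) auto
    moreover have "0 \<le> ?d ?x"
      using out(1) infnorm_pos_le by (intro cINF_greatest) auto
    ultimately have "?d ?x = 0" by (simp add: infnorm_0)
    then have "\<bar>of_rat (p $ 1) :: real\<bar> \<le> 1 / 16" using r by simp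
    then show False using iff False by blast
  qed
qed

text \<open>The unperturbed field is thereby covered by the results on perturbed ones.\<close>

lemma vfield_in_neighbourhood: "vfield h \<in> C1_neighbourhood (vfield h) \<epsilon>" if "\<epsilon> \<ge> 0"
proof -
  have "jacobian (\<lambda>x. 0 :: real ^ 7) (at x) = 0" for x :: "real ^ 7"
    by (simp add: jacobian_def frechet_derivative_const matrix_def vec_eq_iff)
  moreover have "mat_norm (0 :: real ^ 7 ^ 7) \<le> 0"
  proof -
    let ?v = "axis ct 1 :: real ^ 7"
    have "infnorm ?v > 0" by (simp add: infnorm_pos_lt axis_eq_0_iff)
    then have "infnorm ((1 / infnorm ?v) *\<^sub>R ?v) = 1" by (simp add: infnorm_mul)
    then show ?thesis unfolding mat_norm_def by (intro cSUP_least) (auto simp: infnorm_0)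
  qed
  ultimately have "mat_norm (jacobian (\<lambda>x. 0 :: real ^ 7) (at x)) = 0" for x :: "real ^ 7"
    using mat_norm_nonneg[of "0 :: real ^ 7 ^ 7"] by simp
  then have "C1_norm (\<lambda>x. vfield h x - vfield h x) = 0"
    by (simp add: C1_norm_def infnorm_0 zero_ereal_def[symmetric])
  then show ?thesis using that by (simp add: C1_neighbourhood_def smooth_vfield)
qed

theorem theoremA:
  shows "\<exists>(f :: real ^ 7 \<Rightarrow> real ^ 7) s\<^sub>0.
    C_infinity f \<and> computable_function f \<and>
    is_sink f s\<^sub>0 \<and> computable_point s\<^sub>0 \<and>
    \<not> computable_open_set (basin f s\<^sub>0) \<and>
    (\<exists>\<epsilon>>0. \<exists>s :: (real ^ 7 \<Rightarrow> real ^ 7) \<Rightarrow> real ^ 7.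
       (\<forall>g \<in> C1_neighbourhood f \<epsilon>.
          is_sink g (s g) \<and> \<not> computable_open_set (basin g (s g))) \<and>
       computable_from_name (C1_neighbourhood f \<epsilon>) s \<and>
       (\<forall>\<delta>>0. \<exists>\<eta>>0. \<forall>g \<in> C1_neighbourhood f \<epsilon> \<inter> C1_neighbourhood f \<eta>.
          infnorm (s g - s\<^sub>0) < \<delta>))"
proof -
  obtain h :: "nat \<Rightarrow> nat \<Rightarrow> bool" where h: "cmp (\<lambda>\<Omega> p. h (fst p) (snd p))"
    and diag: "\<And>M. \<exists>e. (\<exists>k. h k e) \<longleftrightarrow>
      (\<exists>v. outputs M (\<lambda>_. enc_point (channel_rat (Suc e))) (unary 5) v \<and> near_zero v)"
    using diagonal[OF cmp_channel_word, of "unary 5"] by blast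
  \<comment> \<open>Shifting the index by one leaves channel 0 without kicks.\<close>
  define H where "H = (\<lambda>k m. 0 < m \<and> h k (m - 1))"
  have "cmp (\<lambda>\<Omega> p. H (fst p) (snd p))"
    unfolding H_def by (intro cmp_intros cmp_app2[OF h])
  then have comp: "computable_function (vfield H)" by (rule computable_vfield)
  let ?N = "C1_neighbourhood (vfield H) (1 / 100)"
  have basin: "\<not> computable_open_set (basin g (sink_of H g))" if g: "g \<in> ?N" for g
  proof (rule not_computable_from_channels[OF diag])
    show "channel_point 0 \<notin> basin g (sink_of H g)"
      by (rule channel_not_in_basin[OF g]) (simp add: H_def)
    show "channel_point (Suc e) \<notin> basin g (sink_of H g)" if "\<not> (\<exists>k. h k e)" for e
      by (rule channel_not_in_basin[OF g]) (use that in \<open>simp add: H_def\<close>)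
    show "x \<in> basin g (sink_of H g)" if "h k e" "infnorm (x - channel_point (Suc e)) \<le> 1 / 8" for e k x
      by (rule channel_ball_in_basin[OF g _ that(2), of k]) (use that(1) in \<open>simp add: H_def\<close>)
  qed
  have f: "vfield H \<in> ?N" by (rule vfield_in_neighbourhood) simp
  \<comment> \<open>For the zero perturbation the fixed point equation reduces to this
    equality.\<close>
  have s0: "sink_of H (vfield H) = rest_point"
    using sink_fixpoint[OF f] by (simp add: perturbation_def)
  have near: "infnorm (sink_of H g - rest_point) \<le> \<eta>" if "g \<in> ?N" "g \<in> C1_neighbourhood (vfield H) \<eta>" for g \<eta>
  proof (rule sink_near_rest[OF that(1)])
    have "C1_norm (perturbation H g) \<le> ereal \<eta>"
      using that(2) unfolding C1_neighbourhood_def perturbation_def[abs_def] by blast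
    then show "infnorm (perturbation H g x) \<le> \<eta>" for x by (rule C1_norm_le(1))
  qed
  show ?thesis
  proof (intro exI conjI)
    show "C_infinity (vfield H)" by (rule smooth_vfield)
    show "computable_function (vfield H)" by (rule comp)
    show "is_sink (vfield H) rest_point" using is_sink_sink[OF f] s0 by simp
    show "computable_point rest_point" by (rule computable_rest_point)
    show "\<not> computable_open_set (basin (vfield H) rest_point)" using basin[OF f] s0 by simp
    show "(0 :: real) < 1 / 100" by simp
    show "\<forall>g \<in> ?N. is_sink g (sink_of H g) \<and> \<not> computable_open_set (basin g (sink_of H g))"
      using is_sink_sink basin by blast
    show "computable_from_name ?N (sink_of H)" by (rule computable_sink)
    show "\<forall>\<delta>>0. \<exists>\<eta>>0. \<forall>g \<in> ?N \<inter> C1_neighbourhood (vfield H) \<eta>. infnorm (sink_of H g - rest_point) < \<delta>"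
    proof (intro allI impI)
      fix \<delta> :: real assume "\<delta> > 0"
      then show "\<exists>\<eta>>0. \<forall>g \<in> ?N \<inter> C1_neighbourhood (vfield H) \<eta>. infnorm (sink_of H g - rest_point) < \<delta>"
        using near by (intro exI[of _ "\<delta> / 2"]) force
    qed
  qed
qed

end
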